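(* Consider the multi-scale LDDMM optimal control problem of minimizing $$\frac12\int_0^1\|v(t,\cdot,\cdot)\|_{\mathbb W}^2\,dt+G(\varphi(1,\cdot,\cdot))$$ over $v\in L^2([0,1],\mathbb W)$, subject to $$\varphi(t,\lambda,x)=x+\int_0^t v(\tau,\lambda,\varphi(\tau,\lambda,x))\,d\tau\qquad(t\in[0,1],\ \lambda\in[s_1,s_2],\ x\in\mathbb R^d).$$ Minimizing sequences for this problem are bounded and have subsequences that converge weakly, and minimizers always exist, as soon as $G$ is lower semi-continuous for the uniform convergence on compact subsets.
   Context: Let $[s_1,s_2]$ be a range of positive scales ($s_1>0$). Let $V$ be a reproducing kernel Hilbert space (RKHS) of vector fields on $\mathbb R^d$, continuously embedded in $C^p_0(\mathbb R^d,\mathbb R^d)$ for $p$ large enough (with $p\ge1$), where $C^p_0(\mathbb R^d,\mathbb R^d)$ is the Banach space of $C^p$ functions $w$ which tend to $0$ at infinity together with their derivatives up to order $p$, with the maximum of the supremum norms of $w$ and of these derivatives as norm. $\mathbb V=H^1((s_1,s_2),V)$ is the Hilbert space of square-integrable functions $v:(s_1,s_2)\to V$ with square-integrable weak derivative $\partial_\lambda v$ (Bochner sense). Each $v\in\mathbb V$ is identified with its continuous version on $[s_1,s_2]$; write $v(\lambda,x)=v(\lambda)(x)$. Set $W_0=V$ and let $(W_\lambda)_{\lambda\in[s_1,s_2]}$ be a nested family of RKHS's with Hilbert norms $\|\cdot\|_\lambda$ (with $\|\cdot\|_0=\|\cdot\|_V$), such that $W_\lambda$ is continuously embedded in $W_\mu$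 for all $\lambda,\mu\in\{0\}\cup[s_1,s_2]$ with $\mu<\lambda$. Let $c_{\lambda,\mu}$ be the operator norm of this embedding; it is assumed that $C:=\sup\{c_{\lambda,\mu}:\mu,\lambda\in\{0\}\cup[s_1,s_2],\ \mu<\lambda\}<\infty$. Fix a positive measure $\rho$ on $[s_1,s_2]$. $\mathbb W$ is the subspace of $\mathbb V$ consisting of functions $v$ such that $v(\lambda)$ and $\partial_\lambda v(\lambda)$ belong to $W_\lambda$ for a.e. $\lambda\in[s_1,s_2]$ and such that $\|v\|_{\mathbb W}^2:=\int_{[s_1,s_2]}\|v(\lambda)\|_\lambda^2\,d\rho(\lambda)+\int_{s_1}^{s_2}\|\partial_\lambda v(\lambda)\|_\lambda^2\,d\lambda<\infty$. With this norm $\mathbb W$ is a Hilbert space (indeed an RKHS). For $v\in L^2([0,1],\mathbb W)$ write $v(t,\lambda,x)=v(t)(\lambda,x)$. The flow equation in the claim has a unique solution $\varphi$, which is continuous in $(\lambda,x)$. The end-cost $G$ is a real-valued function of the scale-dependent map $\varphi(1,\cdot,\cdot):[s_1,s_2]\times\mathbb R^d\to\mathbb R^d$, and "compact subsets" refers to compact subsets of $[s_1,s_2]\times\mathbb R^d$.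
   Formalization: The end-cost G is additionally assumed bounded below on continuous scale-dependent maps; without this the claim fails, e.g. for G(f) = -|f(s1,0)|^4, where the infimum is minus infinity and no minimizer exists. *)

theory Defs
  imports "HOL-Analysis.Analysis" "HOL-Library.Function_Algebras"
begin

text \<open>
  Spaces of vector fields, and of functions with values in them, are handled as carrier sets
  inside function types, with pointwise linear structure. A norm is a separate real function,
  meaningful on its carrier only.
\<close>

instantiation "fun" :: (type, real_vector) real_vector
begin

definition scaleR_fun :: "real \<Rightarrow> ('a \<Rightarrow> 'b) \<Rightarrow> 'a \<Rightarrow> 'b" where
  "scaleR_fun c f = (\<lambda>x. c *\<^sub>R f x)"

instance
  by standard (simp_all add: scaleR_fun_def fun_eq_iff algebra_simps)

end


section \<open>Hilbert spaces given by a carrier and a norm\<close>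

definition inner_product_on :: "'a::real_vector set \<Rightarrow> ('a \<Rightarrow> 'a \<Rightarrow> real) \<Rightarrow> bool" where
  "inner_product_on S ip \<longleftrightarrow>
     (\<forall>x\<in>S. \<forall>y\<in>S. ip x y = ip y x) \<and>
     (\<forall>x\<in>S. \<forall>y\<in>S. \<forall>z\<in>S. ip (x + y) z = ip x z + ip y z) \<and>
     (\<forall>c. \<forall>x\<in>S. \<forall>y\<in>S. ip (c *\<^sub>R x) y = c * ip x y) \<and>
     (\<forall>x\<in>S. x \<noteq> 0 \<longrightarrow> 0 < ip x x)"

definition complete_norm_on :: "'a::real_vector set \<Rightarrow> ('a \<Rightarrow> real) \<Rightarrow> bool" where
  "complete_norm_on S N \<longleftrightarrow>
     (\<forall>u. (\<forall>n. u n \<in> S) \<longrightarrow> (\<forall>e>0. \<exists>M::nat. \<forall>m\<ge>M. \<forall>n\<ge>M. N (u m - u n) < e) \<longrightarrow>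
          (\<exists>l\<in>S. (\<lambda>n. N (u n - l)) \<longlonglongrightarrow> 0))"

definition hilbert_space_on :: "'a::real_vector set \<Rightarrow> ('a \<Rightarrow> real) \<Rightarrow> bool" where
  "hilbert_space_on S N \<longleftrightarrow>
     subspace S \<and>
     (\<exists>ip. inner_product_on S ip \<and> (\<forall>x\<in>S. N x = sqrt (ip x x))) \<and>
     complete_norm_on S N"

definition bounded_functional_on :: "'a::real_vector set \<Rightarrow> ('a \<Rightarrow> real) \<Rightarrow> ('a \<Rightarrow> real) \<Rightarrow> bool" where
  "bounded_functional_on S N l \<longleftrightarrow>
     (\<forall>x\<in>S. \<forall>y\<in>S. l (x + y) = l x + l y) \<and>
     (\<forall>c. \<forall>x\<in>S. l (c *\<^sub>R x) = c * l x) \<and>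
     (\<exists>K. \<forall>x\<in>S. \<bar>l x\<bar> \<le> K * N x)"

definition weakly_converges_on ::
  "'a::real_vector set \<Rightarrow> ('a \<Rightarrow> real) \<Rightarrow> (nat \<Rightarrow> 'a) \<Rightarrow> 'a \<Rightarrow> bool" where
  "weakly_converges_on S N u x \<longleftrightarrow>
     (\<forall>n. u n \<in> S) \<and> x \<in> S \<and>
     (\<forall>l. bounded_functional_on S N l \<longrightarrow> (\<lambda>n. l (u n)) \<longlonglongrightarrow> l x)"

definition continuously_embedded ::
  "'a::real_vector set \<Rightarrow> ('a \<Rightarrow> real) \<Rightarrow> 'a set \<Rightarrow> ('a \<Rightarrow> real) \<Rightarrow> bool" where
  "continuously_embedded S N T M \<longleftrightarrow> S \<subseteq> T \<and> (\<exists>K. \<forall>x\<in>S. M x \<le> K * N x)"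

definition embedding_norm :: "'a::real_vector set \<Rightarrow> ('a \<Rightarrow> real) \<Rightarrow> ('a \<Rightarrow> real) \<Rightarrow> real" where
  "embedding_norm S N M = (SUP x\<in>{x\<in>S. N x \<le> 1}. M x)"

definition rkhs :: "('x \<Rightarrow> 'e::real_normed_vector) set \<Rightarrow> (('x \<Rightarrow> 'e) \<Rightarrow> real) \<Rightarrow> bool" where
  "rkhs S N \<longleftrightarrow> hilbert_space_on S N \<and> (\<forall>x. \<exists>K. \<forall>f\<in>S. norm (f x) \<le> K * N f)"


section \<open>The space of C^p vector fields vanishing at infinity\<close>

text \<open>\<open>iter_deriv [u\<^sub>1, \<dots>, u\<^sub>k] f x\<close> is the k-th derivative of f at x, applied to
  the directions \<open>u\<^sub>k, \<dots>, u\<^sub>1\<close>.\<close>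

fun iter_deriv ::
  "'a::real_normed_vector list \<Rightarrow> ('a \<Rightarrow> 'b::real_normed_vector) \<Rightarrow> 'a \<Rightarrow> 'b" where
  "iter_deriv [] f = f"
| "iter_deriv (u # us) f = (\<lambda>x. frechet_derivative (iter_deriv us f) (at x) u)"

definition C0_space :: "nat \<Rightarrow> (real^'n \<Rightarrow> real^'n) set" where
  "C0_space p = {f.
     (\<forall>us. length us < p \<longrightarrow> (\<forall>x. iter_deriv us f differentiable at x)) \<and>
     (\<forall>us. length us \<le> p \<longrightarrow>
        continuous_on UNIV (iter_deriv us f) \<and> (iter_deriv us f \<longlongrightarrow> 0) at_infinity)}"

text \<open>Taking the supremum over unit directions gives the operator norm of each derivative.\<close>

definition C0_norm :: "nat \<Rightarrow> (real^'n \<Rightarrow> real^'n) \<Rightarrow> real" where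
  "C0_norm p f =
     Sup {norm (iter_deriv us f x) | us x. length us \<le> p \<and> (\<forall>u\<in>set us. norm u = 1)}"


section \<open>Bochner measurability, integral and L2 spaces\<close>

text \<open>The Bochner integral of the library needs a separable Banach space as target type. The
  following transcribes its definition to a carrier with a norm.\<close>

definition strongly_measurable_on ::
  "'a::real_vector set \<Rightarrow> ('a \<Rightarrow> real) \<Rightarrow> 't measure \<Rightarrow> ('t \<Rightarrow> 'a) \<Rightarrow> bool" where
  "strongly_measurable_on S N M f \<longleftrightarrow>
     (\<forall>t\<in>space M. f t \<in> S) \<and>
     (\<exists>s. (\<forall>i::nat. simple_function M (s i) \<and> s i ` space M \<subseteq> S) \<and>
          (AE t in M. (\<lambda>i. N (s i t - f t)) \<longlonglongrightarrow> 0))"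

definition has_bochner_integral_on ::
  "'a::real_vector set \<Rightarrow> ('a \<Rightarrow> real) \<Rightarrow> 't measure \<Rightarrow> ('t \<Rightarrow> 'a) \<Rightarrow> 'a \<Rightarrow> bool" where
  "has_bochner_integral_on S N M f I \<longleftrightarrow>
     strongly_measurable_on S N M f \<and> I \<in> S \<and>
     (\<exists>s. (\<forall>i::nat. Bochner_Integration.simple_bochner_integrable M (s i) \<and> s i ` space M \<subseteq> S) \<and>
          (\<lambda>i. \<integral>\<^sup>+t. ennreal (N (f t - s i t)) \<partial>M) \<longlonglongrightarrow> 0 \<and>
          (\<lambda>i. N (Bochner_Integration.simple_bochner_integral M (s i) - I)) \<longlonglongrightarrow> 0)"

text \<open>Elements of an L2 space are functions, not classes modulo almost everywhere equality; a
  bounded functional is automatically invariant under that equality.\<close>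

definition L2_space ::
  "'a::real_vector set \<Rightarrow> ('a \<Rightarrow> real) \<Rightarrow> 't measure \<Rightarrow> ('t \<Rightarrow> 'a) set" where
  "L2_space S N M =
     {f. strongly_measurable_on S N M f \<and> (\<integral>\<^sup>+t. ennreal ((N (f t))\<^sup>2) \<partial>M) < \<infinity>}"

definition L2_norm :: "('a \<Rightarrow> real) \<Rightarrow> 't measure \<Rightarrow> ('t \<Rightarrow> 'a) \<Rightarrow> real" where
  "L2_norm N M f = sqrt (LINT t|M. (N (f t))\<^sup>2)"


section \<open>The space H1((a,b),V)\<close>

definition test_function :: "real \<Rightarrow> real \<Rightarrow> (real \<Rightarrow> real) \<Rightarrow> bool" where
  "test_function a b \<theta> \<longleftrightarrow>
     (\<forall>k x. ((deriv ^^ k) \<theta>) differentiable at x) \<and> closure {x. \<theta> x \<noteq> 0} \<subseteq> {a<..<b}"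

definition weak_derivative ::
  "'a::real_vector set \<Rightarrow> ('a \<Rightarrow> real) \<Rightarrow> real \<Rightarrow> real \<Rightarrow> (real \<Rightarrow> 'a) \<Rightarrow> (real \<Rightarrow> 'a) \<Rightarrow> bool" where
  "weak_derivative V N a b v w \<longleftrightarrow>
     (\<forall>\<theta>. test_function a b \<theta> \<longrightarrow>
        (\<exists>I. has_bochner_integral_on V N (lebesgue_on {a<..<b}) (\<lambda>l. deriv \<theta> l *\<^sub>R v l) I \<and>
             has_bochner_integral_on V N (lebesgue_on {a<..<b}) (\<lambda>l. \<theta> l *\<^sub>R w l) (- I)))"

text \<open>Elements of H1 are represented by their continuous versions on \<open>[a,b]\<close>, extended by 0
  outside \<open>[a,b]\<close> so that the representing function is unique.\<close>

definition H1_space ::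
  "'a::real_vector set \<Rightarrow> ('a \<Rightarrow> real) \<Rightarrow> real \<Rightarrow> real \<Rightarrow> (real \<Rightarrow> 'a) set" where
  "H1_space V N a b = {v.
     (\<forall>l\<in>{a..b}. v l \<in> V \<and> ((\<lambda>m. N (v m - v l)) \<longlongrightarrow> 0) (at l within {a..b})) \<and>
     (\<forall>l. l \<notin> {a..b} \<longrightarrow> v l = 0) \<and>
     v \<in> L2_space V N (lebesgue_on {a<..<b}) \<and>
     (\<exists>w\<in>L2_space V N (lebesgue_on {a<..<b}). weak_derivative V N a b v w)}"

text \<open>The derivative is only determined almost everywhere on \<open>(a,b)\<close>.\<close>

definition H1_deriv ::
  "'a::real_vector set \<Rightarrow> ('a \<Rightarrow> real) \<Rightarrow> real \<Rightarrow> real \<Rightarrow> (real \<Rightarrow> 'a) \<Rightarrow> real \<Rightarrow> 'a" where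
  "H1_deriv V N a b v =
     (SOME w. w \<in> L2_space V N (lebesgue_on {a<..<b}) \<and> weak_derivative V N a b v w)"


section \<open>The space of multi-scale vector fields\<close>

type_synonym 'n vfield = "real^'n \<Rightarrow> real^'n"

definition ext_norm ::
  "(real \<Rightarrow> 'n::finite vfield set) \<Rightarrow> (real \<Rightarrow> 'n vfield \<Rightarrow> real) \<Rightarrow> real \<Rightarrow> 'n vfield \<Rightarrow> ennreal" where
  "ext_norm W nrm l f = (if f \<in> W l then ennreal (nrm l f) else \<infinity>)"

definition WW_norm2 ::
  "real \<Rightarrow> real \<Rightarrow> (real \<Rightarrow> 'n::finite vfield set) \<Rightarrow> (real \<Rightarrow> 'n vfield \<Rightarrow> real) \<Rightarrow> real measure \<Rightarrow>
   (real \<Rightarrow> 'n vfield) \<Rightarrow> ennreal" where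
  "WW_norm2 s1 s2 W nrm \<rho> v =
     (\<integral>\<^sup>+l. (ext_norm W nrm l (v l))\<^sup>2 \<partial>completion \<rho>) +
     (\<integral>\<^sup>+l. (ext_norm W nrm l (H1_deriv (W 0) (nrm 0) s1 s2 v l))\<^sup>2 \<partial>lebesgue_on {s1<..<s2})"

text \<open>The two measurability conditions are the ones under which the integrals defining the norm
  make sense. The space V is \<open>W 0\<close>.\<close>

definition WW ::
  "real \<Rightarrow> real \<Rightarrow> (real \<Rightarrow> 'n::finite vfield set) \<Rightarrow> (real \<Rightarrow> 'n vfield \<Rightarrow> real) \<Rightarrow> real measure \<Rightarrow>
   (real \<Rightarrow> 'n vfield) set" where
  "WW s1 s2 W nrm \<rho> = {v \<in> H1_space (W 0) (nrm 0) s1 s2.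
     (AE l in lebesgue_on {s1<..<s2}. v l \<in> W l \<and> H1_deriv (W 0) (nrm 0) s1 s2 v l \<in> W l) \<and>
     (\<lambda>l. ext_norm W nrm l (v l)) \<in> borel_measurable (completion \<rho>) \<and>
     (\<lambda>l. ext_norm W nrm l (H1_deriv (W 0) (nrm 0) s1 s2 v l))
        \<in> borel_measurable (lebesgue_on {s1<..<s2}) \<and>
     WW_norm2 s1 s2 W nrm \<rho> v < \<infinity>}"

definition WW_norm ::
  "real \<Rightarrow> real \<Rightarrow> (real \<Rightarrow> 'n::finite vfield set) \<Rightarrow> (real \<Rightarrow> 'n vfield \<Rightarrow> real) \<Rightarrow> real measure \<Rightarrow>
   (real \<Rightarrow> 'n vfield) \<Rightarrow> real" where
  "WW_norm s1 s2 W nrm \<rho> v = sqrt (enn2real (WW_norm2 s1 s2 W nrm \<rho> v))"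


section \<open>The optimal control problem\<close>

type_synonym 'n scale_map = "real \<Rightarrow> real^'n \<Rightarrow> real^'n"

definition controls ::
  "real \<Rightarrow> real \<Rightarrow> (real \<Rightarrow> 'n::finite vfield set) \<Rightarrow> (real \<Rightarrow> 'n vfield \<Rightarrow> real) \<Rightarrow> real measure \<Rightarrow>
   (real \<Rightarrow> real \<Rightarrow> 'n vfield) set" where
  "controls s1 s2 W nrm \<rho> =
     L2_space (WW s1 s2 W nrm \<rho>) (WW_norm s1 s2 W nrm \<rho>) (lebesgue_on {0..1})"

definition control_norm ::
  "real \<Rightarrow> real \<Rightarrow> (real \<Rightarrow> 'n::finite vfield set) \<Rightarrow> (real \<Rightarrow> 'n vfield \<Rightarrow> real) \<Rightarrow> real measure \<Rightarrow>
   (real \<Rightarrow> real \<Rightarrow> 'n vfield) \<Rightarrow> real" where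
  "control_norm s1 s2 W nrm \<rho> = L2_norm (WW_norm s1 s2 W nrm \<rho>) (lebesgue_on {0..1})"

definition flow_equation ::
  "real \<Rightarrow> real \<Rightarrow> (real \<Rightarrow> real \<Rightarrow> 'n::finite vfield) \<Rightarrow> (real \<Rightarrow> 'n scale_map) \<Rightarrow> bool" where
  "flow_equation s1 s2 v \<phi> \<longleftrightarrow>
     (\<forall>t\<in>{0..1}. \<forall>l\<in>{s1..s2}. \<forall>x.
        set_integrable lebesgue {0..t} (\<lambda>\<tau>. v \<tau> l (\<phi> \<tau> l x)) \<and>
        \<phi> t l x = x + (LINT \<tau>:{0..t}|lebesgue. v \<tau> l (\<phi> \<tau> l x)))"

definition admissible ::
  "real \<Rightarrow> real \<Rightarrow> (real \<Rightarrow> 'n::finite vfield set) \<Rightarrow> (real \<Rightarrow> 'n vfield \<Rightarrow> real) \<Rightarrow> real measure \<Rightarrow>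
   ((real \<Rightarrow> real \<Rightarrow> 'n vfield) \<times> (real \<Rightarrow> 'n scale_map)) set" where
  "admissible s1 s2 W nrm \<rho> =
     {(v, \<phi>). v \<in> controls s1 s2 W nrm \<rho> \<and> flow_equation s1 s2 v \<phi>}"

definition objective ::
  "real \<Rightarrow> real \<Rightarrow> (real \<Rightarrow> 'n::finite vfield set) \<Rightarrow> (real \<Rightarrow> 'n vfield \<Rightarrow> real) \<Rightarrow> real measure \<Rightarrow>
   ('n scale_map \<Rightarrow> real) \<Rightarrow> (real \<Rightarrow> real \<Rightarrow> 'n vfield) \<times> (real \<Rightarrow> 'n scale_map) \<Rightarrow> real" where
  "objective s1 s2 W nrm \<rho> G = (\<lambda>(v, \<phi>).
     1/2 * (LINT t|lebesgue_on {0..1}. (WW_norm s1 s2 W nrm \<rho> (v t))\<^sup>2) + G (\<phi> 1))"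

definition minimizing_sequence :: "'c set \<Rightarrow> ('c \<Rightarrow> real) \<Rightarrow> (nat \<Rightarrow> 'c) \<Rightarrow> bool" where
  "minimizing_sequence A J c \<longleftrightarrow>
     (\<forall>n. c n \<in> A) \<and> (\<lambda>n. ereal (J (c n))) \<longlonglongrightarrow> (INF a\<in>A. ereal (J a))"

definition scale_continuous :: "real \<Rightarrow> real \<Rightarrow> ('n::finite) scale_map \<Rightarrow> bool" where
  "scale_continuous s1 s2 f \<longleftrightarrow> continuous_on ({s1..s2} \<times> UNIV) (\<lambda>(l, x). f l x)"

text \<open>Lower semi-continuity on the space of continuous maps \<open>[s1,s2] \<times> \<real>\<^sup>d \<rightarrow> \<real>\<^sup>d\<close> with the
  topology of uniform convergence on compact sets. It forces \<open>G f\<close> to depend only on the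
  restriction of f to \<open>[s1,s2] \<times> \<real>\<^sup>d\<close>.\<close>

definition lsc_compact_uniform ::
  "real \<Rightarrow> real \<Rightarrow> ('n::finite scale_map \<Rightarrow> real) \<Rightarrow> bool" where
  "lsc_compact_uniform s1 s2 G \<longleftrightarrow>
     (\<forall>f. scale_continuous s1 s2 f \<longrightarrow> (\<forall>e>0. \<exists>K \<delta>.
        compact K \<and> K \<subseteq> {s1..s2} \<times> UNIV \<and> 0 < \<delta> \<and>
        (\<forall>g. scale_continuous s1 s2 g \<longrightarrow>
             (\<forall>(l, x)\<in>K. dist (g l x) (f l x) < \<delta>) \<longrightarrow> G f - e < G g)))"

end

theory Submission
  imports Defs "HOL-Library.Diagonal_Subsequence" "HOL-Complex_Analysis.Great_Picard"
begin

text \<open>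
  The proof is the direct method of the calculus of variations. Three facts carry it.

  Compactness. Square-integrable functions with values in a Hilbert space form a complete
  semi-inner product space (\<open>L2_semi_hilbert\<close>), and in such a space every bounded sequence has a
  weakly convergent subsequence (\<open>bounded_imp_weakly_convergent_subseq\<close>), the norm being weakly
  lower semi-continuous. Since the end-cost is bounded below, a minimizing sequence has bounded
  norms, so it converges weakly along a subsequence.

  Uniform estimates. The values of a field, its difference quotients in space and its 1/2-Hoelder
  quotients in scale are linear functionals on the space of multi-scale fields. Each of them is
  bounded because evaluations are, and on each single field they are bounded as a family, since an
  element of H1 with values in V is 1/2-Hoelder continuous in scale, uniformly over points
  (\<open>H1_space_Hoelder\<close>), and elements of V are bounded and Lipschitz. The uniform boundedness
  principle then gives one constant \<open>c\<close> with
  \<open>|v(l,x) - v(m,y)| \<le> c \<parallel>v\<parallel> (|x - y| + |l - m|\<^sup>1\<^sup>/\<^sup>2)\<close>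
  (\<open>H1_subspace_scale_fields\<close>).

  Weak continuity of the flow. Let \<open>v\<^sub>n\<close> converge weakly to \<open>w\<close>. For a fixed scale and starting point
  the integral curves are equicontinuous in time, and a uniform limit of a subsequence is an
  integral curve of \<open>w\<close>: replacing the curves by their limit costs a vanishing amount by the
  Lipschitz bound, and along a fixed curve the integral of the control is a bounded functional of
  the control (\<open>integral_curve_weak_limit\<close>). This gives existence of the flow of \<open>w\<close> and, by
  uniqueness from Gronwall's inequality, convergence of the whole sequence. Gronwall's inequality
  also gives the flows a common modulus of continuity in scale and starting point
  (\<open>integral_curve_stability\<close>), so the end maps converge uniformly on compact sets
  (\<open>flow_uniform_convergence\<close>), and lower semi-continuity of the end-cost applies.
\<close>

section \<open>Complete semi-inner product spaces on a carrier\<close>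

text \<open>The form is only semi-definite because square-integrable functions are not identified
  modulo equality almost everywhere; completeness then means convergence to some limit, which
  need not be unique.\<close>

locale semi_hilbert =
  fixes S :: "'a::real_vector set" and N :: "'a \<Rightarrow> real" and ip :: "'a \<Rightarrow> 'a \<Rightarrow> real"
  assumes subspace: "subspace S"
    and sym: "x \<in> S \<Longrightarrow> y \<in> S \<Longrightarrow> ip x y = ip y x"
    and add_left: "x \<in> S \<Longrightarrow> y \<in> S \<Longrightarrow> z \<in> S \<Longrightarrow> ip (x + y) z = ip x z + ip y z"
    and scale_left: "x \<in> S \<Longrightarrow> y \<in> S \<Longrightarrow> ip (c *\<^sub>R x) y = c * ip x y"
    and ip_nonneg: "x \<in> S \<Longrightarrow> 0 \<le> ip x x"
    and norm_eq: "x \<in> S \<Longrightarrow> N x = sqrt (ip x x)"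
    and complete: "complete_norm_on S N"
begin

lemma zero_in [simp, intro]: "0 \<in> S"
  using subspace by (rule subspace_0)

lemma add_in [simp, intro]: "x \<in> S \<Longrightarrow> y \<in> S \<Longrightarrow> x + y \<in> S"
  using subspace by (rule subspace_add)

lemma diff_in [simp, intro]: "x \<in> S \<Longrightarrow> y \<in> S \<Longrightarrow> x - y \<in> S"
  using subspace by (rule subspace_diff)

lemma scale_in [simp, intro]: "x \<in> S \<Longrightarrow> c *\<^sub>R x \<in> S"
  using subspace by (rule subspace_scale)

lemma add_right: "x \<in> S \<Longrightarrow> y \<in> S \<Longrightarrow> z \<in> S \<Longrightarrow> ip z (x + y) = ip z x + ip z y"
  by (metis sym add_left add_in)

lemma scale_right: "x \<in> S \<Longrightarrow> y \<in> S \<Longrightarrow> ip y (c *\<^sub>R x) = c * ip y x"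
  by (metis sym scale_left scale_in)

lemma diff_left: "x \<in> S \<Longrightarrow> y \<in> S \<Longrightarrow> z \<in> S \<Longrightarrow> ip (x - y) z = ip x z - ip y z"
  using add_left[of x "(-1) *\<^sub>R y" z] scale_left[of y z "-1"] scale_in[of y "-1"] by simp

lemma diff_right: "x \<in> S \<Longrightarrow> y \<in> S \<Longrightarrow> z \<in> S \<Longrightarrow> ip z (x - y) = ip z x - ip z y"
  by (metis sym diff_left diff_in)

lemmas ip_simps = add_left add_right scale_left scale_right diff_left diff_right

lemma N_nonneg [simp]: "x \<in> S \<Longrightarrow> 0 \<le> N x"
  by (simp add: norm_eq ip_nonneg)

lemma N_power2: "x \<in> S \<Longrightarrow> (N x)\<^sup>2 = ip x x"
  by (simp add: norm_eq ip_nonneg)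

lemma N_scale: "x \<in> S \<Longrightarrow> N (c *\<^sub>R x) = \<bar>c\<bar> * N x"
  by (simp add: norm_eq ip_simps real_sqrt_mult real_sqrt_mult_self flip: mult.assoc)

lemma N_zero [simp]: "N 0 = 0"
  using N_scale[of 0 0] by simp

lemma N_minus_commute: "x \<in> S \<Longrightarrow> y \<in> S \<Longrightarrow> N (x - y) = N (y - x)"
  using N_scale[of "x - y" "-1"] by simp

lemma N_add_power2:
  "x \<in> S \<Longrightarrow> y \<in> S \<Longrightarrow> (N (x + c *\<^sub>R y))\<^sup>2 = (N x)\<^sup>2 + 2 * c * ip x y + c\<^sup>2 * (N y)\<^sup>2"
  by (simp add: N_power2 ip_simps sym[of y x] power2_eq_square[of c] algebra_simps)

lemma Cauchy_Schwarz:
  assumes x: "x \<in> S" and y: "y \<in> S"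
  shows "\<bar>ip x y\<bar> \<le> N x * N y"
proof -
  have *: "0 \<le> (N x)\<^sup>2 + 2 * c * ip x y + c\<^sup>2 * (N y)\<^sup>2" for c
    using N_add_power2[OF x y, of c] by (metis zero_le_power2)
  have "(ip x y)\<^sup>2 \<le> (N x)\<^sup>2 * (N y)\<^sup>2"
  proof (cases "N y = 0")
    case False
    then have p: "0 < (N y)\<^sup>2" by simp
    have "0 \<le> (N x)\<^sup>2 + 2 * (- ip x y / (N y)\<^sup>2) * ip x y + (- ip x y / (N y)\<^sup>2)\<^sup>2 * (N y)\<^sup>2"
      by (rule *)
    also have "\<dots> = (N x)\<^sup>2 - (ip x y)\<^sup>2 / (N y)\<^sup>2"
      using p by (simp add: field_simps power2_eq_square)
    finally show ?thesis using p by (simp add: field_simps)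
  next
    case True
    have "ip x y = 0"
    proof (rule ccontr)
      assume a: "ip x y \<noteq> 0"
      have "0 \<le> (N x)\<^sup>2 + 2 * (- ((N x)\<^sup>2 + 1) / (2 * ip x y)) * ip x y"
        using *[of "- ((N x)\<^sup>2 + 1) / (2 * ip x y)"] True by simp
      also have "\<dots> = -1" using a by (simp add: field_simps)
      finally show False by simp
    qed
    then show ?thesis by simp
  qed
  then have "sqrt ((ip x y)\<^sup>2) \<le> sqrt ((N x * N y)\<^sup>2)"
    by (simp add: power_mult_distrib del: real_sqrt_abs)
  then show ?thesis using x y by simp
qed

lemma triangle: "x \<in> S \<Longrightarrow> y \<in> S \<Longrightarrow> N (x + y) \<le> N x + N y"
proof (rule power2_le_imp_le)
  assume x: "x \<in> S" and y: "y \<in> S"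
  show "(N (x + y))\<^sup>2 \<le> (N x + N y)\<^sup>2"
    using N_add_power2[OF x y, of 1] Cauchy_Schwarz[OF x y]
    by (simp add: power2_eq_square algebra_simps)
  show "0 \<le> N x + N y" using x y by simp
qed

lemma triangle_diff:
  assumes "x \<in> S" "y \<in> S" "z \<in> S"
  shows "N (x - z) \<le> N (x - y) + N (y - z)"
  using triangle[of "x - y" "y - z"] assms by simp

lemma triangle_abs:
  assumes "x \<in> S" "y \<in> S"
  shows "\<bar>N x - N y\<bar> \<le> N (x - y)"
  using triangle[of "x - y" y] triangle[of "y - x" x] N_minus_commute[of x y] assms by simp

lemma limit_norm:
  assumes "\<And>n. u n \<in> S" "x \<in> S" "((\<lambda>n. N (u n - x)) \<longlongrightarrow> 0) F"
  shows "((\<lambda>n. N (u n)) \<longlongrightarrow> N x) F"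
proof -
  have "((\<lambda>n. N (u n) - N x) \<longlongrightarrow> 0) F"
    by (rule tendsto_0_le[OF assms(3), where K = 1])
       (use triangle_abs assms in \<open>auto intro!: always_eventually\<close>)
  then show ?thesis by (simp add: LIM_zero_iff)
qed

lemma functional_diff:
  assumes "bounded_functional_on S N l" "x \<in> S" "y \<in> S"
  shows "l (x - y) = l x - l y"
proof -
  have "l (x + (-1) *\<^sub>R y) = l x + l ((-1) *\<^sub>R y)" "l ((-1) *\<^sub>R y) = (-1) * l y"
    using assms scale_in[of y "-1"] unfolding bounded_functional_on_def by blast+
  then show ?thesis by simp
qed

lemma functional_limit:
  assumes l: "bounded_functional_on S N l"
    and u: "\<And>n. u n \<in> S" and x: "x \<in> S" and lim: "((\<lambda>n. N (u n - x)) \<longlongrightarrow> 0) F"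
  shows "((\<lambda>n. l (u n)) \<longlongrightarrow> l x) F"
proof -
  obtain K where K: "\<And>x. x \<in> S \<Longrightarrow> \<bar>l x\<bar> \<le> K * N x"
    using l unfolding bounded_functional_on_def by blast
  have "((\<lambda>n. l (u n) - l x) \<longlongrightarrow> 0) F"
    by (rule tendsto_0_le[OF lim, where K = K])
       (use K[of "u _ - x"] functional_diff[OF l] u x in \<open>auto intro!: always_eventually simp: mult.commute\<close>)
  then show ?thesis by (simp add: LIM_zero_iff)
qed

lemma bounded_functional_ip: "w \<in> S \<Longrightarrow> bounded_functional_on S N (ip w)"
  unfolding bounded_functional_on_def
  using Cauchy_Schwarz[of w] by (auto simp: ip_simps)

text \<open>The representing vector minimises \<open>\<parallel>x\<parallel>\<^sup>2 / 2 - l x\<close>: the parallelogram identity makes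
  every minimising sequence Cauchy, and the first variation at the limit vanishes.\<close>

lemma Riesz:
  assumes l: "bounded_functional_on S N l"
  shows "\<exists>w\<in>S. \<forall>x\<in>S. l x = ip w x"
proof -
  have ladd: "\<And>x y. x \<in> S \<Longrightarrow> y \<in> S \<Longrightarrow> l (x + y) = l x + l y"
    and lscale: "\<And>c x. x \<in> S \<Longrightarrow> l (c *\<^sub>R x) = c * l x"
    using l unfolding bounded_functional_on_def by auto
  obtain K where K: "\<And>x. x \<in> S \<Longrightarrow> \<bar>l x\<bar> \<le> K * N x"
    using l unfolding bounded_functional_on_def by blast
  define J where "J x = (N x)\<^sup>2 / 2 - l x" for x
  have Jlb: "- (K\<^sup>2 / 2) \<le> J x" if "x \<in> S" for x
  proof -
    have "0 \<le> (N x - K)\<^sup>2" by simp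
    then show ?thesis using K[OF that] unfolding J_def
      by (simp add: power2_eq_square algebra_simps)
  qed
  define m where "m = Inf (J ` S)"
  have bdd: "bdd_below (J ` S)" using Jlb by (auto intro!: bdd_belowI)
  have m_le: "m \<le> J x" if "x \<in> S" for x
    unfolding m_def using bdd that by (auto intro: cInf_lower)
  have "\<exists>x\<in>S. J x < m + 1 / real (Suc n)" for n
  proof -
    have "J ` S \<noteq> {}" using zero_in by blast
    then show ?thesis
      using cInf_lessD[of "J ` S" "m + 1 / real (Suc n)"] unfolding m_def by fastforce
  qed
  then obtain u where uS: "\<And>n. u n \<in> S" and u: "\<And>n. J (u n) < m + 1 / real (Suc n)"
    by metis
  have par: "(N (x - y))\<^sup>2 \<le> 4 * (J x - m + (J y - m))" if x: "x \<in> S" and y: "y \<in> S" for x y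
  proof -
    have "J x + J y - 2 * J ((1/2) *\<^sub>R (x + y)) = (N (x - y))\<^sup>2 / 4"
      using x y unfolding J_def
      by (simp add: N_power2 ip_simps ladd lscale sym[of y x] field_simps)
    then show ?thesis using m_le[of "(1/2) *\<^sub>R (x + y)"] x y by simp
  qed
  have cauchy: "\<exists>M::nat. \<forall>i\<ge>M. \<forall>j\<ge>M. N (u i - u j) < e" if e: "0 < e" for e
  proof -
    obtain M where M: "8 / e\<^sup>2 < real M" using reals_Archimedean2 by blast
    have "N (u i - u j) < e" if ij: "M \<le> i" "M \<le> j" for i j
    proof (rule power2_less_imp_less)
      have J: "J (u k) - m < 1 / real (Suc M)" if "M \<le> k" for k
      proof -
        have "1 / real (Suc k) \<le> 1 / real (Suc M)" using that by (simp add: frac_le)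
        with u[of k] show ?thesis by (metis diff_less_eq add.commute less_le_trans add_left_mono)
      qed
      have "(N (u i - u j))\<^sup>2 < 8 * (1 / real (Suc M))"
        using par[OF uS uS, of i j] J[OF ij(1)] J[OF ij(2)] by argo
      also have "\<dots> < e\<^sup>2"
      proof -
        have "8 < real M * e\<^sup>2" using M e by (simp add: field_simps)
        also have "\<dots> \<le> real (Suc M) * e\<^sup>2" by (simp add: mult_right_mono)
        finally show ?thesis by (simp add: field_simps)
      qed
      finally show "(N (u i - u j))\<^sup>2 < e\<^sup>2" .
    qed (use e in simp)
    then show ?thesis by blast
  qed
  obtain w where w: "w \<in> S" and lim: "(\<lambda>n. N (u n - w)) \<longlonglongrightarrow> 0"
    using complete cauchy uS unfolding complete_norm_on_def by metis
  have "l x = ip w x" if x: "x \<in> S" for x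
  proof -
    have ip_lim: "(\<lambda>n. ip (u n) x) \<longlonglongrightarrow> ip w x"
      using functional_limit[OF bounded_functional_ip[OF x] uS w lim]
      by (simp add: sym[OF x] uS w)
    have quad: "0 \<le> s * (ip w x - l x) + s\<^sup>2 * ((N x)\<^sup>2 / 2)" for s
    proof (rule LIMSEQ_le_const)
      have "(\<lambda>n. s * (ip (u n) x - l x) + s\<^sup>2 * ((N x)\<^sup>2 / 2) + 1 / real (Suc n))
              \<longlonglongrightarrow> s * (ip w x - l x) + s\<^sup>2 * ((N x)\<^sup>2 / 2) + 0"
        by (intro tendsto_intros ip_lim LIMSEQ_Suc[OF lim_1_over_n])
      then show "(\<lambda>n. s * (ip (u n) x - l x) + s\<^sup>2 * ((N x)\<^sup>2 / 2) + 1 / real (Suc n))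
              \<longlonglongrightarrow> s * (ip w x - l x) + s\<^sup>2 * ((N x)\<^sup>2 / 2)" by simp
      have "0 \<le> s * (ip (u n) x - l x) + s\<^sup>2 * ((N x)\<^sup>2 / 2) + 1 / real (Suc n)" for n
      proof -
        have "J (u n + s *\<^sub>R x) = J (u n) + s * (ip (u n) x - l x) + s\<^sup>2 * ((N x)\<^sup>2 / 2)"
          using uS[of n] x unfolding J_def by (simp add: N_add_power2 ladd lscale field_simps)
        then show ?thesis using m_le[of "u n + s *\<^sub>R x"] u[of n] uS[of n] x by simp
      qed
      then show "\<exists>M. \<forall>n\<ge>M. 0 \<le> s * (ip (u n) x - l x) + s\<^sup>2 * ((N x)\<^sup>2 / 2) + 1 / real (Suc n)"
        by blast
    qed
    define a b where "a = ip w x - l x" and "b = (N x)\<^sup>2 / 2"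
    have b0: "0 \<le> b" by (simp add: b_def)
    \<comment> \<open>The step \<open>s = - a / d\<close> makes \<open>s a + s\<^sup>2 b\<close> negative unless \<open>a = 0\<close>, also when \<open>b = 0\<close>.\<close>
    define d where "d = 2 * b + 1"
    have d: "0 < d" using b0 by (simp add: d_def)
    have "0 \<le> (- a / d) * a + (- a / d)\<^sup>2 * b"
      using quad[of "- a / d"] unfolding a_def b_def by blast
    then have "0 \<le> d\<^sup>2 * ((- a / d) * a + (- a / d)\<^sup>2 * b)" by simp
    also have "\<dots> = - (a\<^sup>2) * d + a\<^sup>2 * b"
      using d by (simp add: field_simps power2_eq_square)
    also have "\<dots> = - (a\<^sup>2 * (b + 1))" by (simp add: d_def algebra_simps)
    finally have "a\<^sup>2 * (b + 1) \<le> 0" by simp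
    then have "a = 0" using b0 by (simp add: mult_le_0_iff)
    then show ?thesis by (simp add: a_def)
  qed
  then show ?thesis using w by blast
qed

lemma closed_subspace:
  assumes "subspace T" "T \<subseteq> S"
    and closed: "\<And>u x. (\<And>n. u n \<in> T) \<Longrightarrow> x \<in> S \<Longrightarrow> (\<lambda>n. N (u n - x)) \<longlonglongrightarrow> 0 \<Longrightarrow> x \<in> T"
  shows "semi_hilbert T N ip"
proof
  show "complete_norm_on T N"
    unfolding complete_norm_on_def
  proof (intro allI impI)
    fix u :: "nat \<Rightarrow> 'a"
    assume u: "\<forall>n. u n \<in> T" and c: "\<forall>e>0. \<exists>M::nat. \<forall>m\<ge>M. \<forall>n\<ge>M. N (u m - u n) < e"
    obtain x where "x \<in> S" "(\<lambda>n. N (u n - x)) \<longlonglongrightarrow> 0"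
      using complete c u assms(2) unfolding complete_norm_on_def by blast
    then show "\<exists>l\<in>T. (\<lambda>n. N (u n - l)) \<longlonglongrightarrow> 0" using closed u by blast
  qed
  show "ip x y = ip y x" if "x \<in> T" "y \<in> T" for x y
    using that assms(2) sym by blast
  show "ip (x + y) z = ip x z + ip y z" if "x \<in> T" "y \<in> T" "z \<in> T" for x y z
    using that assms(2) add_left by blast
  show "ip (c *\<^sub>R x) y = c * ip x y" if "x \<in> T" "y \<in> T" for c x y
    using that assms(2) scale_left by blast
  show "0 \<le> ip x x" "N x = sqrt (ip x x)" if "x \<in> T" for x
    using that assms(2) ip_nonneg norm_eq by blast+
qed fact

text \<open>Each sequence of inner products with a fixed member is bounded, so this is a diagonal
  extraction over the countably many members.\<close>

lemma bounded_subseq_ip_convergent: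
  fixes u :: "nat \<Rightarrow> 'a"
  assumes u: "\<And>n. u n \<in> S" and B: "\<And>n. N (u n) \<le> B"
  shows "\<exists>r::nat\<Rightarrow>nat. strict_mono r \<and> (\<forall>m. convergent (\<lambda>n. ip (u (r n)) (u m)))"
proof -
  have B0: "0 \<le> B" using B[of 0] N_nonneg[OF u[of 0]] by linarith
  define F where "F n m = ip (u n) (u m)" for n m
  have bnd: "bounded (range (\<lambda>n. F (r n) m))" for m and r :: "nat \<Rightarrow> nat"
  proof -
    have "\<bar>F (r n) m\<bar> \<le> B * B" for n
      using Cauchy_Schwarz[OF u u, of "r n" m] mult_mono[OF B B B0 N_nonneg[OF u], of "r n" m]
      unfolding F_def by linarith
    then show ?thesis by (auto simp: bounded_iff)
  qed
  interpret subseqs "\<lambda>m r. convergent (\<lambda>n. F (r n) m)"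
  proof unfold_locales
    fix m :: nat and s :: "nat \<Rightarrow> nat"
    obtain l r where "strict_mono r" "((\<lambda>n. F (s n) m) \<circ> r) \<longlonglongrightarrow> l"
      using bounded_imp_convergent_subsequence[OF bnd[of s m]] by blast
    then show "\<exists>r. strict_mono r \<and> convergent (\<lambda>n. F ((s \<circ> r) n) m)"
      by (auto simp: convergent_def o_def)
  qed
  have "convergent (\<lambda>n. F (diagseq n) m)" for m
  proof -
    have "convergent (\<lambda>n. F ((diagseq \<circ> (+) (Suc m)) n) m)"
    proof (rule diagseq_holds)
      fix r s :: "nat \<Rightarrow> nat" and k
      assume "strict_mono r" "convergent (\<lambda>n. F (s n) k)"
      then show "convergent (\<lambda>n. F ((s \<circ> r) n) k)"
        using convergent_subseq_convergent[of "\<lambda>n. F (s n) k" r] by (simp add: o_def)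
    qed
    then have "convergent (\<lambda>n. F (diagseq (n + Suc m)) m)" by (simp add: o_def add.commute)
    then show ?thesis using convergent_ignore_initial_segment[of "\<lambda>n. F (diagseq n) m" "Suc m"] by simp
  qed
  then show ?thesis using subseq_diagseq unfolding F_def by blast
qed

text \<open>The vectors against which the subsequence converges form a closed subspace \<open>T\<close>
  containing the sequence itself. The Riesz representation inside \<open>T\<close>, once for the limit
  functional and once for the restriction to \<open>T\<close> of an arbitrary bounded functional, gives
  weak convergence without orthogonal projections.\<close>

theorem bounded_imp_weakly_convergent_subseq:
  fixes u :: "nat \<Rightarrow> 'a"
  assumes u: "\<And>n. u n \<in> S" and B: "\<And>n. N (u n) \<le> B"
  shows "\<exists>r w. strict_mono r \<and> weakly_converges_on S N (u \<circ> r) w"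
proof -
  have B0: "0 \<le> B" using B[of 0] N_nonneg[OF u[of 0]] by linarith
  obtain r :: "nat \<Rightarrow> nat" where r: "strict_mono r"
    and conv: "\<And>m. convergent (\<lambda>n. ip (u (r n)) (u m))"
    using bounded_subseq_ip_convergent[of u B] u B by blast
  define T where "T = {x\<in>S. convergent (\<lambda>n. ip (u (r n)) x)}"
  have bd: "\<bar>ip (u (r n)) x\<bar> \<le> B * N x" if "x \<in> S" for n x
    using Cauchy_Schwarz[OF u that, of "r n"] mult_right_mono[OF B[of "r n"] N_nonneg[OF that]]
    by linarith
  have sub: "subspace T"
    unfolding subspace_def
  proof (intro conjI ballI allI)
    have "ip (u (r n)) 0 = 0" for n using scale_right[of 0 "u (r n)" 0] u by simp
    then show "0 \<in> T" by (simp add: T_def convergent_const)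
  next
    fix x y assume "x \<in> T" "y \<in> T"
    then show "x + y \<in> T" using u by (auto simp: T_def ip_simps intro: convergent_add)
  next
    fix c x assume "x \<in> T"
    then show "c *\<^sub>R x \<in> T"
      using u convergent_mult[OF convergent_const[of c]] by (auto simp: T_def ip_simps)
  qed
  have closed: "x \<in> T"
    if y: "\<And>n. y n \<in> T" and x: "x \<in> S" and lim: "(\<lambda>n. N (y n - x)) \<longlonglongrightarrow> 0" for y x
  proof -
    have yS: "y n \<in> S" for n using y by (simp add: T_def)
    have "Cauchy (\<lambda>n. ip (u (r n)) x)"
      unfolding Cauchy_def
    proof (intro allI impI)
      fix e :: real assume e: "0 < e"
      have "(\<lambda>n. B * N (y n - x)) \<longlonglongrightarrow> 0" using lim tendsto_mult_right_zero by blast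
      then have "\<forall>\<^sub>F n in sequentially. B * N (y n - x) < e / 3"
        by (rule order_tendstoD(2)) (use e in simp)
      then obtain k where k: "B * N (y k - x) < e / 3"
        using eventually_happens'[OF sequentially_bot] by blast
      have "Cauchy (\<lambda>n. ip (u (r n)) (y k))"
        using y[of k] by (simp add: T_def Cauchy_convergent_iff)
      then obtain M where M: "\<And>i j. M \<le> i \<Longrightarrow> M \<le> j \<Longrightarrow>
          dist (ip (u (r i)) (y k)) (ip (u (r j)) (y k)) < e / 3"
        unfolding Cauchy_def using e by (metis zero_less_divide_iff zero_less_numeral)
      have "dist (ip (u (r i)) x) (ip (u (r j)) x) < e" if "M \<le> i" "M \<le> j" for i j
      proof -
        have *: "\<bar>p - q\<bar> < e"
          if "\<bar>a - b\<bar> < e / 3" "\<bar>a - p\<bar> \<le> t" "\<bar>b - q\<bar> \<le> t" "t < e / 3" for a b p q t :: real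
          using that by linarith
        show ?thesis
          unfolding dist_real_def
          by (rule *[OF M[OF that, unfolded dist_real_def] _ _ k])
             (use bd[of "y k - x" i] bd[of "y k - x" j] x yS[of k] u in \<open>simp_all add: ip_simps\<close>)
      qed
      then show "\<exists>M. \<forall>m\<ge>M. \<forall>n\<ge>M. dist (ip (u (r m)) x) (ip (u (r n)) x) < e" by blast
    qed
    then show ?thesis using x by (simp add: T_def Cauchy_convergent_iff)
  qed
  interpret T: semi_hilbert T N ip
    by (rule closed_subspace[OF sub _ closed]) (auto simp: T_def)
  define f where "f x = lim (\<lambda>n. ip (u (r n)) x)" for x
  have f: "(\<lambda>n. ip (u (r n)) x) \<longlonglongrightarrow> f x" if "x \<in> T" for x
    using that by (simp add: T_def f_def convergent_LIMSEQ_iff)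
  have TS: "x \<in> S" if "x \<in> T" for x using that by (simp add: T_def)
  have uT: "u n \<in> T" for n using u conv by (simp add: T_def)
  have "bounded_functional_on T N f"
    unfolding bounded_functional_on_def
  proof (intro conjI ballI allI exI[of _ B])
    fix x y assume x: "x \<in> T" and y: "y \<in> T"
    show "f (x + y) = f x + f y"
      using LIMSEQ_unique[OF f[of "x + y"] ] tendsto_add[OF f[OF x] f[OF y]] x y u TS
      by (simp add: ip_simps)
  next
    fix c x assume x: "x \<in> T"
    show "f (c *\<^sub>R x) = c * f x"
      using LIMSEQ_unique[OF f[of "c *\<^sub>R x"] ] tendsto_mult_left[OF f[OF x], of c] x u TS
      by (simp add: ip_simps)
  next
    fix x assume x: "x \<in> T"
    show "\<bar>f x\<bar> \<le> B * N x"
      using tendsto_rabs[OF f[OF x]] bd[OF TS[OF x]]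
      by (intro LIMSEQ_le_const2[where X = "\<lambda>n. \<bar>ip (u (r n)) x\<bar>"]) auto
  qed
  then obtain w where w: "w \<in> T" and fw: "\<And>x. x \<in> T \<Longrightarrow> f x = ip w x"
    using T.Riesz by blast
  have "(\<lambda>n. L (u (r n))) \<longlonglongrightarrow> L w" if L: "bounded_functional_on S N L" for L
  proof -
    have "bounded_functional_on T N L"
      using L TS unfolding bounded_functional_on_def by blast
    then obtain z where z: "z \<in> T" and Lz: "\<And>x. x \<in> T \<Longrightarrow> L x = ip z x"
      using T.Riesz by blast
    show ?thesis
      using f[OF z] by (simp add: fw z Lz uT w sym[of z] TS u)
  qed
  then show ?thesis
    using r u TS[OF w] unfolding weakly_converges_on_def by (auto simp: o_def)
qed

text \<open>Testing with the limit itself bounds its squared norm by its norm times \<open>b\<close>.\<close>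

lemma norm_weak_limit_le:
  assumes weak: "weakly_converges_on S N u w" and le: "\<forall>\<^sub>F n in sequentially. N (u n) \<le> b"
  shows "N w \<le> b"
proof -
  have u: "\<And>n. u n \<in> S" and w: "w \<in> S"
    using weak by (auto simp: weakly_converges_on_def)
  have "(\<lambda>n. ip w (u n)) \<longlonglongrightarrow> ip w w"
    using weak bounded_functional_ip[OF w] by (auto simp: weakly_converges_on_def)
  moreover have "\<forall>\<^sub>F n in sequentially. ip w (u n) \<le> N w * b"
    using le
  proof eventually_elim
    case (elim n)
    have "ip w (u n) \<le> N w * N (u n)" using Cauchy_Schwarz[OF w u, of n] by linarith
    also have "\<dots> \<le> N w * b" using elim N_nonneg[OF w] by (rule mult_left_mono)
    finally show ?case .
  qed
  ultimately have "ip w w \<le> N w * b"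
    by (rule tendsto_upperbound) simp
  then have "N w * N w \<le> N w * b" using N_power2[OF w] by (simp add: power2_eq_square)
  moreover have "0 \<le> b"
    using eventually_happens'[OF sequentially_bot le] N_nonneg[OF u] order_trans by blast
  ultimately show ?thesis using N_nonneg[OF w] by (cases "N w = 0") auto
qed

end


lemma tendsto_zero_le:
  fixes a b :: "nat \<Rightarrow> real"
  assumes "b \<longlonglongrightarrow> 0" "\<And>i. 0 \<le> a i" "\<And>i. a i \<le> b i"
  shows "a \<longlonglongrightarrow> 0"
  by (rule tendsto_sandwich[of "\<lambda>_. 0" a sequentially b]) (use assms in auto)

context semi_hilbert
begin

lemma summable_steps_convergent:
  assumes u: "\<And>n. u n \<in> S" and step: "\<And>n. N (u (Suc n) - u n) \<le> a n" and a: "summable a"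
  shows "\<exists>x\<in>S. (\<lambda>n. N (u n - x)) \<longlonglongrightarrow> 0 \<and> (\<forall>n. N (x - u n) \<le> (\<Sum>i. a (i + n)))"
proof -
  have a0: "0 \<le> a n" for n
    using order_trans[OF N_nonneg step[of n]] u by simp
  have sa: "summable (\<lambda>i. a (i + n))" for n using a by (simp add: summable_iff_shift)
  have part: "N (u (n + k) - u n) \<le> (\<Sum>i<k. a (i + n))" for n k
  proof (induction k)
    case (Suc k)
    have "N (u (n + Suc k) - u n) \<le> N (u (Suc (n + k)) - u (n + k)) + N (u (n + k) - u n)"
      using triangle_diff[of "u (Suc (n + k))" "u (n + k)" "u n"] u by simp
    then show ?case using Suc step[of "n + k"] by (simp add: add.commute)
  qed simp
  have tail: "N (u m - u n) \<le> (\<Sum>i. a (i + n))" if "n \<le> m" for m n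
  proof -
    have "N (u m - u n) \<le> (\<Sum>i<m - n. a (i + n))" using part[of n "m - n"] that by simp
    also have "\<dots> \<le> (\<Sum>i. a (i + n))" by (intro sum_le_suminf sa) (auto simp: a0)
    finally show ?thesis .
  qed
  have tail0: "(\<lambda>n. \<Sum>i. a (i + n)) \<longlonglongrightarrow> 0" using suminf_exist_split2[OF a] .
  have "\<exists>M::nat. \<forall>m\<ge>M. \<forall>n\<ge>M. N (u m - u n) < e" if e: "0 < e" for e
  proof -
    have "\<forall>\<^sub>F n in sequentially. (\<Sum>i. a (i + n)) < e / 2"
      by (rule order_tendstoD(2)[OF tail0]) (use e in simp)
    then obtain M where M: "(\<Sum>i. a (i + M)) < e / 2"
      using eventually_happens'[OF sequentially_bot] by blast
    have "N (u m - u n) < e" if "M \<le> m" "M \<le> n" for m n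
      using triangle_diff[OF u u u, of m n M] tail[OF that(1)] tail[OF that(2)] M
        N_minus_commute[OF u u, of n M] by linarith
    then show ?thesis by blast
  qed
  then obtain x where x: "x \<in> S" and lim: "(\<lambda>n. N (u n - x)) \<longlonglongrightarrow> 0"
    using complete u unfolding complete_norm_on_def by metis
  have "N (x - u n) \<le> (\<Sum>i. a (i + n))" for n
  proof (rule LIMSEQ_le_const2)
    show "(\<lambda>m. N (u m - u n)) \<longlonglongrightarrow> N (x - u n)"
      by (rule limit_norm) (use u x lim in auto)
  qed (use tail in blast)
  then show ?thesis using x lim by blast
qed

text \<open>Gliding hump: for every functional \<open>l\<close> and all \<open>x\<close> and \<open>z\<close>, one of \<open>l (x + z)\<close> and
  \<open>l (x - z)\<close> is at least \<open>l z\<close> in absolute value. If the operator norms \<open>c\<^sub>n\<close> of functionals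
  \<open>l\<^sub>n\<close> exceed \<open>4\<^sup>n\<close>, steps of length \<open>3\<^sup>-\<^sup>n\<close> in nearly norming directions lead to a point
  where the functionals are unbounded.\<close>

theorem uniform_boundedness:
  assumes T: "\<And>i. i \<in> I \<Longrightarrow> bounded_functional_on S N (T i)"
    and pointwise: "\<And>x. x \<in> S \<Longrightarrow> \<exists>K. \<forall>i\<in>I. \<bar>T i x\<bar> \<le> K"
  shows "\<exists>K\<ge>0. \<forall>i\<in>I. \<forall>x\<in>S. \<bar>T i x\<bar> \<le> K * N x"
proof (rule ccontr)
  assume unbounded: "\<not> ?thesis"
  have "\<exists>i z c. i \<in> I \<and> z \<in> S \<and> N z \<le> 1 \<and> 4 ^ n < c \<and> 3/4 * c \<le> \<bar>T i z\<bar> \<and>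
      (\<forall>x\<in>S. \<bar>T i x\<bar> \<le> c * N x)" for n :: nat
  proof -
    obtain i x where i: "i \<in> I" and x: "x \<in> S" and big: "4 ^ n * N x < \<bar>T i x\<bar>"
      using unbounded by (metis not_le zero_le_numeral zero_le_power)
    obtain K where K: "\<And>x. x \<in> S \<Longrightarrow> \<bar>T i x\<bar> \<le> K * N x"
      and hom: "\<And>c x. x \<in> S \<Longrightarrow> T i (c *\<^sub>R x) = c * T i x"
      using T[OF i] unfolding bounded_functional_on_def by blast
    define A where "A = (\<lambda>z. \<bar>T i z\<bar>) ` {z\<in>S. N z \<le> 1}"
    have bdd: "bdd_above A"
      unfolding A_def
    proof (rule bdd_aboveI2)
      fix z assume "z \<in> {z\<in>S. N z \<le> 1}"
      then have z: "z \<in> S" "N z \<le> 1" by auto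
      have "\<bar>T i z\<bar> \<le> \<bar>K\<bar> * N z"
        using K[OF z(1)] mult_right_mono[OF abs_ge_self[of K] N_nonneg[OF z(1)]] by linarith
      also have "\<dots> \<le> \<bar>K\<bar>" using z by (simp add: mult_left_le)
      finally show "\<bar>T i z\<bar> \<le> \<bar>K\<bar>" .
    qed
    define c where "c = Sup A"
    have c: "\<bar>T i z\<bar> \<le> c * N z" if z: "z \<in> S" for z
    proof (cases "N z = 0")
      case True
      then show ?thesis using K[OF z] by simp
    next
      case False
      then have p: "0 < N z" using N_nonneg[OF z] by linarith
      have "\<bar>T i ((1 / N z) *\<^sub>R z)\<bar> \<in> A"
        unfolding A_def using z p by (auto simp: N_scale)
      then have "\<bar>T i ((1 / N z) *\<^sub>R z)\<bar> \<le> c"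
        unfolding c_def using bdd by (rule cSup_upper)
      then show ?thesis using p by (simp add: hom z abs_mult field_simps)
    qed
    have Nx: "0 < N x" using big c[OF x] N_nonneg[OF x] by (cases "N x = 0") auto
    have c4: "4 ^ n < c"
      using less_le_trans[OF big c[OF x]] Nx by simp
    then have c0: "0 < c" by (meson less_trans zero_less_numeral zero_less_power)
    have "A \<noteq> {}" using zero_in N_zero unfolding A_def by force
    then obtain b where "b \<in> A" "3/4 * c < b"
      using less_cSupD[of A "3/4 * c"] c0 unfolding c_def by auto
    then obtain z where "z \<in> S" "N z \<le> 1" "3/4 * c < \<bar>T i z\<bar>" unfolding A_def by auto
    then show ?thesis using i c4 c by (auto intro!: exI[of _ i] exI[of _ z] exI[of _ c])
  qed
  then obtain i z c where iz: "\<And>n::nat. i n \<in> I \<and> z n \<in> S \<and> N (z n) \<le> 1 \<and> 4 ^ n < c n \<and>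
      3/4 * c n \<le> \<bar>T (i n) (z n)\<bar> \<and> (\<forall>x\<in>S. \<bar>T (i n) x\<bar> \<le> c n * N x)"
    by metis
  have add: "T (i n) (x + y) = T (i n) x + T (i n) y" if "x \<in> S" "y \<in> S" for n x y
    using T[of "i n"] iz[of n] that unfolding bounded_functional_on_def by blast
  have hom: "T (i n) (a *\<^sub>R x) = a * T (i n) x" if "x \<in> S" for n x a
    using T[of "i n"] iz[of n] that unfolding bounded_functional_on_def by blast
  define h where "h n = (1/3) ^ n *\<^sub>R z n" for n
  have h: "h n \<in> S" "N (h n) \<le> (1/3) ^ n" for n
    using iz[of n] by (auto simp: h_def N_scale mult_left_le)
  have Th: "(1/3) ^ n * (3/4 * c n) \<le> \<bar>T (i n) (h n)\<bar>" for n
    using iz[of n] by (simp add: h_def hom abs_mult mult_left_mono)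
  define u where "u = rec_nat 0 (\<lambda>n x.
      if \<bar>T (i n) (h n)\<bar> \<le> \<bar>T (i n) (x + h n)\<bar> then x + h n else x - h n)"
  have u0: "u 0 = 0" by (simp add: u_def)
  have uSuc: "u (Suc n) = (if \<bar>T (i n) (h n)\<bar> \<le> \<bar>T (i n) (u n + h n)\<bar>
      then u n + h n else u n - h n)" for n
    by (simp add: u_def)
  have uS: "u n \<in> S" for n by (induction n) (auto simp: u0 uSuc h)
  have step: "N (u (Suc n) - u n) \<le> (1/3) ^ n" for n
    using h[of n] N_scale[of "h n" "-1"] by (auto simp: uSuc)
  have hump: "\<bar>T (i n) (h n)\<bar> \<le> \<bar>T (i n) (u (Suc n))\<bar>" for n
  proof -
    have "u n - h n = u n + (-1) *\<^sub>R h n" by simp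
    then have "T (i n) (u n - h n) = T (i n) (u n) - T (i n) (h n)"
      using add[of "u n" "(-1) *\<^sub>R h n" n] hom[of "h n" n "-1"] scale_in[of "h n" "-1"] uS h by simp
    then show ?thesis using add[of "u n" "h n" n] uS h by (auto simp: uSuc)
  qed
  obtain x where x: "x \<in> S" and near: "\<And>n. N (x - u n) \<le> (\<Sum>k. (1/3) ^ (k + n))"
    using summable_steps_convergent[of u "\<lambda>n. (1/3) ^ n"] uS step by (auto simp: summable_geometric)
  \<comment> \<open>The steps after the n-th move at most \<open>3\<^sup>-\<^sup>n / 2\<close>, which costs \<open>l\<^sub>n\<close> at most \<open>c\<^sub>n 3\<^sup>-\<^sup>n / 2\<close> of the
    \<open>3/4 c\<^sub>n 3\<^sup>-\<^sup>n\<close> gained at that step.\<close>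
  have big: "1/4 * (4/3) ^ n \<le> \<bar>T (i n) x\<bar>" for n
  proof -
    have c0: "4 ^ n \<le> c n" "0 \<le> c n" using iz[of n] by (auto intro: order_trans[of _ "4 ^ n"] less_imp_le)
    have "(\<Sum>k. (1/3 :: real) ^ (k + Suc n)) = (1/3) ^ Suc n * (\<Sum>k. (1/3) ^ k)"
      by (subst suminf_mult[symmetric]) (auto simp: summable_geometric power_add mult_ac)
    also have "\<dots> = (1/3) ^ n / 2" by (simp add: suminf_geometric)
    finally have "N (x - u (Suc n)) \<le> (1/3) ^ n / 2" using near[of "Suc n"] by simp
    then have "c n * N (x - u (Suc n)) \<le> c n * ((1/3) ^ n / 2)"
      using c0 by (intro mult_left_mono)
    then have d: "\<bar>T (i n) (x - u (Suc n))\<bar> \<le> c n * ((1/3) ^ n / 2)"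
      using iz[of n] x uS by (meson diff_in order_trans)
    have "T (i n) x = T (i n) (x - u (Suc n)) + T (i n) (u (Suc n))"
      using add[of "x - u (Suc n)" "u (Suc n)" n] x uS by simp
    then have "(1/3) ^ n * (3/4 * c n) - c n * ((1/3) ^ n / 2) \<le> \<bar>T (i n) x\<bar>"
      using Th[of n] hump[of n] d by linarith
    then have "1/4 * ((1/3) ^ n * c n) \<le> \<bar>T (i n) x\<bar>" by (simp add: algebra_simps)
    moreover have "(4/3 :: real) ^ n = (1/3) ^ n * 4 ^ n"
      by (simp add: power_mult_distrib[symmetric])
    moreover have "(1/3) ^ n * 4 ^ n \<le> (1/3) ^ n * c n" using c0 by (intro mult_left_mono) auto
    ultimately show ?thesis by linarith
  qed
  obtain K where K: "\<And>j. j \<in> I \<Longrightarrow> \<bar>T j x\<bar> \<le> K" using pointwise[OF x] by blast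
  obtain n where "4 * K < (4/3) ^ n" using real_arch_pow[of "4/3" "4 * K"] by auto
  then show False using big[of n] K[of "i n"] iz[of n] by auto
qed

end


section \<open>Square-integrable functions with values in such a space\<close>

lemma (in complete_measure) borel_measurable_AE_LIMSEQ:
  fixes f :: "'a \<Rightarrow> 'b::metric_space"
  assumes s: "\<And>i. s i \<in> borel_measurable M" and lim: "AE t in M. (\<lambda>i. s i t) \<longlonglongrightarrow> f t"
  shows "f \<in> borel_measurable M"
proof -
  define Z where "Z = {t\<in>space M. \<not> (\<lambda>i. s i t) \<longlonglongrightarrow> f t}"
  have Z: "Z \<in> null_sets M" using lim by (simp add: Z_def AE_iff_null_sets)
  then have [measurable]: "Z \<in> sets M" by auto
  note s[measurable]
  define f' where "f' t = (if t \<in> Z then undefined else f t)" for t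
  have "f' \<in> borel_measurable M"
  proof (rule borel_measurable_LIMSEQ_metric)
    show "(\<lambda>t. if t \<in> Z then undefined else s i t) \<in> borel_measurable M" for i by measurable
    show "(\<lambda>i. if t \<in> Z then undefined else s i t) \<longlonglongrightarrow> f' t" if "t \<in> space M" for t
      using that by (auto simp: f'_def Z_def)
  qed
  then have *: "f' -` A \<inter> space M \<in> sets M" if "A \<in> sets borel" for A
    using that by (rule measurable_sets)
  show ?thesis
  proof (rule measurableI)
    fix A :: "'b set" assume A: "A \<in> sets borel"
    show "f -` A \<inter> space M \<in> sets M"
    proof (rule in_sets_AE[OF _ *[OF A]])
      have "AE t in M. t \<notin> Z" using Z by (rule AE_not_in)
      then show "AE t in M. (t \<in> f' -` A \<inter> space M) = (t \<in> f -` A \<inter> space M)"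
        by eventually_elim (simp add: f'_def)
    qed auto
  qed simp
qed

lemma AE_tendsto_zero_of_summable_integrals:
  fixes g :: "nat \<Rightarrow> 't \<Rightarrow> real"
  assumes m: "\<And>k. g k \<in> borel_measurable M" and nn: "\<And>k t. t \<in> space M \<Longrightarrow> 0 \<le> g k t"
    and le: "\<And>k. (\<integral>\<^sup>+t. ennreal (g k t) \<partial>M) \<le> ennreal (C * (1/2) ^ k)" and C: "0 \<le> C"
  shows "AE t in M. summable (\<lambda>k. g k t)"
proof -
  note m[measurable]
  have "(\<integral>\<^sup>+t. (\<Sum>k. ennreal (g k t)) \<partial>M) = (\<Sum>k. \<integral>\<^sup>+t. ennreal (g k t) \<partial>M)"
    by (rule nn_integral_suminf) measurable
  also have "\<dots> \<le> (\<Sum>k. ennreal (C * (1/2) ^ k))"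
    by (intro suminf_le le) auto
  also have "\<dots> < \<infinity>"
    using C by (simp add: suminf_ennreal2 summable_geometric less_top)
  finally have "AE t in M. (\<Sum>k. ennreal (g k t)) \<noteq> \<infinity>"
    by (intro nn_integral_PInf_AE) auto
  then show ?thesis
    using AE_space by eventually_elim (rule summable_suminf_not_top, auto simp: nn)
qed

locale semi_hilbert_L2 = semi_hilbert S N ip + complete_measure M + finite_measure M
  for S :: "'a::real_vector set" and N ip and M :: "'t measure"
begin

abbreviation "strongly_meas \<equiv> strongly_measurable_on S N M"

abbreviation "L2 \<equiv> L2_space S N M"

lemma strongly_meas_in: "strongly_meas f \<Longrightarrow> t \<in> space M \<Longrightarrow> f t \<in> S"
  by (simp add: strongly_measurable_on_def)

lemma strongly_measE:
  assumes "strongly_meas f"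
  obtains s where "\<And>i. simple_function M (s i)" "\<And>i t. t \<in> space M \<Longrightarrow> s i t \<in> S"
    "AE t in M. (\<lambda>i. N (s i t - f t)) \<longlonglongrightarrow> 0"
  using assms unfolding strongly_measurable_on_def by blast

lemma strongly_measI:
  assumes "\<And>t. t \<in> space M \<Longrightarrow> f t \<in> S"
    "\<And>i. simple_function M (s i)" "\<And>i t. t \<in> space M \<Longrightarrow> s i t \<in> S"
    "AE t in M. (\<lambda>i. N (s i t - f t)) \<longlonglongrightarrow> 0"
  shows "strongly_meas f"
  using assms unfolding strongly_measurable_on_def by blast

lemma strongly_meas_simple:
  assumes "simple_function M f" "\<And>t. t \<in> space M \<Longrightarrow> f t \<in> S"
  shows "strongly_meas f"
  by (rule strongly_measI[of f "\<lambda>_. f"]) (use assms in auto)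

lemma strongly_meas_add:
  assumes f: "strongly_meas f" and g: "strongly_meas g"
  shows "strongly_meas (\<lambda>t. f t + g t)"
proof -
  obtain s where s: "\<And>i. simple_function M (s i)" "\<And>i t. t \<in> space M \<Longrightarrow> s i t \<in> S"
    and slim: "AE t in M. (\<lambda>i. N (s i t - f t)) \<longlonglongrightarrow> 0" using strongly_measE[OF f] by blast
  obtain r where r: "\<And>i. simple_function M (r i)" "\<And>i t. t \<in> space M \<Longrightarrow> r i t \<in> S"
    and rlim: "AE t in M. (\<lambda>i. N (r i t - g t)) \<longlonglongrightarrow> 0" using strongly_measE[OF g] by blast
  show ?thesis
  proof (rule strongly_measI[of _ "\<lambda>i t. s i t + r i t"])
    show "simple_function M (\<lambda>t. s i t + r i t)" for i
      by (rule simple_function_compose2[OF s(1) r(1)])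
    show "AE t in M. (\<lambda>i. N (s i t + r i t - (f t + g t))) \<longlonglongrightarrow> 0"
      using slim rlim AE_space
    proof eventually_elim
      case (elim t)
      have le: "N (s i t + r i t - (f t + g t)) \<le> N (s i t - f t) + N (r i t - g t)" for i
        using triangle[of "s i t - f t" "r i t - g t"] elim(3) s(2) r(2)
          strongly_meas_in[OF f] strongly_meas_in[OF g] by (simp add: add_diff_add)
      show ?case
      proof (rule tendsto_zero_le)
        show "(\<lambda>i. N (s i t - f t) + N (r i t - g t)) \<longlonglongrightarrow> 0"
          using tendsto_add[OF elim(1,2)] by simp
        show "0 \<le> N (s i t + r i t - (f t + g t))" for i
          using elim(3) s(2) r(2) strongly_meas_in[OF f] strongly_meas_in[OF g]
          by (intro N_nonneg diff_in add_in)
      qed (rule le)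
    qed
  qed (use s r f g strongly_meas_in in auto)
qed

lemma strongly_meas_scale:
  assumes f: "strongly_meas f"
  shows "strongly_meas (\<lambda>t. c *\<^sub>R f t)"
proof -
  obtain s where s: "\<And>i. simple_function M (s i)" "\<And>i t. t \<in> space M \<Longrightarrow> s i t \<in> S"
    and slim: "AE t in M. (\<lambda>i. N (s i t - f t)) \<longlonglongrightarrow> 0" using strongly_measE[OF f] by blast
  show ?thesis
  proof (rule strongly_measI[of _ "\<lambda>i t. c *\<^sub>R s i t"])
    show "simple_function M (\<lambda>t. c *\<^sub>R s i t)" for i
      by (rule simple_function_compose1[OF s(1)])
    show "AE t in M. (\<lambda>i. N (c *\<^sub>R s i t - c *\<^sub>R f t)) \<longlonglongrightarrow> 0"
      using slim AE_space
    proof eventually_elim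
      case (elim t)
      then have "N (c *\<^sub>R s i t - c *\<^sub>R f t) = \<bar>c\<bar> * N (s i t - f t)" for i
        using N_scale[of "s i t - f t" c] s(2) strongly_meas_in[OF f]
        by (simp add: scaleR_diff_right)
      then show ?case using tendsto_mult_right_zero[OF elim(1), of "\<bar>c\<bar>"] by simp
    qed
  qed (use s f strongly_meas_in in auto)
qed

lemma strongly_meas_diff:
  assumes "strongly_meas f" "strongly_meas g"
  shows "strongly_meas (\<lambda>t. f t - g t)"
  using strongly_meas_add[OF assms(1) strongly_meas_scale[OF assms(2), of "-1"]] by simp

lemma norm_measurable:
  assumes f: "strongly_meas f"
  shows "(\<lambda>t. N (f t)) \<in> borel_measurable M"
proof -
  obtain s where s: "\<And>i. simple_function M (s i)" "\<And>i t. t \<in> space M \<Longrightarrow> s i t \<in> S"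
    and slim: "AE t in M. (\<lambda>i. N (s i t - f t)) \<longlonglongrightarrow> 0" using strongly_measE[OF f] by blast
  show ?thesis
  proof (rule borel_measurable_AE_LIMSEQ)
    show "(\<lambda>t. N (s i t)) \<in> borel_measurable M" for i
      by (intro borel_measurable_simple_function simple_function_compose1[OF s(1)])
    show "AE t in M. (\<lambda>i. N (s i t)) \<longlonglongrightarrow> N (f t)"
      using slim AE_space
      by eventually_elim (intro limit_norm, auto simp: s strongly_meas_in[OF f])
  qed
qed

text \<open>Convergence almost everywhere does not diagonalise, but convergence in measure does. From
  simple approximations \<open>s k i\<close> of \<open>f k\<close>, a diagonal sequence is extracted by measuring errors
  with \<open>\<integral> min 1 (N \<dots>)\<close>, which tends to zero by dominated convergence on the finite measure
  space, and whose summability gives back convergence almost everywhere.\<close>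

lemma strongly_meas_limit:
  assumes f: "\<And>k. strongly_meas (f k)" and g: "\<And>t. t \<in> space M \<Longrightarrow> g t \<in> S"
    and lim: "AE t in M. (\<lambda>k. N (f k t - g t)) \<longlonglongrightarrow> 0"
  shows "strongly_meas g"
proof -
  define P where "P k s \<longleftrightarrow> (\<forall>i. simple_function M (s i)) \<and> (\<forall>i. \<forall>t\<in>space M. s i t \<in> S) \<and>
      (AE t in M. (\<lambda>i. N (s i t - f k t)) \<longlonglongrightarrow> 0)" for k and s :: "nat \<Rightarrow> 't \<Rightarrow> 'a"
  have "\<exists>s. P k s" for k
    unfolding P_def by (rule strongly_measE[OF f[of k]]) blast
  then obtain s where "\<And>k. P k (s k)" by metis
  then have s: "\<And>k i. simple_function M (s k i)" "\<And>k i t. t \<in> space M \<Longrightarrow> s k i t \<in> S"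
    and slim: "\<And>k. AE t in M. (\<lambda>i. N (s k i t - f k t)) \<longlonglongrightarrow> 0"
    unfolding P_def by blast+
  have fS: "f k t \<in> S" if "t \<in> space M" for k t using that strongly_meas_in[OF f] by blast
  have dm: "(\<lambda>t. N (s k i t - f k t)) \<in> borel_measurable M" for k i
    by (intro norm_measurable strongly_meas_diff strongly_meas_simple f s)
  have "\<exists>i. (\<integral>\<^sup>+t. ennreal (min 1 (N (s k i t - f k t))) \<partial>M) \<le> ennreal (1 * (1/2) ^ k)" for k
  proof -
    have "(\<lambda>i. \<integral>\<^sup>+t. ennreal (min 1 (N (s k i t - f k t))) \<partial>M) \<longlonglongrightarrow> (\<integral>\<^sup>+t. 0 \<partial>M)"
    proof (rule nn_integral_dominated_convergence[where w = "\<lambda>_. 1"])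
      show "(\<integral>\<^sup>+t. 1 \<partial>M) < \<infinity>" by (simp flip: less_top)
      show "AE t in M. (\<lambda>i. ennreal (min 1 (N (s k i t - f k t)))) \<longlonglongrightarrow> 0"
        using slim[of k]
      proof eventually_elim
        case (elim t)
        then have "(\<lambda>i. min 1 (N (s k i t - f k t))) \<longlonglongrightarrow> min 1 0"
          by (intro tendsto_min tendsto_const)
        then show ?case using tendsto_ennrealI by fastforce
      qed
    qed (use dm in auto)
    then have "\<forall>\<^sub>F i in sequentially.
        (\<integral>\<^sup>+t. ennreal (min 1 (N (s k i t - f k t))) \<partial>M) < ennreal (1 * (1/2) ^ k)"
      by (intro order_tendstoD(2)) auto
    then show ?thesis using eventually_happens'[OF sequentially_bot] less_imp_le by blast
  qed
  then obtain i where i: "\<And>k. (\<integral>\<^sup>+t. ennreal (min 1 (N (s k (i k) t - f k t))) \<partial>M)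
      \<le> ennreal (1 * (1/2) ^ k)"
    by metis
  have "AE t in M. summable (\<lambda>k. min 1 (N (s k (i k) t - f k t)))"
    by (rule AE_tendsto_zero_of_summable_integrals[OF _ _ i]) (use dm s fS in auto)
  then have "AE t in M. (\<lambda>k. N (s k (i k) t - g t)) \<longlonglongrightarrow> 0"
    using lim AE_space
  proof eventually_elim
    case (elim t)
    have m0: "(\<lambda>k. min 1 (N (s k (i k) t - f k t))) \<longlonglongrightarrow> 0"
      using elim(1) by (rule summable_LIMSEQ_zero)
    then have "\<forall>\<^sub>F k in sequentially. min 1 (N (s k (i k) t - f k t)) < 1"
      by (rule order_tendstoD(2)) simp
    then have "\<forall>\<^sub>F k in sequentially. min 1 (N (s k (i k) t - f k t)) = N (s k (i k) t - f k t)"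
      by eventually_elim auto
    then have "(\<lambda>k. N (s k (i k) t - f k t)) \<longlonglongrightarrow> 0"
      using m0 by (rule Lim_transform_eventually[rotated])
    then have sum0: "(\<lambda>k. N (s k (i k) t - f k t) + N (f k t - g t)) \<longlonglongrightarrow> 0"
      using tendsto_add[OF _ elim(2)] by fastforce
    have le: "N (s k (i k) t - g t) \<le> N (s k (i k) t - f k t) + N (f k t - g t)" for k
      using triangle_diff[of "s k (i k) t" "f k t" "g t"] s(2) fS g elim(3) by simp
    show ?case
      by (rule tendsto_zero_le[OF sum0 _ le]) (use s(2) g elim(3) in simp)
  qed
  then show ?thesis
    by (intro strongly_measI[of g "\<lambda>k. s k (i k)"]) (use s g in auto)
qed

lemma L2_iff: "f \<in> L2 \<longleftrightarrow> strongly_meas f \<and> integrable M (\<lambda>t. (N (f t))\<^sup>2)"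
  unfolding L2_space_def using norm_measurable
  by (auto simp: integrable_iff_bounded)

lemma L2_in: "f \<in> L2 \<Longrightarrow> t \<in> space M \<Longrightarrow> f t \<in> S"
  by (simp add: L2_iff strongly_meas_in)

lemma L2_norm_measurable: "f \<in> L2 \<Longrightarrow> (\<lambda>t. N (f t)) \<in> borel_measurable M"
  by (simp add: L2_iff norm_measurable)

lemma L2_norm_integrable:
  assumes f: "f \<in> L2"
  shows "integrable M (\<lambda>t. N (f t))"
proof (rule Bochner_Integration.integrable_bound)
  show "integrable M (\<lambda>t. 1 + (N (f t))\<^sup>2)" using f by (simp add: L2_iff)
  have "\<bar>x\<bar> \<le> 1 + x\<^sup>2" for x :: real
  proof -
    have "0 \<le> (\<bar>x\<bar> - 1)\<^sup>2" by simp
    then show ?thesis by (simp add: power2_diff)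
  qed
  then show "AE t in M. norm (N (f t)) \<le> norm (1 + (N (f t))\<^sup>2)" by simp
qed (rule L2_norm_measurable[OF f])

lemma L2_scale: "f \<in> L2 \<Longrightarrow> c *\<^sub>R f \<in> L2"
proof -
  assume f: "f \<in> L2"
  have "integrable M (\<lambda>t. c\<^sup>2 * (N (f t))\<^sup>2)" using f by (simp add: L2_iff)
  then have "integrable M (\<lambda>t. (N (c *\<^sub>R f t))\<^sup>2)"
    by (rule Bochner_Integration.integrable_cong[THEN iffD1, rotated -1])
       (auto simp: N_scale L2_in[OF f] power_mult_distrib)
  then show ?thesis using f strongly_meas_scale by (simp add: L2_iff scaleR_fun_def)
qed

lemma L2_add: "f \<in> L2 \<Longrightarrow> g \<in> L2 \<Longrightarrow> f + g \<in> L2"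
proof -
  assume f: "f \<in> L2" and g: "g \<in> L2"
  have sm: "strongly_meas (\<lambda>t. f t + g t)" using f g by (simp add: L2_iff strongly_meas_add)
  have "integrable M (\<lambda>t. (N (f t + g t))\<^sup>2)"
  proof (rule Bochner_Integration.integrable_bound)
    show "integrable M (\<lambda>t. 2 * (N (f t))\<^sup>2 + 2 * (N (g t))\<^sup>2)" using f g by (simp add: L2_iff)
    show "AE t in M. norm ((N (f t + g t))\<^sup>2) \<le> norm (2 * (N (f t))\<^sup>2 + 2 * (N (g t))\<^sup>2)"
    proof (rule AE_I2)
      fix t assume t: "t \<in> space M"
      have "(N (f t + g t))\<^sup>2 \<le> (N (f t) + N (g t))\<^sup>2"
        using triangle[of "f t" "g t"] L2_in[OF f t] L2_in[OF g t] by (intro power_mono) auto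
      also have "\<dots> \<le> 2 * (N (f t))\<^sup>2 + 2 * (N (g t))\<^sup>2"
        using sum_squares_bound[of "N (f t)" "N (g t)"] by (simp add: power2_sum)
      finally show "norm ((N (f t + g t))\<^sup>2) \<le> norm (2 * (N (f t))\<^sup>2 + 2 * (N (g t))\<^sup>2)" by simp
    qed
  qed (use norm_measurable[OF sm] in measurable)
  then show ?thesis using sm by (simp add: L2_iff plus_fun_def)
qed

lemma L2_zero: "0 \<in> L2"
proof -
  have "strongly_meas (\<lambda>t. 0)" by (rule strongly_meas_simple) auto
  then show ?thesis by (simp add: L2_iff zero_fun_def)
qed

lemma L2_subspace: "subspace L2"
  unfolding subspace_def using L2_add L2_scale L2_zero by blast

lemma L2_diff: "f \<in> L2 \<Longrightarrow> g \<in> L2 \<Longrightarrow> f - g \<in> L2"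
  using L2_subspace by (rule subspace_diff)

lemma L2_ip_integrable:
  assumes f: "f \<in> L2" and g: "g \<in> L2"
  shows "integrable M (\<lambda>t. ip (f t) (g t))"
proof -
  have "integrable M (\<lambda>t. ((N (f t + g t))\<^sup>2 - (N (f t))\<^sup>2 - (N (g t))\<^sup>2) / 2)"
    using f g L2_add[OF f g] by (simp add: L2_iff plus_fun_def)
  then show ?thesis
  proof (rule Bochner_Integration.integrable_cong[THEN iffD1, rotated -1])
    fix t assume "t \<in> space M"
    then show "((N (f t + g t))\<^sup>2 - (N (f t))\<^sup>2 - (N (g t))\<^sup>2) / 2 = ip (f t) (g t)"
      using N_add_power2[of "f t" "g t" 1] L2_in[OF f] L2_in[OF g] by simp
  qed simp
qed

definition L2_ip :: "('t \<Rightarrow> 'a) \<Rightarrow> ('t \<Rightarrow> 'a) \<Rightarrow> real" where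
  "L2_ip f g = (LINT t|M. ip (f t) (g t))"

lemma L2_norm_power2: "f \<in> L2 \<Longrightarrow> (L2_norm N M f)\<^sup>2 = (LINT t|M. (N (f t))\<^sup>2)"
  by (simp add: L2_norm_def)

lemma L2_norm_nn_integral:
  "f \<in> L2 \<Longrightarrow> (\<integral>\<^sup>+t. ennreal ((N (f t))\<^sup>2) \<partial>M) = ennreal ((L2_norm N M f)\<^sup>2)"
  by (simp add: L2_norm_power2 L2_iff nn_integral_eq_integral)

text \<open>Riesz and Fischer: along a rapidly Cauchy subsequence the increments are summable in L1,
  hence pointwise almost everywhere, which gives a pointwise limit; Fatou's lemma turns it into
  a limit in norm of the whole sequence.\<close>

lemma L2_complete: "complete_norm_on L2 (L2_norm N M)"
  unfolding complete_norm_on_def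
proof (intro allI impI)
  fix u :: "nat \<Rightarrow> 't \<Rightarrow> 'a"
  assume u: "\<forall>n. u n \<in> L2"
    and cauchy: "\<forall>e>0. \<exists>K::nat. \<forall>m\<ge>K. \<forall>n\<ge>K. L2_norm N M (u m - u n) < e"
  have uS: "u n t \<in> S" if "t \<in> space M" for n t using u L2_in that by blast
  have "\<exists>K. \<forall>m\<ge>K. \<forall>n\<ge>K. L2_norm N M (u m - u n) < (1/2) ^ j" for j :: nat
    using cauchy by simp
  then obtain K :: "nat \<Rightarrow> nat" where
    K: "\<And>j m n. K j \<le> m \<Longrightarrow> K j \<le> n \<Longrightarrow> L2_norm N M (u m - u n) < (1/2) ^ j"
    by metis
  define r where "r j = (\<Sum>i\<le>j. K i)" for j :: nat
  have r: "K j \<le> r j" "r j \<le> r (Suc j)" for j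
    unfolding r_def by (auto intro: member_le_sum)
  have rmono: "r i \<le> r j" if "i \<le> j" for i j using r(2) that by (rule lift_Suc_mono_le)
  define d where "d j t = N (u (r (Suc j)) t - u (r j) t)" for j t
  have dL2: "u m - u n \<in> L2" for m n using L2_diff u by blast
  have d_int: "(\<integral>\<^sup>+t. ennreal (d j t) \<partial>M) \<le> ennreal ((1 + measure M (space M)) * (1/2) ^ j)" for j
  proof -
    have "(L2_norm N M (u (r (Suc j)) - u (r j)))\<^sup>2 \<le> ((1/2) ^ j)\<^sup>2"
      using K[of j "r (Suc j)" "r j"] order_trans[OF r(1) r(2)] r(1)
      by (intro power_mono) (auto simp: L2_norm_def less_imp_le)
    then have sq: "(LINT t|M. (d j t)\<^sup>2) \<le> ((1/2) ^ j)\<^sup>2"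
      using dL2 by (simp add: L2_norm_power2 d_def)
    have isq: "integrable M (\<lambda>t. (d j t)\<^sup>2)" "integrable M (d j)"
      using dL2[of "r (Suc j)" "r j"] L2_norm_integrable[OF dL2[of "r (Suc j)" "r j"]]
      unfolding d_def by (simp_all add: L2_iff)
    \<comment> \<open>The weight \<open>2\<^sup>j\<close> balances \<open>\<integral> d\<^sup>2 \<le> 4\<^sup>-\<^sup>j\<close> against the constant \<open>2\<^sup>-\<^sup>j\<close>.\<close>
    have "(LINT t|M. d j t) \<le> (LINT t|M. 2 ^ j * (d j t)\<^sup>2 + (1/2) ^ j)"
    proof (rule integral_mono)
      fix t
      have "x \<le> c * x\<^sup>2 + 1 / c" if "0 < c" for x c :: real
      proof -
        have "0 \<le> (c * x - 1)\<^sup>2" by simp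
        then have "2 * (c * x) \<le> c * (c * x\<^sup>2) + 1" by (simp add: power2_eq_square algebra_simps)
        moreover have "x * c \<le> \<bar>c * x\<bar>" by (simp add: mult.commute)
        moreover have "0 \<le> c * (c * x\<^sup>2) + 1" using that by simp
        ultimately have "c * x \<le> c * (c * x\<^sup>2) + 1" by linarith
        then show ?thesis using that by (simp add: field_simps)
      qed
      from this[of "2 ^ j" "d j t"] show "d j t \<le> 2 ^ j * (d j t)\<^sup>2 + (1/2) ^ j"
        by (simp add: power_one_over)
    qed (use isq in auto)
    also have "\<dots> = 2 ^ j * (LINT t|M. (d j t)\<^sup>2) + (1/2) ^ j * measure M (space M)"
      using isq by (simp add: mult.commute)
    also have "\<dots> \<le> 2 ^ j * ((1/2) ^ j)\<^sup>2 + (1/2) ^ j * measure M (space M)"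
      using sq by (intro add_right_mono mult_left_mono) auto
    also have "\<dots> = (1 + measure M (space M)) * (1/2) ^ j"
      by (simp add: power2_eq_square algebra_simps flip: power_mult_distrib)
    finally have "(LINT t|M. d j t) \<le> (1 + measure M (space M)) * (1/2) ^ j" .
    moreover have "(\<integral>\<^sup>+t. ennreal (d j t) \<partial>M) = ennreal (LINT t|M. d j t)"
      by (intro nn_integral_eq_integral isq AE_I2) (simp add: d_def uS)
    ultimately show ?thesis by (simp add: ennreal_leI)
  qed
  have "AE t in M. summable (\<lambda>j. d j t)"
    by (rule AE_tendsto_zero_of_summable_integrals[OF _ _ d_int])
       (use L2_norm_measurable[OF dL2] in \<open>auto simp: d_def uS\<close>)
  then have conv: "AE t in M. \<exists>x\<in>S. (\<lambda>j. N (u (r j) t - x)) \<longlonglongrightarrow> 0"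
    using AE_space
  proof eventually_elim
    case (elim t)
    show ?case
      using summable_steps_convergent[of "\<lambda>j. u (r j) t" "\<lambda>j. d j t"] uS elim by (auto simp: d_def)
  qed
  define f where "f t = (if \<exists>x\<in>S. (\<lambda>j. N (u (r j) t - x)) \<longlonglongrightarrow> 0
      then SOME x. x \<in> S \<and> (\<lambda>j. N (u (r j) t - x)) \<longlonglongrightarrow> 0 else 0)" for t
  have f: "f t \<in> S \<and> (\<lambda>j. N (u (r j) t - f t)) \<longlonglongrightarrow> 0"
    if "\<exists>x\<in>S. (\<lambda>j. N (u (r j) t - x)) \<longlonglongrightarrow> 0" for t
  proof -
    have "f t = (SOME x. x \<in> S \<and> (\<lambda>j. N (u (r j) t - x)) \<longlonglongrightarrow> 0)"
      using that by (simp add: f_def)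
    then show ?thesis using that by (auto intro: someI2)
  qed
  have fS: "f t \<in> S" for t
    using f[of t] by (cases "\<exists>x\<in>S. (\<lambda>j. N (u (r j) t - x)) \<longlonglongrightarrow> 0") (auto simp: f_def)
  have flim: "AE t in M. (\<lambda>j. N (u (r j) t - f t)) \<longlonglongrightarrow> 0"
    using conv by eventually_elim (use f in blast)
  have fsm: "strongly_meas f"
    by (rule strongly_meas_limit[OF _ _ flim]) (use u fS in \<open>auto simp: L2_iff\<close>)
  have fatou: "(\<integral>\<^sup>+t. ennreal ((N (u n t - f t))\<^sup>2) \<partial>M) \<le> ennreal (((1/2) ^ j)\<^sup>2)"
    if n: "K j \<le> n" for j n
  proof -
    have "(\<integral>\<^sup>+t. ennreal ((N (u n t - f t))\<^sup>2) \<partial>M)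
        = (\<integral>\<^sup>+t. liminf (\<lambda>i. ennreal ((N (u n t - u (r i) t))\<^sup>2)) \<partial>M)"
    proof (rule nn_integral_cong_AE)
      show "AE t in M. ennreal ((N (u n t - f t))\<^sup>2)
          = liminf (\<lambda>i. ennreal ((N (u n t - u (r i) t))\<^sup>2))"
        using flim AE_space
      proof eventually_elim
        case (elim t)
        have "(\<lambda>i. N (u n t - u (r i) t)) \<longlonglongrightarrow> N (u n t - f t)"
        proof (rule limit_norm)
          have "N (u n t - u (r i) t - (u n t - f t)) = N (u (r i) t - f t)" for i
            using N_minus_commute[of "u (r i) t" "f t"] uS[OF elim(2)] fS by simp
          then show "(\<lambda>i. N (u n t - u (r i) t - (u n t - f t))) \<longlonglongrightarrow> 0"
            using elim(1) by simp
        qed (use uS[OF elim(2)] fS in auto)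
        then have "(\<lambda>i. ennreal ((N (u n t - u (r i) t))\<^sup>2)) \<longlonglongrightarrow> ennreal ((N (u n t - f t))\<^sup>2)"
          by (intro tendsto_ennrealI tendsto_power)
        then show ?case using lim_imp_Liminf[OF sequentially_bot] by metis
      qed
    qed
    also have "\<dots> \<le> liminf (\<lambda>i. \<integral>\<^sup>+t. ennreal ((N (u n t - u (r i) t))\<^sup>2) \<partial>M)"
      using L2_norm_measurable[OF dL2] by (intro nn_integral_liminf) auto
    also have "\<dots> \<le> ennreal (((1/2) ^ j)\<^sup>2)"
    proof (rule Liminf_le)
      have "(\<integral>\<^sup>+t. ennreal ((N (u n t - u (r i) t))\<^sup>2) \<partial>M) \<le> ennreal (((1/2) ^ j)\<^sup>2)" if "j \<le> i" for i
      proof -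
        have "K j \<le> r i" using r(1)[of j] rmono[OF that] by linarith
        then have "(L2_norm N M (u n - u (r i)))\<^sup>2 \<le> ((1/2) ^ j)\<^sup>2"
          using K[OF n] by (intro power_mono) (auto simp: L2_norm_def less_imp_le)
        then show ?thesis
          using L2_norm_nn_integral[OF dL2[of n "r i"]] by (simp add: ennreal_leI)
      qed
      then show "\<forall>\<^sub>F i in sequentially.
          (\<integral>\<^sup>+t. ennreal ((N (u n t - u (r i) t))\<^sup>2) \<partial>M) \<le> ennreal (((1/2) ^ j)\<^sup>2)"
        unfolding eventually_sequentially by blast
    qed simp
    finally show ?thesis .
  qed
  have diff: "u n - f \<in> L2" if "K j \<le> n" for j n
    using fatou[OF that] strongly_meas_diff[of "u n" f] u fsm
    by (auto simp: L2_space_def fun_diff_def intro: le_less_trans)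
  have fL2: "f \<in> L2"
    using L2_diff[OF spec[OF u, of "K 0"] diff[of 0 "K 0"]] by simp
  have "L2_norm N M (u n - f) \<le> (1/2) ^ j" if "K j \<le> n" for j n
  proof (rule power2_le_imp_le)
    show "(L2_norm N M (u n - f))\<^sup>2 \<le> ((1/2) ^ j)\<^sup>2"
      using fatou[OF that] L2_norm_nn_integral[OF diff[OF that]] by simp
  qed simp
  then have "(\<lambda>n. L2_norm N M (u n - f)) \<longlonglongrightarrow> 0"
  proof (intro LIMSEQ_I)
    fix e :: real assume "0 < e" and
      le: "\<And>j n. K j \<le> n \<Longrightarrow> L2_norm N M (u n - f) \<le> (1/2) ^ j"
    then obtain j where "(1/2) ^ j < e" using real_arch_pow_inv[of e "1/2"] by auto
    then have "norm (L2_norm N M (u n - f) - 0) < e" if "K j \<le> n" for n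
      using le[OF that] by (simp add: L2_norm_def)
    then show "\<exists>no. \<forall>n\<ge>no. norm (L2_norm N M (u n - f) - 0) < e" by blast
  qed
  then show "\<exists>l\<in>L2. (\<lambda>n. L2_norm N M (u n - l)) \<longlonglongrightarrow> 0" using fL2 by blast
qed

lemma L2_semi_hilbert: "semi_hilbert L2 (L2_norm N M) L2_ip"
proof
  show "subspace L2" by (rule L2_subspace)
  show "complete_norm_on L2 (L2_norm N M)" by (rule L2_complete)
  fix f assume f: "f \<in> L2"
  show "0 \<le> L2_ip f f" unfolding L2_ip_def
    by (intro integral_nonneg_AE AE_I2) (simp add: ip_nonneg L2_in[OF f])
  show "L2_norm N M f = sqrt (L2_ip f f)" unfolding L2_ip_def L2_norm_def
    by (intro arg_cong[of _ _ sqrt] Bochner_Integration.integral_cong) (auto simp: N_power2 L2_in[OF f])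
  fix g assume g: "g \<in> L2"
  show "L2_ip f g = L2_ip g f" unfolding L2_ip_def
    by (intro Bochner_Integration.integral_cong) (auto simp: sym L2_in[OF f] L2_in[OF g])
  show "L2_ip (c *\<^sub>R f) g = c * L2_ip f g" for c
    unfolding L2_ip_def
    by (subst integral_mult_right_zero[symmetric], intro Bochner_Integration.integral_cong)
       (auto simp: scale_left L2_in[OF f] L2_in[OF g] scaleR_fun_def)
  fix h assume h: "h \<in> L2"
  have "L2_ip (f + g) h = (LINT t|M. ip (f t) (h t) + ip (g t) (h t))"
    unfolding L2_ip_def
    by (intro Bochner_Integration.integral_cong) (auto simp: add_left L2_in[OF f] L2_in[OF g] L2_in[OF h])
  then show "L2_ip (f + g) h = L2_ip f h + L2_ip g h"
    unfolding L2_ip_def using L2_ip_integrable f g h by simp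
qed

end


section \<open>Smooth steps\<close>

text \<open>The functions \<open>exp (-1/x) / x\<^sup>k\<close> for \<open>x > 0\<close>, extended by 0, are closed under
  differentiation up to linear combinations; dividing by \<open>x\<close> raises \<open>k\<close> by one, also in the
  difference quotient at 0.\<close>

definition flat :: "nat \<Rightarrow> real \<Rightarrow> real" where
  "flat k x = (if x \<le> 0 then 0 else exp (- (1 / x)) / x ^ k)"

lemma flat_at_0: "(flat k \<longlongrightarrow> 0) (at 0)"
proof -
  have "((\<lambda>x. (1 / x) ^ k / exp (1 / x)) \<longlongrightarrow> (0::real)) (at_right 0)"
    using filterlim_compose[OF tendsto_power_div_exp_0[of k] filterlim_inverse_at_top_right]
    by (simp add: inverse_eq_divide)
  then have "(flat k \<longlongrightarrow> 0) (at_right 0)"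
    by (rule Lim_transform_eventually)
       (auto simp: eventually_at_right_field flat_def exp_minus power_one_over field_simps
         intro!: exI[of _ 1])
  moreover have "(flat k \<longlongrightarrow> 0) (at_left 0)"
    by (rule Lim_transform_eventually[OF tendsto_const])
       (auto simp: eventually_at_left_field flat_def intro!: exI[of _ "-1"])
  ultimately show ?thesis using filterlim_at_split by blast
qed

lemma flat_has_derivative:
  "(flat k has_field_derivative flat (k + 2) x - real k * flat (k + 1) x) (at x)"
proof -
  consider "x < 0" | "x = 0" | "0 < x" by linarith
  then show ?thesis
  proof cases
    case 1
    have "((\<lambda>_. 0) has_field_derivative 0) (at x)" by simp
    then have "(flat k has_field_derivative 0) (at x)"
      by (rule has_field_derivative_transform_within_open[of _ _ _ "{..<0}"])
         (use 1 in \<open>auto simp: flat_def\<close>)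
    then show ?thesis using 1 by (simp add: flat_def)
  next
    case 2
    have "((\<lambda>h. (flat k (0 + h) - flat k 0) / h) \<longlongrightarrow> 0) (at 0)"
      by (rule Lim_transform_eventually[OF flat_at_0[of "k + 1"]])
         (auto simp: eventually_at_filter flat_def)
    then show ?thesis using 2 by (simp add: DERIV_def flat_def)
  next
    case 3
    have "((\<lambda>x. exp (- (1 / x)) / x ^ k) has_field_derivative
        flat (k + 2) x - real k * flat (k + 1) x) (at x)"
      by (cases k) (auto intro!: derivative_eq_intros simp: 3 flat_def field_simps power2_eq_square
          simp del: power_Suc simp: power_Suc[symmetric], use 3 in \<open>auto simp: flat_def field_simps\<close>)
    then show ?thesis
      by (rule has_field_derivative_transform_within_open[of _ _ _ "{0<..}"])
         (use 3 in \<open>auto simp: flat_def\<close>)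
  qed
qed

text \<open>A class of functions closed under differentiation, so that membership gives
  differentiability of all iterated derivatives. Closure under antiderivatives turns a bump
  into a smooth step without division by another smooth function.\<close>

inductive_set smooth_functions :: "(real \<Rightarrow> real) set" where
  flat: "flat k \<in> smooth_functions"
| const: "(\<lambda>_. c) \<in> smooth_functions"
| add: "f \<in> smooth_functions \<Longrightarrow> g \<in> smooth_functions \<Longrightarrow> (\<lambda>x. f x + g x) \<in> smooth_functions"
| mult: "f \<in> smooth_functions \<Longrightarrow> g \<in> smooth_functions \<Longrightarrow> (\<lambda>x. f x * g x) \<in> smooth_functions"
| affine: "f \<in> smooth_functions \<Longrightarrow> (\<lambda>x. f (a * x + b)) \<in> smooth_functions"
| antiderivative: "g \<in> smooth_functions \<Longrightarrow> (\<And>x. (f has_field_derivative g x) (at x)) \<Longrightarrow>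
    f \<in> smooth_functions"

lemma smooth_functions_derivative:
  "f \<in> smooth_functions \<Longrightarrow> \<exists>f'\<in>smooth_functions. \<forall>x. (f has_field_derivative f' x) (at x)"
proof (induction rule: smooth_functions.induct)
  case (flat k)
  have "(\<lambda>x. flat (k + 2) x + (- real k) * flat (k + 1) x) \<in> smooth_functions"
    by (intro smooth_functions.intros)
  then show ?case
    by (rule bexI[rotated]) (use flat_has_derivative[of k] in simp)
next
  case (const c)
  show ?case by (rule bexI[OF _ smooth_functions.const[of 0]]) simp
next
  case (add f g)
  then obtain f' g' where "f' \<in> smooth_functions" "g' \<in> smooth_functions"
    and "\<And>x. (f has_field_derivative f' x) (at x)" "\<And>x. (g has_field_derivative g' x) (at x)"
    by blast
  then show ?case
    by (intro bexI[of _ "\<lambda>x. f' x + g' x"])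
       (auto intro!: smooth_functions.add DERIV_add)
next
  case (mult f g)
  then obtain f' g' where "f' \<in> smooth_functions" "g' \<in> smooth_functions"
    and "\<And>x. (f has_field_derivative f' x) (at x)" "\<And>x. (g has_field_derivative g' x) (at x)"
    by blast
  then show ?case using mult.hyps
    by (intro bexI[of _ "\<lambda>x. f' x * g x + g' x * f x"])
       (auto intro!: smooth_functions.add smooth_functions.mult DERIV_mult)
next
  case (affine f a b)
  then obtain f' where f': "f' \<in> smooth_functions" "\<And>x. (f has_field_derivative f' x) (at x)"
    by blast
  have "((\<lambda>x. f (a * x + b)) has_field_derivative a * f' (a * x + b)) (at x)" for x
    by (rule DERIV_cong[OF DERIV_chain2[OF f'(2)]]) (auto intro!: derivative_eq_intros)
  moreover have "(\<lambda>x. a * f' (a * x + b)) \<in> smooth_functions"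
    by (intro smooth_functions.mult smooth_functions.const smooth_functions.affine f')
  ultimately show ?case by (intro bexI[of _ "\<lambda>x. a * f' (a * x + b)"] allI)
next
  case (antiderivative g f)
  then show ?case by blast
qed

lemma smooth_functions_iterated_deriv:
  "f \<in> smooth_functions \<Longrightarrow> (deriv ^^ k) f \<in> smooth_functions"
proof (induction k)
  case (Suc k)
  obtain f' where f': "f' \<in> smooth_functions" "\<And>x. ((deriv ^^ k) f has_field_derivative f' x) (at x)"
    using smooth_functions_derivative[OF Suc.IH[OF Suc.prems]] by blast
  then have "(deriv ^^ Suc k) f = f'" by (auto intro!: DERIV_imp_deriv)
  then show ?case using f' by simp
qed simp

lemma smooth_functions_differentiable:
  "f \<in> smooth_functions \<Longrightarrow> (deriv ^^ k) f differentiable at x"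
  using smooth_functions_derivative[OF smooth_functions_iterated_deriv[of f k]]
  by (meson has_field_derivative_imp_has_derivative differentiable_def)

lemma smooth_functions_continuous:
  "f \<in> smooth_functions \<Longrightarrow> continuous_on A f"
  using smooth_functions_derivative[of f] DERIV_isCont continuous_at_imp_continuous_on by metis

lemma smooth_step:
  obtains \<sigma> \<beta> :: "real \<Rightarrow> real" where "\<sigma> \<in> smooth_functions" "\<beta> \<in> smooth_functions"
    "\<And>x. (\<sigma> has_field_derivative \<beta> x) (at x)" "\<And>x. 0 \<le> \<beta> x"
    "\<And>x. x \<le> 1 \<Longrightarrow> \<sigma> x = 0" "\<And>x. 2 \<le> x \<Longrightarrow> \<sigma> x = 1" "\<And>x. x \<notin> {1..2} \<Longrightarrow> \<beta> x = 0"
proof -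
  define b where "b x = flat 0 (1 * x + (-1)) * flat 0 ((-1) * x + 2)" for x
  have b: "b \<in> smooth_functions"
    unfolding b_def by (intro smooth_functions.mult smooth_functions.affine smooth_functions.flat)
  have b_nonneg: "0 \<le> b x" and b_pos: "1 < x \<Longrightarrow> x < 2 \<Longrightarrow> 0 < b x"
    and b_zero: "x \<notin> {1..2} \<Longrightarrow> b x = 0" for x
    by (auto simp: b_def flat_def)
  have "isCont b x" for x using smooth_functions_continuous[OF b, of UNIV] by (simp add: continuous_on_eq_continuous_at)
  then obtain F where F: "\<And>x. (F has_vector_derivative b x) (at x)"
    using einterval_antiderivative[of "-\<infinity>" \<infinity> b] by auto
  then have F': "(F has_field_derivative b x) (at x)" for x
    by (simp add: has_real_derivative_iff_has_vector_derivative)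
  have F_low: "F x = F 1" if "x \<le> 1" for x
  proof (cases "x = 1")
    case False
    then have "x < 1" using that by simp
    moreover have "b z = 0" if "x < z" "z < 1" for z using that b_zero by simp
    ultimately show ?thesis
      using MVT2[of x 1 F b] F' by force
  qed simp
  have F_high: "F x = F 2" if "2 \<le> x" for x
  proof (cases "x = 2")
    case False
    then have "2 < x" using that by simp
    moreover have "b z = 0" if "2 < z" "z < x" for z using that b_zero by simp
    ultimately show ?thesis
      using MVT2[of 2 x F b] F' by force
  qed simp
  define c where "c = F 2 - F 1"
  have c: "0 < c"
    using MVT2[of 1 2 F b] F' b_pos unfolding c_def by force
  have "(\<lambda>x. (1 / c) * b x) \<in> smooth_functions"
    by (intro smooth_functions.mult smooth_functions.const b)
  moreover have d: "((\<lambda>x. (F x - F 1) / c) has_field_derivative (1 / c) * b x) (at x)" for x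
    using DERIV_cdivide[OF DERIV_diff[OF F'[of x] DERIV_const[of "F 1"]], of c] by simp
  ultimately have "(\<lambda>x. (F x - F 1) / c) \<in> smooth_functions"
    by (rule smooth_functions.antiderivative)
  moreover note \<open>(\<lambda>x. (1 / c) * b x) \<in> smooth_functions\<close> d
  moreover have "0 \<le> (1 / c) * b x" for x using b_nonneg[of x] c by simp
  moreover have "(F x - F 1) / c = 0" if "x \<le> 1" for x using F_low[OF that] by simp
  moreover have "(F x - F 1) / c = 1" if "2 \<le> x" for x using F_high[OF that] c by (simp add: c_def)
  moreover have "(1 / c) * b x = 0" if "x \<notin> {1..2}" for x using b_zero[OF that] by simp
  ultimately show thesis by (rule that)
qed


section \<open>Hoelder continuity of H1 functions\<close>

lemma Cauchy_Schwarz_integral: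
  fixes f g :: "'t \<Rightarrow> real"
  assumes m[measurable]: "f \<in> borel_measurable M" "g \<in> borel_measurable M"
    and i: "integrable M (\<lambda>t. (f t)\<^sup>2)" "integrable M (\<lambda>t. (g t)\<^sup>2)"
  shows "integrable M (\<lambda>t. f t * g t)"
    and "(LINT t|M. \<bar>f t * g t\<bar>)\<^sup>2 \<le> (LINT t|M. (f t)\<^sup>2) * (LINT t|M. (g t)\<^sup>2)"
proof -
  show int: "integrable M (\<lambda>t. f t * g t)"
  proof (rule Bochner_Integration.integrable_bound)
    show "integrable M (\<lambda>t. (f t)\<^sup>2 + (g t)\<^sup>2)" using i by simp
    have "\<bar>a * b\<bar> \<le> \<bar>a\<^sup>2 + b\<^sup>2\<bar>" for a b :: real
      using sum_squares_bound[of a b] sum_squares_bound[of a "-b"] by (simp add: abs_if)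
    then show "AE t in M. norm (f t * g t) \<le> norm ((f t)\<^sup>2 + (g t)\<^sup>2)" by simp
  qed measurable
  have "ennreal ((LINT t|M. \<bar>f t * g t\<bar>)\<^sup>2) = (\<integral>\<^sup>+t. ennreal \<bar>f t * g t\<bar> \<partial>M)\<^sup>2"
    using int by (subst nn_integral_eq_integral) (auto simp: ennreal_power)
  also have "\<dots> = (\<integral>\<^sup>+t. ennreal \<bar>f t\<bar> * ennreal \<bar>g t\<bar> \<partial>M)\<^sup>2"
    by (simp add: abs_mult ennreal_mult)
  also have "\<dots> \<le> (\<integral>\<^sup>+t. (ennreal \<bar>f t\<bar>)\<^sup>2 \<partial>M) * (\<integral>\<^sup>+t. (ennreal \<bar>g t\<bar>)\<^sup>2 \<partial>M)"
    by (rule Cauchy_Schwarz_nn_integral) measurable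
  also have "\<dots> = ennreal (LINT t|M. (f t)\<^sup>2) * ennreal (LINT t|M. (g t)\<^sup>2)"
    using i by (simp add: ennreal_power nn_integral_eq_integral)
  also have "\<dots> = ennreal ((LINT t|M. (f t)\<^sup>2) * (LINT t|M. (g t)\<^sup>2))"
    by (simp add: ennreal_mult)
  finally show "(LINT t|M. \<bar>f t * g t\<bar>)\<^sup>2 \<le> (LINT t|M. (f t)\<^sup>2) * (LINT t|M. (g t)\<^sup>2)"
    by (subst (asm) ennreal_le_iff) auto
qed

lemma lebesgue_on_Ioo:
  "finite_measure (lebesgue_on {a<..<b::real})" "complete_measure (lebesgue_on {a<..<b::real})"
  and lebesgue_on_Icc:
  "finite_measure (lebesgue_on {a..b::real})" "complete_measure (lebesgue_on {a..b::real})"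
  by (auto intro!: finite_measure_lebesgue_on complete_measure.intro
      simp: null_sets_restrict_space sets_restrict_space_iff)
     (auto intro: completion.complete2[THEN null_setsD2])

lemma integrable_continuous_Ioo:
  fixes f :: "real \<Rightarrow> real"
  assumes "continuous_on {a..b} f"
  shows "integrable (lebesgue_on {a<..<b}) f"
proof -
  have "integrable (lebesgue_on {a..b}) f"
    using continuous_imp_integrable[of a b f] assms by simp
  then have "set_integrable lebesgue {a..b} f"
    by (simp add: integrable_restrict_space set_integrable_def)
  then have "set_integrable lebesgue {a<..<b} f"
    by (rule set_integrable_subset) auto
  then show ?thesis by (simp add: integrable_restrict_space set_integrable_def)
qed

text \<open>A unit of mass concentrated near a point recovers the value of a continuous function
  there up to its oscillation.\<close>

lemma averaging_error:
  fixes f \<pi> :: "real \<Rightarrow> real"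
  assumes f: "continuous_on {a..b} f" and \<pi>: "continuous_on {a..b} \<pi>" "\<And>l. 0 \<le> \<pi> l"
    and P: "\<And>l. (P has_field_derivative \<pi> l) (at l)" "P b - P a = 1" and ab: "a \<le> b"
    and close: "\<And>l. l \<in> {a<..<b} \<Longrightarrow> \<pi> l \<noteq> 0 \<Longrightarrow> \<bar>f l - y\<bar> \<le> \<delta>"
  shows "\<bar>(LINT l|lebesgue_on {a<..<b}. \<pi> l * f l) - y\<bar> \<le> \<delta>"
proof -
  let ?M = "lebesgue_on {a<..<b}"
  have i\<pi>: "integrable ?M \<pi>" and if': "integrable ?M (\<lambda>l. \<pi> l * f l)"
    using f \<pi> by (auto intro!: integrable_continuous_Ioo continuous_on_mult)
  have "(\<pi> has_integral (P b - P a)) {a..b}"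
    using P(1) ab by (intro fundamental_theorem_of_calculus)
      (auto simp: has_real_derivative_iff_has_vector_derivative[symmetric] intro: has_field_derivative_at_within)
  then have "integral {a<..<b} \<pi> = 1"
    using P(2) by (simp add: integral_open_interval_real[symmetric] integral_unique)
  then have one: "(LINT l|?M. \<pi> l) = 1"
    using lebesgue_integral_eq_integral[OF i\<pi>] by simp
  have "(LINT l|?M. \<pi> l * f l) - y = (LINT l|?M. \<pi> l * f l - y * \<pi> l)"
    using i\<pi> if' one by simp
  also have "\<bar>\<dots>\<bar> \<le> (LINT l|?M. \<delta> * \<pi> l)"
  proof (rule integral_abs_bound_integral)
    fix l assume "l \<in> space ?M"
    then have l: "l \<in> {a<..<b}" by simp
    have "\<bar>\<pi> l * f l - y * \<pi> l\<bar> = \<pi> l * \<bar>f l - y\<bar>"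
      using \<pi>(2)[of l] by (simp add: abs_mult right_diff_distrib[symmetric] mult.commute[of y])
    also have "\<dots> \<le> \<pi> l * \<delta>"
      using close[OF l] \<pi>(2)[of l] by (cases "\<pi> l = 0") (auto intro: mult_left_mono)
    finally show "\<bar>\<pi> l * f l - y * \<pi> l\<bar> \<le> \<delta> * \<pi> l" by (simp add: mult.commute)
  qed (use i\<pi> if' in auto)
  also have "\<dots> = \<delta>" using one by simp
  finally show ?thesis .
qed

text \<open>Testing with smooth approximations of the indicator of \<open>[x,y]\<close>, supported inside
  \<open>[x,y]\<close>, turns the weak derivative identity into the fundamental theorem of calculus.\<close>

lemma weak_derivative_Hoelder:
  fixes f g :: "real \<Rightarrow> real"
  assumes f: "continuous_on {a..b} f"
    and g: "g \<in> borel_measurable (lebesgue_on {a<..<b})"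
    and g2: "integrable (lebesgue_on {a<..<b}) (\<lambda>l. (g l)\<^sup>2)"
    and weak: "\<And>\<theta>. test_function a b \<theta> \<Longrightarrow>
      (LINT l|lebesgue_on {a<..<b}. deriv \<theta> l * f l) = - (LINT l|lebesgue_on {a<..<b}. \<theta> l * g l)"
    and xy: "a \<le> x" "x < y" "y \<le> b"
  shows "\<bar>f x - f y\<bar> \<le> sqrt (LINT l|lebesgue_on {a<..<b}. (g l)\<^sup>2) * sqrt (y - x)"
proof (rule field_le_epsilon)
  let ?M = "lebesgue_on {a<..<b}"
  let ?D = "sqrt (LINT l|?M. (g l)\<^sup>2)"
  fix e :: real assume e: "0 < e"
  obtain \<sigma> \<beta> :: "real \<Rightarrow> real" where \<sigma>: "\<sigma> \<in> smooth_functions" and \<beta>: "\<beta> \<in> smooth_functions"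
    and der: "\<And>x. (\<sigma> has_field_derivative \<beta> x) (at x)" and \<beta>0: "\<And>x. 0 \<le> \<beta> x"
    and \<sigma>0: "\<And>x. x \<le> 1 \<Longrightarrow> \<sigma> x = 0" and \<sigma>1: "\<And>x. 2 \<le> x \<Longrightarrow> \<sigma> x = 1"
    and \<beta>s: "\<And>x. x \<notin> {1..2} \<Longrightarrow> \<beta> x = 0"
    using smooth_step by blast
  have \<sigma>_mono: "\<sigma> u \<le> \<sigma> v" if "u \<le> v" for u v
    using DERIV_nonneg_imp_nondecreasing[OF that] der \<beta>0 by metis
  have \<sigma>01: "0 \<le> \<sigma> u" "\<sigma> u \<le> 1" for u
    using \<sigma>_mono[of "min 1 u" u] \<sigma>_mono[of u "max 2 u"] \<sigma>0[of "min 1 u"] \<sigma>1[of "max 2 u"] by auto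
  have cont: "\<exists>d>0. \<forall>l\<in>{a..b}. \<bar>l - z\<bar> < d \<longrightarrow> \<bar>f l - f z\<bar> < e / 2" if "z \<in> {a..b}" for z
    using f[unfolded continuous_on_iff dist_real_def, rule_format, OF that, of "e / 2"] e by auto
  have "x \<in> {a..b}" "y \<in> {a..b}" using xy by auto
  then obtain d1 d2 where d: "0 < d1" "0 < d2"
    and d1: "\<And>l. l \<in> {a..b} \<Longrightarrow> \<bar>l - x\<bar> < d1 \<Longrightarrow> \<bar>f l - f x\<bar> < e / 2"
    and d2: "\<And>l. l \<in> {a..b} \<Longrightarrow> \<bar>l - y\<bar> < d2 \<Longrightarrow> \<bar>f l - f y\<bar> < e / 2"
    using cont[of x] cont[of y] by blast
  \<comment> \<open>The steps up and down take place in \<open>[x + \<epsilon>, x + 2 \<epsilon>]\<close> and \<open>[y - 2 \<epsilon>, y - \<epsilon>]\<close>, which are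
    disjoint and lie in the open interval even if \<open>x = a\<close> or \<open>y = b\<close>.\<close>
  define \<epsilon> where "\<epsilon> = min (min d1 d2 / 3) ((y - x) / 5)"
  have \<epsilon>: "0 < \<epsilon>" "3 * \<epsilon> \<le> d1" "3 * \<epsilon> \<le> d2" "5 * \<epsilon> \<le> y - x"
    using d xy by (auto simp: \<epsilon>_def min_def)
  define P where "P l = \<sigma> ((1/\<epsilon>) * l + (- x / \<epsilon>))" for l
  define Q where "Q l = \<sigma> ((1/\<epsilon>) * l + (3 - y / \<epsilon>))" for l
  define p where "p l = (1/\<epsilon>) * \<beta> ((1/\<epsilon>) * l + (- x / \<epsilon>))" for l
  define q where "q l = (1/\<epsilon>) * \<beta> ((1/\<epsilon>) * l + (3 - y / \<epsilon>))" for l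
  have "((\<lambda>l. \<sigma> (s * l + k)) has_field_derivative s * \<beta> (s * l + k)) (at l)" for s k l
    by (rule DERIV_cong[OF DERIV_chain2[OF der]]) (auto intro!: derivative_eq_intros)
  then have PQ: "(P has_field_derivative p l) (at l)" "(Q has_field_derivative q l) (at l)" for l
    unfolding P_def[abs_def] Q_def[abs_def] p_def q_def by blast+
  have sm: "P \<in> smooth_functions" "Q \<in> smooth_functions" "p \<in> smooth_functions" "q \<in> smooth_functions"
    unfolding P_def Q_def p_def q_def
    by (intro smooth_functions.mult smooth_functions.const smooth_functions.affine \<sigma> \<beta>)+
  define \<theta> where "\<theta> l = P l + (-1) * Q l" for l
  have \<theta>sm: "\<theta> \<in> smooth_functions"
    unfolding \<theta>_def by (intro smooth_functions.add smooth_functions.mult smooth_functions.const sm)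
  have \<theta>d: "deriv \<theta> l = p l - q l" for l
  proof (rule DERIV_imp_deriv)
    show "(\<theta> has_field_derivative p l - q l) (at l)"
      unfolding \<theta>_def using DERIV_diff[OF PQ(1)[of l] PQ(2)[of l]] by simp
  qed
  have \<theta>supp: "\<theta> l = 0" if "l \<notin> {x + \<epsilon>..y - \<epsilon>}" for l
  proof (cases "l < x + \<epsilon>")
    case True
    have "(1/\<epsilon>) * l + (- x / \<epsilon>) \<le> 1" "(1/\<epsilon>) * l + (3 - y / \<epsilon>) \<le> 1"
      using True \<epsilon> by (simp_all add: field_simps)
    then show ?thesis by (simp add: \<theta>_def P_def Q_def \<sigma>0)
  next
    case False
    then have "y - \<epsilon> < l" using that by auto
    then have "2 \<le> (1/\<epsilon>) * l + (- x / \<epsilon>)" "2 \<le> (1/\<epsilon>) * l + (3 - y / \<epsilon>)"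
      using \<epsilon> by (simp_all add: field_simps)
    then show ?thesis by (simp add: \<theta>_def P_def Q_def \<sigma>1)
  qed
  have \<theta>1: "\<bar>\<theta> l\<bar> \<le> 1" for l
    using \<sigma>01[of "(1/\<epsilon>) * l + (- x / \<epsilon>)"] \<sigma>01[of "(1/\<epsilon>) * l + (3 - y / \<epsilon>)"]
    unfolding \<theta>_def P_def Q_def by linarith
  have "{l. \<theta> l \<noteq> 0} \<subseteq> {x + \<epsilon>..y - \<epsilon>}" using \<theta>supp by blast
  then have "closure {l. \<theta> l \<noteq> 0} \<subseteq> {x + \<epsilon>..y - \<epsilon>}" by (intro closure_minimal) auto
  then have test: "test_function a b \<theta>"
    unfolding test_function_def using smooth_functions_differentiable[OF \<theta>sm] xy \<epsilon> by auto
  have ab: "a \<le> b" using xy by simp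
  have P1: "P b - P a = 1" "Q b - Q a = 1"
  proof -
    have "2 \<le> (1/\<epsilon>) * b + (- x / \<epsilon>)" "2 \<le> (1/\<epsilon>) * b + (3 - y / \<epsilon>)"
      "(1/\<epsilon>) * a + (- x / \<epsilon>) \<le> 1" "(1/\<epsilon>) * a + (3 - y / \<epsilon>) \<le> 1"
      using \<epsilon> xy by (simp_all add: field_simps)
    then show "P b - P a = 1" "Q b - Q a = 1" by (simp_all add: P_def Q_def \<sigma>0 \<sigma>1)
  qed
  have ep: "\<bar>(LINT l|?M. p l * f l) - f x\<bar> \<le> e / 2"
  proof (rule averaging_error[OF f _ _ PQ(1) P1(1) ab])
    fix l assume l: "l \<in> {a<..<b}" and "p l \<noteq> 0"
    then have "\<beta> ((1/\<epsilon>) * l + (- x / \<epsilon>)) \<noteq> 0" by (auto simp: p_def)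
    then have "(1/\<epsilon>) * l + (- x / \<epsilon>) \<in> {1..2}" using \<beta>s by blast
    then have "\<bar>l - x\<bar> < d1" using \<epsilon> by (auto simp: field_simps)
    then show "\<bar>f l - f x\<bar> \<le> e / 2" using d1[of l] l by simp
  qed (use smooth_functions_continuous[OF sm(3)] \<beta>0 \<epsilon> in \<open>auto simp: p_def\<close>)
  have eq: "\<bar>(LINT l|?M. q l * f l) - f y\<bar> \<le> e / 2"
  proof (rule averaging_error[OF f _ _ PQ(2) P1(2) ab])
    fix l assume l: "l \<in> {a<..<b}" and "q l \<noteq> 0"
    then have "\<beta> ((1/\<epsilon>) * l + (3 - y / \<epsilon>)) \<noteq> 0" by (auto simp: q_def)
    then have "(1/\<epsilon>) * l + (3 - y / \<epsilon>) \<in> {1..2}" using \<beta>s by blast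
    then have "\<bar>l - y\<bar> < d2" using \<epsilon> by (auto simp: field_simps)
    then show "\<bar>f l - f y\<bar> \<le> e / 2" using d2[of l] l by simp
  qed (use smooth_functions_continuous[OF sm(4)] \<beta>0 \<epsilon> in \<open>auto simp: q_def\<close>)
  have "(LINT l|?M. deriv \<theta> l * f l) = (LINT l|?M. p l * f l) - (LINT l|?M. q l * f l)"
    unfolding \<theta>d left_diff_distrib
    by (intro Bochner_Integration.integral_diff integrable_continuous_Ioo
        continuous_on_mult[OF smooth_functions_continuous f] sm)
  then have "\<bar>f x - f y\<bar> \<le> \<bar>LINT l|?M. \<theta> l * g l\<bar> + e"
    using ep eq weak[OF test] by linarith
  moreover have "\<bar>LINT l|?M. \<theta> l * g l\<bar> \<le> ?D * sqrt (y - x)"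
  proof -
    have i\<theta>: "integrable ?M (\<lambda>l. (\<theta> l)\<^sup>2)"
      by (intro integrable_continuous_Ioo continuous_on_power smooth_functions_continuous \<theta>sm)
    have \<theta>m: "\<theta> \<in> borel_measurable ?M"
      by (rule borel_measurable_integrable)
         (intro integrable_continuous_Ioo smooth_functions_continuous \<theta>sm)
    define A where "A = {x..y} \<inter> {a<..<b}"
    have A: "A \<in> sets ?M" by (simp add: A_def sets_restrict_space_iff)
    interpret M: finite_measure ?M by (rule lebesgue_on_Ioo)
    have "(LINT l|?M. (\<theta> l)\<^sup>2) \<le> (LINT l|?M. indicator A l)"
    proof (rule integral_mono[OF i\<theta>])
      show "integrable ?M (indicator A :: real \<Rightarrow> real)"
        using A by (rule integrable_real_indicator) (simp flip: less_top)
      fix l assume "l \<in> space ?M"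
      then show "(\<theta> l)\<^sup>2 \<le> indicator A l"
        using \<theta>supp[of l] \<theta>1[of l] \<epsilon> by (cases "l \<in> {x..y}") (auto simp: A_def abs_square_le_1)
    qed
    also have "(LINT l|?M. indicator A l) = measure ?M A"
      using A by (simp add: A_def)
    also have "\<dots> = measure lebesgue A" by (simp add: measure_restrict_space A_def)
    also have "\<dots> \<le> measure lebesgue {x..y}" by (intro measure_mono_fmeasurable) (auto simp: A_def)
    also have "\<dots> = y - x" using xy by simp
    finally have \<theta>2: "(LINT l|?M. (\<theta> l)\<^sup>2) \<le> y - x" .
    have "(LINT l|?M. \<bar>\<theta> l * g l\<bar>)\<^sup>2 \<le> (LINT l|?M. (\<theta> l)\<^sup>2) * (LINT l|?M. (g l)\<^sup>2)"
      by (rule Cauchy_Schwarz_integral(2)[OF \<theta>m g i\<theta> g2])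
    also have "\<dots> \<le> (y - x) * (LINT l|?M. (g l)\<^sup>2)"
      by (intro mult_right_mono \<theta>2) simp
    also have "\<dots> = (?D * sqrt (y - x))\<^sup>2"
      using xy by (simp add: power_mult_distrib)
    finally have "(LINT l|?M. \<bar>\<theta> l * g l\<bar>) \<le> ?D * sqrt (y - x)"
      by (rule power2_le_imp_le) (use xy in simp)
    then show ?thesis using integral_abs_bound[of ?M "\<lambda>l. \<theta> l * g l"] by linarith
  qed
  ultimately show "\<bar>f x - f y\<bar> \<le> ?D * sqrt (y - x) + e" by linarith
qed

context semi_hilbert_L2
begin

lemma functional_measurable:
  assumes L: "bounded_functional_on S N L" and f: "strongly_meas f"
  shows "(\<lambda>t. L (f t)) \<in> borel_measurable M"
proof -
  obtain s where s: "\<And>i. simple_function M (s i)" "\<And>i t. t \<in> space M \<Longrightarrow> s i t \<in> S"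
    and slim: "AE t in M. (\<lambda>i. N (s i t - f t)) \<longlonglongrightarrow> 0" using strongly_measE[OF f] by blast
  show ?thesis
  proof (rule borel_measurable_AE_LIMSEQ)
    show "(\<lambda>t. L (s i t)) \<in> borel_measurable M" for i
      by (intro borel_measurable_simple_function simple_function_compose1[OF s(1)])
    show "AE t in M. (\<lambda>i. L (s i t)) \<longlonglongrightarrow> L (f t)"
      using slim AE_space
      by eventually_elim (intro functional_limit[OF L], auto simp: s strongly_meas_in[OF f])
  qed
qed

lemma functional_sum:
  assumes L: "bounded_functional_on S N L" and "finite A" and "\<And>y. y \<in> A \<Longrightarrow> y \<in> S"
  shows "L (\<Sum>y\<in>A. c y *\<^sub>R y) = (\<Sum>y\<in>A. c y * L y) \<and> (\<Sum>y\<in>A. c y *\<^sub>R y) \<in> S"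
  using assms(2,3)
proof (induction A rule: finite_induct)
  case empty
  have "L (0 *\<^sub>R 0) = 0 * L 0" using L zero_in unfolding bounded_functional_on_def by blast
  then show ?case by simp
next
  case (insert y A)
  moreover have "L (c y *\<^sub>R y) = c y * L y"
    using L insert.prems[of y] unfolding bounded_functional_on_def by blast
  moreover have "L (c y *\<^sub>R y + (\<Sum>y\<in>A. c y *\<^sub>R y)) = L (c y *\<^sub>R y) + L (\<Sum>y\<in>A. c y *\<^sub>R y)"
    using L insert unfolding bounded_functional_on_def by (meson insertCI scale_in)
  ultimately show ?case by simp
qed

text \<open>This transfers vector-valued integrals on a carrier to scalar integrals.\<close>

lemma functional_bochner_integral:
  assumes L: "bounded_functional_on S N L" and f: "has_bochner_integral_on S N M f I"
  shows "has_bochner_integral M (\<lambda>t. L (f t)) (L I)"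
proof -
  obtain s where fm: "strongly_meas f" and I: "I \<in> S"
    and s: "\<And>i. Bochner_Integration.simple_bochner_integrable M (s i)"
    and sS: "\<And>i t. t \<in> space M \<Longrightarrow> s i t \<in> S"
    and int: "(\<lambda>i. \<integral>\<^sup>+t. ennreal (N (f t - s i t)) \<partial>M) \<longlonglongrightarrow> 0"
    and lim: "(\<lambda>i. N (Bochner_Integration.simple_bochner_integral M (s i) - I)) \<longlonglongrightarrow> 0"
    using f unfolding has_bochner_integral_on_def by blast
  obtain K where K: "\<And>x. x \<in> S \<Longrightarrow> \<bar>L x\<bar> \<le> K * N x"
    using L unfolding bounded_functional_on_def by blast
  have ss: "simple_function M (s i)" for i
    using s[of i] by (auto elim: Bochner_Integration.simple_bochner_integrable.cases)
  have fS: "f t \<in> S" if "t \<in> space M" for t using strongly_meas_in[OF fm that] .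
  have L0: "L 0 = 0" using functional_diff[OF L, of 0 0] by simp
  have Ls: "Bochner_Integration.simple_bochner_integrable M (\<lambda>t. L (s i t))" for i
    using Bochner_Integration.simple_bochner_integrable_compose2[OF _ s s, of "\<lambda>x y. L x" i i] L0 by simp
  have part: "Bochner_Integration.simple_bochner_integral M (\<lambda>t. L (s i t))
      = (\<Sum>y\<in>s i ` space M. measure M {t\<in>space M. s i t = y} *\<^sub>R L y)" for i
    by (rule Bochner_Integration.simple_bochner_integral_partition[OF Ls ss]) auto
  have sum: "L (Bochner_Integration.simple_bochner_integral M (s i))
        = Bochner_Integration.simple_bochner_integral M (\<lambda>t. L (s i t)) \<and>
      Bochner_Integration.simple_bochner_integral M (s i) \<in> S" for i
    unfolding part unfolding Bochner_Integration.simple_bochner_integral_def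
    using functional_sum[OF L, of "s i ` space M" "\<lambda>y. measure M {t\<in>space M. s i t = y}"]
      simple_functionD(1)[OF ss] sS by auto
  show ?thesis
  proof (rule has_bochner_integral.intros)
    show "(\<lambda>t. L (f t)) \<in> borel_measurable M" by (rule functional_measurable[OF L fm])
    show "Bochner_Integration.simple_bochner_integrable M (\<lambda>t. L (s i t))" for i by (rule Ls)
    show "(\<lambda>i. Bochner_Integration.simple_bochner_integral M (\<lambda>t. L (s i t))) \<longlonglongrightarrow> L I"
      using functional_limit[OF L _ I lim] sum by simp
    have le: "(\<integral>\<^sup>+t. ennreal (norm (L (f t) - L (s i t))) \<partial>M)
        \<le> ennreal \<bar>K\<bar> * (\<integral>\<^sup>+t. ennreal (N (f t - s i t)) \<partial>M)" for i
    proof -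
      have "(\<integral>\<^sup>+t. ennreal (norm (L (f t) - L (s i t))) \<partial>M)
          \<le> (\<integral>\<^sup>+t. ennreal \<bar>K\<bar> * ennreal (N (f t - s i t)) \<partial>M)"
      proof (rule nn_integral_mono)
        fix t assume t: "t \<in> space M"
        have "\<bar>L (f t) - L (s i t)\<bar> = \<bar>L (f t - s i t)\<bar>"
          using functional_diff[OF L fS[OF t] sS[OF t]] by simp
        also have "\<dots> \<le> \<bar>K\<bar> * N (f t - s i t)"
          using K[of "f t - s i t"] fS[OF t] sS[OF t]
            mult_right_mono[OF abs_ge_self[of K], of "N (f t - s i t)"]
          by (meson N_nonneg diff_in order_trans)
        finally show "ennreal (norm (L (f t) - L (s i t))) \<le> ennreal \<bar>K\<bar> * ennreal (N (f t - s i t))"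
          by (simp add: ennreal_leI flip: ennreal_mult')
      qed
      also have "\<dots> = ennreal \<bar>K\<bar> * (\<integral>\<^sup>+t. ennreal (N (f t - s i t)) \<partial>M)"
        by (intro nn_integral_cmult measurable_compose[OF _ measurable_ennreal]
            norm_measurable strongly_meas_diff fm strongly_meas_simple ss sS)
      finally show ?thesis .
    qed
    have "(\<lambda>i. ennreal \<bar>K\<bar> * (\<integral>\<^sup>+t. ennreal (N (f t - s i t)) \<partial>M)) \<longlonglongrightarrow> ennreal \<bar>K\<bar> * 0"
      using int by (intro ennreal_tendsto_cmult) auto
    then have lim0: "(\<lambda>i. ennreal \<bar>K\<bar> * (\<integral>\<^sup>+t. ennreal (N (f t - s i t)) \<partial>M)) \<longlonglongrightarrow> 0"
      by simp
    show "(\<lambda>i. \<integral>\<^sup>+t. ennreal (norm (L (f t) - L (s i t))) \<partial>M) \<longlonglongrightarrow> 0"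
      by (rule tendsto_sandwich[OF _ _ tendsto_const lim0]) (use le in auto)
  qed
qed

end

text \<open>Evaluating a component at a point is a bounded functional, which turns the vector-valued
  weak derivative into a scalar one. The bound \<open>c\<close> does not depend on the point, and so neither
  does the Hoelder constant.\<close>

lemma H1_space_Hoelder:
  fixes V :: "('x \<Rightarrow> real^'n) set"
  assumes V: "semi_hilbert V N ip"
    and ev: "\<And>f x. f \<in> V \<Longrightarrow> norm (f x) \<le> c * N f"
    and v: "v \<in> H1_space V N a b"
  shows "\<exists>K\<ge>0. \<forall>x. \<forall>l\<in>{a..b}. \<forall>m\<in>{a..b}. norm (v l x - v m x) \<le> K * sqrt \<bar>l - m\<bar>"
proof -
  let ?M = "lebesgue_on {a<..<b}"
  interpret V: semi_hilbert_L2 V N ip ?M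
    using V lebesgue_on_Ioo by (simp add: semi_hilbert_L2_def)
  have vV: "v l \<in> V" and vcont: "((\<lambda>m. N (v m - v l)) \<longlongrightarrow> 0) (at l within {a..b})"
    if "l \<in> {a..b}" for l
    using v that unfolding H1_space_def by auto
  obtain w where w: "w \<in> V.L2" and weak: "weak_derivative V N a b v w"
    using v unfolding H1_space_def by auto
  define D where "D = sqrt (LINT l|?M. (c * N (w l))\<^sup>2)"
  have L: "bounded_functional_on V N (\<lambda>f. f x $ i)" for x i
  proof -
    have "\<bar>f x $ i\<bar> \<le> c * N f" if "f \<in> V" for f
      using ev[OF that, of x] component_le_norm_cart[of "f x" i] by linarith
    then show ?thesis
      unfolding bounded_functional_on_def by (auto simp: scaleR_fun_def)
  qed
  have comp: "\<bar>v l x $ i - v m x $ i\<bar> \<le> D * sqrt (m - l)" if lm: "a \<le> l" "l < m" "m \<le> b" for x i l m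
  proof -
    let ?g = "\<lambda>l. w l x $ i"
    have gm: "?g \<in> borel_measurable ?M"
      using w by (intro V.functional_measurable[OF L]) (simp add: V.L2_iff)
    have iw: "integrable ?M (\<lambda>l. (c * N (w l))\<^sup>2)"
      using w by (simp add: V.L2_iff power_mult_distrib)
    have le: "(w l x $ i)\<^sup>2 \<le> (c * N (w l))\<^sup>2" if "l \<in> space ?M" for l
    proof -
      have "\<bar>w l x $ i\<bar> \<le> c * N (w l)"
        using ev[OF V.L2_in[OF w that], of x] component_le_norm_cart[of "w l x" i] by linarith
      then have "\<bar>w l x $ i\<bar>\<^sup>2 \<le> (c * N (w l))\<^sup>2" by (intro power_mono) auto
      then show ?thesis by simp
    qed
    have g2: "integrable ?M (\<lambda>l. (?g l)\<^sup>2)"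
    proof (rule Bochner_Integration.integrable_bound[OF iw])
      show "AE l in ?M. norm ((?g l)\<^sup>2) \<le> norm ((c * N (w l))\<^sup>2)"
        using le by (intro AE_I2) auto
    qed (use gm in measurable)
    have "\<bar>v l x $ i - v m x $ i\<bar> \<le> sqrt (LINT l|?M. (?g l)\<^sup>2) * sqrt (m - l)"
    proof (rule weak_derivative_Hoelder[OF _ gm g2 _ lm])
      show "continuous_on {a..b} (\<lambda>l. v l x $ i)"
        unfolding continuous_on
      proof
        fix l assume l: "l \<in> {a..b}"
        have "((\<lambda>m. v m x $ i - v l x $ i) \<longlongrightarrow> 0) (at l within {a..b})"
        proof (rule tendsto_0_le[OF vcont[OF l], where K = c])
          show "\<forall>\<^sub>F m in at l within {a..b}. norm (v m x $ i - v l x $ i) \<le> norm (N (v m - v l)) * c"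
            unfolding eventually_at_filter
          proof (rule always_eventually, intro allI impI)
            fix m assume "m \<in> {a..b}"
            then have d: "v m - v l \<in> V" using vV l by blast
            then show "norm (v m x $ i - v l x $ i) \<le> norm (N (v m - v l)) * c"
              using ev[OF d, of x] component_le_norm_cart[of "(v m - v l) x" i]
              by (simp add: mult.commute)
          qed
        qed
        then show "((\<lambda>m. v m x $ i) \<longlongrightarrow> v l x $ i) (at l within {a..b})"
          by (simp add: LIM_zero_iff)
      qed
      fix \<theta> assume "test_function a b \<theta>"
      then obtain I where I1: "has_bochner_integral_on V N ?M (\<lambda>l. deriv \<theta> l *\<^sub>R v l) I"
        and I2: "has_bochner_integral_on V N ?M (\<lambda>l. \<theta> l *\<^sub>R w l) (- I)"
        using weak unfolding weak_derivative_def by blast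
      show "(LINT l|?M. deriv \<theta> l * v l x $ i) = - (LINT l|?M. \<theta> l * w l x $ i)"
        using V.functional_bochner_integral[OF L[of x i] I1]
          V.functional_bochner_integral[OF L[of x i] I2]
        by (simp add: has_bochner_integral_iff scaleR_fun_def)
    qed
    also have "\<dots> \<le> D * sqrt (m - l)"
      unfolding D_def by (intro mult_right_mono real_sqrt_le_mono integral_mono g2 iw le) (use lm in auto)
    finally show ?thesis .
  qed
  have comp': "\<bar>v l x $ i - v m x $ i\<bar> \<le> D * sqrt \<bar>l - m\<bar>" if "l \<in> {a..b}" "m \<in> {a..b}" for x i l m
    using comp[of l m x i] comp[of m l x i] that
    by (cases l m rule: linorder_cases) (auto simp: abs_minus_commute)
  have "norm (v l x - v m x) \<le> (real CARD('n) * D) * sqrt \<bar>l - m\<bar>"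
    if "l \<in> {a..b}" "m \<in> {a..b}" for x l m
  proof -
    have "norm (v l x - v m x) \<le> (\<Sum>i\<in>UNIV. \<bar>(v l x - v m x) $ i\<bar>)" by (rule norm_le_l1_cart)
    also have "\<dots> \<le> (\<Sum>i\<in>(UNIV :: 'n set). D * sqrt \<bar>l - m\<bar>)"
      using comp'[OF that] by (intro sum_mono) simp
    finally show ?thesis by simp
  qed
  moreover have "0 \<le> real CARD('n) * D" by (simp add: D_def)
  ultimately show ?thesis by blast
qed


section \<open>Uniform estimates for multi-scale vector fields\<close>

lemma hilbert_space_on_semi_hilbert:
  assumes "hilbert_space_on S N"
  shows "\<exists>ip. semi_hilbert S N ip"
proof -
  obtain ip where sub: "subspace S" and ip: "inner_product_on S ip"
    and N: "\<forall>x\<in>S. N x = sqrt (ip x x)" and c: "complete_norm_on S N"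
    using assms unfolding hilbert_space_on_def by blast
  have "ip 0 0 = 0"
    using ip subspace_0[OF sub] unfolding inner_product_on_def
    by (metis mult_zero_left scaleR_zero_left)
  then have "0 \<le> ip x x" if "x \<in> S" for x
    using ip that unfolding inner_product_on_def by (cases "x = 0") (auto simp: less_imp_le)
  then have "semi_hilbert S N ip"
    by (intro semi_hilbert.intro) (use sub ip N c in \<open>simp_all add: inner_product_on_def\<close>)
  then show ?thesis by blast
qed

lemma (in semi_hilbert) uniform_boundedness_vec:
  fixes T :: "'i \<Rightarrow> 'a \<Rightarrow> real^'n"
  assumes add: "\<And>i x y. i \<in> I \<Longrightarrow> x \<in> S \<Longrightarrow> y \<in> S \<Longrightarrow> T i (x + y) = T i x + T i y"
    and hom: "\<And>i c x. i \<in> I \<Longrightarrow> x \<in> S \<Longrightarrow> T i (c *\<^sub>R x) = c *\<^sub>R T i x"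
    and bdd: "\<And>i. i \<in> I \<Longrightarrow> \<exists>K. \<forall>x\<in>S. norm (T i x) \<le> K * N x"
    and pointwise: "\<And>x. x \<in> S \<Longrightarrow> \<exists>K. \<forall>i\<in>I. norm (T i x) \<le> K"
  shows "\<exists>K\<ge>0. \<forall>i\<in>I. \<forall>x\<in>S. norm (T i x) \<le> K * N x"
proof -
  have "\<exists>K\<ge>0. \<forall>j\<in>I \<times> UNIV. \<forall>x\<in>S. \<bar>T (fst j) x $ snd j\<bar> \<le> K * N x"
  proof (rule uniform_boundedness)
    fix j :: "'i \<times> 'n" assume "j \<in> I \<times> UNIV"
    then have j: "fst j \<in> I" by auto
    obtain K where "\<forall>x\<in>S. norm (T (fst j) x) \<le> K * N x" using bdd[OF j] by blast
    then have "\<forall>x\<in>S. \<bar>T (fst j) x $ snd j\<bar> \<le> K * N x"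
      using component_le_norm_cart order_trans by blast
    then show "bounded_functional_on S N (\<lambda>x. T (fst j) x $ snd j)"
      unfolding bounded_functional_on_def using add[OF j] hom[OF j] by auto
  next
    fix x assume "x \<in> S"
    then obtain K where "\<forall>i\<in>I. norm (T i x) \<le> K" using pointwise by blast
    then have "\<forall>j\<in>I \<times> UNIV. \<bar>T (fst j) x $ snd j\<bar> \<le> K"
      using component_le_norm_cart order_trans by fastforce
    then show "\<exists>K. \<forall>j\<in>I \<times> UNIV. \<bar>T (fst j) x $ snd j\<bar> \<le> K" by blast
  qed
  then obtain K where K: "0 \<le> K" "\<And>i k x. i \<in> I \<Longrightarrow> x \<in> S \<Longrightarrow> \<bar>T i x $ k\<bar> \<le> K * N x"
    by fastforce
  have "norm (T i x) \<le> (real CARD('n) * K) * N x" if "i \<in> I" "x \<in> S" for i x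
  proof -
    have "norm (T i x) \<le> (\<Sum>k\<in>UNIV. \<bar>T i x $ k\<bar>)" by (rule norm_le_l1_cart)
    also have "\<dots> \<le> (\<Sum>k\<in>(UNIV :: 'n set). K * N x)" using K(2)[OF that] by (intro sum_mono)
    finally show ?thesis by simp
  qed
  moreover have "0 \<le> real CARD('n) * K" using K by simp
  ultimately show ?thesis by blast
qed

lemma bounded_of_vanishing_at_infinity:
  fixes g :: "'a::euclidean_space \<Rightarrow> 'b::real_normed_vector"
  assumes g: "continuous_on UNIV g" "(g \<longlongrightarrow> 0) at_infinity"
  shows "\<exists>K. \<forall>x. norm (g x) \<le> K"
proof -
  have "\<forall>\<^sub>F x in at_infinity. dist (g x) 0 < 1" using g(2) by (rule tendstoD) simp
  then obtain b where b: "\<And>x. b \<le> norm x \<Longrightarrow> norm (g x) < 1"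
    by (auto simp: eventually_at_infinity)
  have "bounded (g ` cball 0 b)"
    using compact_continuous_image[OF continuous_on_subset[OF g(1)] compact_cball, of 0 b] compact_imp_bounded by auto
  then obtain K where K: "\<forall>x\<in>cball 0 b. norm (g x) \<le> K" by (auto simp: bounded_iff)
  have "norm (g x) \<le> max 1 K" for x
    using b[of x] K by (cases "b \<le> norm x") (auto simp: le_max_iff_disj less_imp_le)
  then show ?thesis by blast
qed

text \<open>Directional derivatives along a basis are continuous and vanish at infinity, hence are
  bounded, and they control the operator norm of the derivative.\<close>

lemma C0_space_bounded_Lipschitz:
  fixes f :: "real^'n \<Rightarrow> real^'n"
  assumes f: "f \<in> C0_space p" and p: "1 \<le> p"
  shows "\<exists>K. (\<forall>x. norm (f x) \<le> K) \<and> (\<forall>x y. norm (f x - f y) \<le> K * norm (x - y))"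
proof -
  have lt: "iter_deriv us f differentiable at x" if "length us < p" for us x
    using f that unfolding C0_space_def by blast
  have le: "\<exists>K. \<forall>x. norm (iter_deriv us f x) \<le> K" if "length us \<le> p" for us
    using f that unfolding C0_space_def by (intro bounded_of_vanishing_at_infinity) auto
  obtain K where K: "\<And>x. norm (f x) \<le> K" using le[of "[]"] p by auto
  have diff: "(f has_derivative frechet_derivative f (at x)) (at x)" for x
    using lt[of "[]" x] p by (simp add: frechet_derivative_works)
  have "\<exists>D. \<forall>x. norm (frechet_derivative f (at x) u) \<le> D" for u
    using le[of "[u]"] p by simp
  then obtain D where D: "\<And>u x. norm (frechet_derivative f (at x) u) \<le> D u" by metis
  define L where "L = (\<Sum>u\<in>Basis. D u)"
  have D0: "0 \<le> D u" for u using D[of 0 u] norm_ge_zero order_trans by blast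
  have L0: "0 \<le> L" by (simp add: L_def D0 sum_nonneg)
  have on: "norm (frechet_derivative f (at x) h) \<le> L * norm h" for x h
  proof -
    interpret D: bounded_linear "frechet_derivative f (at x)"
      using diff by (rule has_derivative_bounded_linear)
    have "frechet_derivative f (at x) h = frechet_derivative f (at x) (\<Sum>u\<in>Basis. (h \<bullet> u) *\<^sub>R u)"
      by (simp add: euclidean_representation)
    also have "\<dots> = (\<Sum>u\<in>Basis. (h \<bullet> u) *\<^sub>R frechet_derivative f (at x) u)"
      by (simp add: D.sum D.scaleR)
    also have "norm \<dots> \<le> (\<Sum>u\<in>Basis. norm h * D u)"
      by (rule sum_norm_le) (auto intro!: mult_mono D Basis_le_norm)
    finally show ?thesis by (simp add: L_def sum_distrib_left mult.commute)
  qed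
  have "norm (f x - f y) \<le> L * norm (x - y)" for x y
    by (rule differentiable_bound[of UNIV f "\<lambda>x. frechet_derivative f (at x)"])
       (auto intro!: diff onorm_bound[OF _ on] simp: L0)
  then have "norm (f x - f y) \<le> max K L * norm (x - y)" for x y
    by (meson max.cobounded2 mult_right_mono norm_ge_zero order_trans)
  moreover have "norm (f x) \<le> max K L" for x using K[of x] by simp
  ultimately show ?thesis by blast
qed

text \<open>Evaluations and difference quotients are families of bounded functionals which are
  bounded on each single function.\<close>

lemma rkhs_uniform_estimates:
  fixes V :: "(real^'n \<Rightarrow> real^'n) set"
  assumes V: "semi_hilbert V N ip" and ev: "\<And>x. \<exists>K. \<forall>f\<in>V. norm (f x) \<le> K * N f"
    and C0: "V \<subseteq> C0_space p" "1 \<le> p"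
  shows "\<exists>c\<ge>0. \<forall>f\<in>V. \<forall>x y. norm (f x) \<le> c * N f \<and> norm (f x - f y) \<le> c * N f * norm (x - y)"
proof -
  interpret semi_hilbert V N ip by (rule V)
  have bl: "\<exists>K. (\<forall>x. norm (f x) \<le> K) \<and> (\<forall>x y. norm (f x - f y) \<le> K * norm (x - y))" if "f \<in> V" for f
    using C0_space_bounded_Lipschitz C0 that by blast
  have "\<exists>K\<ge>0. \<forall>x\<in>UNIV. \<forall>f\<in>V. norm (f x) \<le> K * N f"
  proof (rule uniform_boundedness_vec)
    show "\<exists>K. \<forall>x\<in>UNIV. norm (f x) \<le> K" if "f \<in> V" for f using bl[OF that] by blast
  qed (use ev in \<open>auto simp: scaleR_fun_def\<close>)
  then obtain c1 where c1: "0 \<le> c1" "\<And>f x. f \<in> V \<Longrightarrow> norm (f x) \<le> c1 * N f" by blast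
  define T where "T j f = (1 / norm (fst j - snd j)) *\<^sub>R (f (fst j) - f (snd j))"
    for j :: "(real^'n) \<times> (real^'n)" and f :: "real^'n \<Rightarrow> real^'n"
  have normT: "norm (T j f) = norm (f (fst j) - f (snd j)) / norm (fst j - snd j)" for j f
    unfolding T_def by simp
  have "\<exists>K\<ge>0. \<forall>j\<in>{j. fst j \<noteq> snd j}. \<forall>f\<in>V. norm (T j f) \<le> K * N f"
  proof (rule uniform_boundedness_vec)
    fix j :: "(real^'n) \<times> (real^'n)" assume "j \<in> {j. fst j \<noteq> snd j}"
    have "norm (T j f) \<le> (1 / norm (fst j - snd j) * (2 * c1)) * N f" if f: "f \<in> V" for f
    proof -
      have "norm (f (fst j) - f (snd j)) \<le> 2 * c1 * N f"
        using norm_triangle_ineq4[of "f (fst j)" "f (snd j)"] c1(2)[OF f, of "fst j"]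
          c1(2)[OF f, of "snd j"] by linarith
      then have "1 / norm (fst j - snd j) * norm (f (fst j) - f (snd j))
          \<le> 1 / norm (fst j - snd j) * (2 * c1 * N f)" by (intro mult_left_mono) auto
      then show ?thesis by (simp add: T_def mult.assoc)
    qed
    then show "\<exists>K. \<forall>f\<in>V. norm (T j f) \<le> K * N f" by blast
  next
    fix f assume "f \<in> V"
    then obtain K where K: "\<And>x y. norm (f x - f y) \<le> K * norm (x - y)" using bl by blast
    have "norm (T j f) \<le> K" if "j \<in> {j. fst j \<noteq> snd j}" for j
      using K[of "fst j" "snd j"] that by (simp add: normT divide_le_eq)
    then show "\<exists>K. \<forall>j\<in>{j. fst j \<noteq> snd j}. norm (T j f) \<le> K" by blast
  qed (auto simp: T_def scaleR_fun_def algebra_simps)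
  then obtain c2 where c2: "0 \<le> c2" "\<And>f j. f \<in> V \<Longrightarrow> fst j \<noteq> snd j \<Longrightarrow> norm (T j f) \<le> c2 * N f"
    by blast
  have "norm (f x - f y) \<le> c2 * N f * norm (x - y)" if "f \<in> V" for f x y
    using c2(2)[OF that, of "(x, y)"] by (cases "x = y") (simp_all add: normT divide_le_eq)
  then have "norm (f x - f y) \<le> (c1 + c2) * N f * norm (x - y)"
    and "norm (f x) \<le> (c1 + c2) * N f" if "f \<in> V" for f x y
    using c1(1) c1(2)[OF that, of x] c2(1) that N_nonneg[OF that]
    by (simp_all add: distrib_right add_increasing add_increasing2)
  then show ?thesis using c1(1) c2(1) by (intro exI[of _ "c1 + c2"]) auto
qed

text \<open>The data on which the flow estimates depend: square-integrable controls take values in a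
  space of scale-dependent fields whose values, Lipschitz constants in space and Hoelder
  constants in scale are controlled by the norm.\<close>

locale scale_fields = semi_hilbert S N ip
  for S :: "(real \<Rightarrow> real^'n \<Rightarrow> real^'n) set" and N ip +
  fixes s1 s2 c :: real
  assumes c_nonneg: "0 \<le> c"
    and value_le: "v \<in> S \<Longrightarrow> l \<in> {s1..s2} \<Longrightarrow> norm (v l x) \<le> c * N v"
    and increment_le: "v \<in> S \<Longrightarrow> l \<in> {s1..s2} \<Longrightarrow> m \<in> {s1..s2} \<Longrightarrow>
      norm (v l x - v m y) \<le> c * N v * (norm (x - y) + sqrt \<bar>l - m\<bar>)"

text \<open>The uniform boundedness principle is applied to evaluations, and then to increments divided
  by \<open>norm (x - y) + sqrt \<bar>l - m\<bar>\<close>. On a single field the former are bounded because its norm in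
  \<open>V\<close> is continuous on the compact scale interval; the latter combine the Lipschitz bound in \<open>V\<close>
  at one scale with the Hoelder bound between two scales.\<close>

lemma H1_subspace_scale_fields:
  fixes V :: "(real^'n \<Rightarrow> real^'n) set"
  assumes S: "semi_hilbert S N ip" and SH: "S \<subseteq> H1_space V NV s1 s2"
    and ev: "\<And>l x. l \<in> {s1..s2} \<Longrightarrow> \<exists>K. \<forall>v\<in>S. norm (v l x) \<le> K * N v"
    and V: "semi_hilbert V NV ipV" and evV: "\<And>x. \<exists>K. \<forall>f\<in>V. norm (f x) \<le> K * NV f"
    and C0: "V \<subseteq> C0_space p" "1 \<le> p"
  shows "\<exists>c. scale_fields S N ip s1 s2 c"
proof -
  interpret semi_hilbert S N ip by (rule S)
  interpret V: semi_hilbert V NV ipV by (rule V)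
  obtain d where d: "0 \<le> d" "\<And>f x. f \<in> V \<Longrightarrow> norm (f x) \<le> d * NV f"
    "\<And>f x y. f \<in> V \<Longrightarrow> norm (f x - f y) \<le> d * NV f * norm (x - y)"
    using rkhs_uniform_estimates[OF V evV C0] by blast
  have vV: "v l \<in> V" and vcont: "((\<lambda>m. NV (v m - v l)) \<longlongrightarrow> 0) (at l within {s1..s2})"
    if "v \<in> S" "l \<in> {s1..s2}" for v l
    using SH that unfolding H1_space_def by auto
  have bdd: "\<exists>K\<ge>0. \<forall>l\<in>{s1..s2}. NV (v l) \<le> K" if v: "v \<in> S" for v
  proof -
    have "continuous_on {s1..s2} (\<lambda>l. NV (v l))"
      unfolding continuous_on
    proof
      fix l assume l: "l \<in> {s1..s2}"
      have "((\<lambda>m. NV (v m) - NV (v l)) \<longlongrightarrow> 0) (at l within {s1..s2})"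
      proof (rule tendsto_0_le[OF vcont[OF v l], where K = 1])
        show "\<forall>\<^sub>F m in at l within {s1..s2}. norm (NV (v m) - NV (v l)) \<le> norm (NV (v m - v l)) * 1"
          unfolding eventually_at_filter
          by (rule always_eventually)
             (auto intro!: order_trans[OF V.triangle_abs abs_ge_self] vV v l)
      qed
      then show "((\<lambda>m. NV (v m)) \<longlongrightarrow> NV (v l)) (at l within {s1..s2})" by (simp add: LIM_zero_iff)
    qed
    then have "bounded ((\<lambda>l. NV (v l)) ` {s1..s2})"
      by (intro compact_imp_bounded compact_continuous_image) auto
    then obtain K where "\<forall>l\<in>{s1..s2}. \<bar>NV (v l)\<bar> \<le> K" by (auto simp: bounded_iff)
    then have "\<forall>l\<in>{s1..s2}. NV (v l) \<le> max 0 K" by (auto simp: le_max_iff_disj dest!: bspec abs_le_D1)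
    then show ?thesis by (intro exI[of _ "max 0 K"]) auto
  qed
  have "\<exists>K\<ge>0. \<forall>j\<in>{s1..s2} \<times> UNIV. \<forall>v\<in>S. norm (v (fst j) (snd j)) \<le> K * N v"
  proof (rule uniform_boundedness_vec)
    fix v assume v: "v \<in> S"
    then obtain K where K: "\<And>l. l \<in> {s1..s2} \<Longrightarrow> NV (v l) \<le> K" using bdd by blast
    have "norm (v l x) \<le> d * K" if "l \<in> {s1..s2}" for l x
      using d(2)[OF vV[OF v that], of x] mult_left_mono[OF K[OF that] d(1)] by linarith
    then show "\<exists>K. \<forall>j\<in>{s1..s2} \<times> UNIV. norm (v (fst j) (snd j)) \<le> K" by fastforce
  qed (use ev in \<open>auto simp: scaleR_fun_def\<close>)
  then obtain c1 where c1: "0 \<le> c1" "\<And>v l x. v \<in> S \<Longrightarrow> l \<in> {s1..s2} \<Longrightarrow> norm (v l x) \<le> c1 * N v"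
    by fastforce
  define I where "I = {(l, m, x, y) | l m x y :: real^'n. l \<in> {s1..s2} \<and> m \<in> {s1..s2} \<and>
      0 < norm (x - y) + sqrt \<bar>l - m\<bar>}"
  define T where "T j v = (case j of (l, m, x, y) \<Rightarrow>
      (1 / (norm (x - y) + sqrt \<bar>l - m\<bar>)) *\<^sub>R (v l x - v m y))"
    for j :: "real \<times> real \<times> (real^'n) \<times> (real^'n)" and v :: "real \<Rightarrow> real^'n \<Rightarrow> real^'n"
  have normT: "norm (T (l, m, x, y) v) = norm (v l x - v m y) / (norm (x - y) + sqrt \<bar>l - m\<bar>)"
    for l m x y v
    unfolding T_def by (simp add: abs_of_nonneg)
  have "\<exists>K\<ge>0. \<forall>j\<in>I. \<forall>v\<in>S. norm (T j v) \<le> K * N v"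
  proof (rule uniform_boundedness_vec)
    fix j assume "j \<in> I"
    then obtain l m x y where j: "j = (l, m, x, y)" and lm: "l \<in> {s1..s2}" "m \<in> {s1..s2}"
      unfolding I_def by blast
    define a where "a = 1 / (norm (x - y) + sqrt \<bar>l - m\<bar>)"
    have a: "0 \<le> a" by (simp add: a_def)
    have "norm (T j v) \<le> (a * (2 * c1)) * N v" if v: "v \<in> S" for v
    proof -
      have "norm (v l x - v m y) \<le> 2 * c1 * N v"
        using norm_triangle_ineq4[of "v l x" "v m y"] c1(2)[OF v lm(1), of x]
          c1(2)[OF v lm(2), of y] by linarith
      then have "a * norm (v l x - v m y) \<le> a * (2 * c1 * N v)" using a by (intro mult_left_mono)
      then show ?thesis using a by (simp add: T_def j mult.assoc flip: a_def)
    qed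
    then show "\<exists>K. \<forall>v\<in>S. norm (T j v) \<le> K * N v" by blast
  next
    fix v assume v: "v \<in> S"
    obtain K where K: "0 \<le> K" "\<And>l. l \<in> {s1..s2} \<Longrightarrow> NV (v l) \<le> K" using bdd[OF v] by blast
    obtain H where H: "0 \<le> H" "\<And>x l m. l \<in> {s1..s2} \<Longrightarrow> m \<in> {s1..s2} \<Longrightarrow>
        norm (v l x - v m x) \<le> H * sqrt \<bar>l - m\<bar>"
      using H1_space_Hoelder[OF V d(2), of v s1 s2] SH v by blast
    have "norm (T j v) \<le> d * K + H" if "j \<in> I" for j
    proof -
      obtain l m x y where j: "j = (l, m, x, y)" and lm: "l \<in> {s1..s2}" "m \<in> {s1..s2}"
        and pos: "0 < norm (x - y) + sqrt \<bar>l - m\<bar>"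
        using \<open>j \<in> I\<close> unfolding I_def by blast
      have "norm (v l x - v m y) \<le> norm (v l x - v l y) + norm (v l y - v m y)"
        using norm_triangle_ineq[of "v l x - v l y" "v l y - v m y"] by simp
      also have "norm (v l x - v l y) \<le> d * K * norm (x - y)"
        using d(3)[OF vV[OF v lm(1)], of x y]
          mult_right_mono[OF mult_left_mono[OF K(2)[OF lm(1)] d(1)], of "norm (x - y)"] by simp
      also have "norm (v l y - v m y) \<le> H * sqrt \<bar>l - m\<bar>" by (rule H(2)[OF lm])
      also have "d * K * norm (x - y) + H * sqrt \<bar>l - m\<bar>
          \<le> (d * K + H) * (norm (x - y) + sqrt \<bar>l - m\<bar>)"
        using d(1) K(1) H(1) by (simp add: algebra_simps)
      finally show ?thesis using pos by (simp add: j normT divide_le_eq)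
    qed
    then show "\<exists>K. \<forall>j\<in>I. norm (T j v) \<le> K" by blast
  qed (auto simp: T_def scaleR_fun_def algebra_simps split: prod.splits)
  then obtain c2 where c2: "0 \<le> c2" "\<And>j v. j \<in> I \<Longrightarrow> v \<in> S \<Longrightarrow> norm (T j v) \<le> c2 * N v" by blast
  have inc: "norm (v l x - v m y) \<le> c2 * N v * (norm (x - y) + sqrt \<bar>l - m\<bar>)"
    if "v \<in> S" "l \<in> {s1..s2}" "m \<in> {s1..s2}" for v l m x y
  proof (cases "0 < norm (x - y) + sqrt \<bar>l - m\<bar>")
    case True
    then have "(l, m, x, y) \<in> I" using that by (auto simp: I_def)
    from c2(2)[OF this that(1)] True show ?thesis by (simp add: normT divide_le_eq)
  next
    case False
    moreover have "0 \<le> norm (x - y)" "0 \<le> sqrt \<bar>l - m\<bar>" by simp_all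
    ultimately have "norm (x - y) = 0" "sqrt \<bar>l - m\<bar> = 0" by linarith+
    then show ?thesis by simp
  qed
  have "scale_fields S N ip s1 s2 (c1 + c2)"
  proof unfold_locales
    fix v l x assume v: "v \<in> S" and l: "l \<in> {s1..s2}"
    have "0 \<le> c2 * N v" using c2(1) N_nonneg[OF v] by simp
    then show "norm (v l x) \<le> (c1 + c2) * N v"
      using c1(2)[OF v l, of x] by (simp add: distrib_right)
    fix m y assume m: "m \<in> {s1..s2}"
    have "0 \<le> c1 * N v * (norm (x - y) + sqrt \<bar>l - m\<bar>)" using c1(1) N_nonneg[OF v] by simp
    then show "norm (v l x - v m y) \<le> (c1 + c2) * N v * (norm (x - y) + sqrt \<bar>l - m\<bar>)"
      using inc[OF v l m, of x y] by (simp add: distrib_right)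
  qed (use c1 c2 in simp)
  then show ?thesis by blast
qed


section \<open>Integral curves of square-integrable controls\<close>

abbreviation unit_time :: "real measure" where
  "unit_time \<equiv> lebesgue_on {0..1}"

lemma set_integral_unit_time:
  fixes g :: "real \<Rightarrow> 'b::euclidean_space"
  assumes "A \<subseteq> {0..1}"
  shows "set_integrable lebesgue A g \<longleftrightarrow> integrable unit_time (\<lambda>t. indicator A t *\<^sub>R g t)"
    and "(LINT t:A|lebesgue. g t) = (LINT t|unit_time. indicator A t *\<^sub>R g t)"
proof -
  have ind: "indicat_real {0..1} t * indicat_real A t = indicat_real A t" for t
    using assms by (auto simp: indicator_def)
  show "set_integrable lebesgue A g \<longleftrightarrow> integrable unit_time (\<lambda>t. indicator A t *\<^sub>R g t)"
    and "(LINT t:A|lebesgue. g t) = (LINT t|unit_time. indicator A t *\<^sub>R g t)"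
    by (simp_all add: set_integrable_def set_lebesgue_integral_def integrable_restrict_space
        integral_restrict_space ind)
qed

lemma sets_unit_time [simp]:
  "t \<le> 1 \<Longrightarrow> {0..t} \<in> sets unit_time" "0 \<le> s \<Longrightarrow> t \<le> 1 \<Longrightarrow> {s<..t} \<in> sets unit_time"
  by (auto simp: sets_restrict_space_iff)

lemma measure_unit_time:
  assumes "0 \<le> s" "s \<le> t" "t \<le> 1"
  shows "measure unit_time {s<..t} = t - s"
proof -
  have "measure unit_time {s<..t} = measure lebesgue {s<..t}"
    using assms by (intro measure_restrict_space) auto
  then show ?thesis using assms by simp
qed

lemma Gronwall_constant:
  fixes U :: "real \<Rightarrow> real"
  assumes U: "continuous_on {0..1} U" and K: "0 \<le> K"
    and le: "\<And>t. t \<in> {0..1} \<Longrightarrow> U t \<le> A + K * integral {0..t} U" and t: "t \<in> {0..1}"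
  shows "U t \<le> A * exp (K * t)"
proof (cases "t = 0")
  case True
  then show ?thesis using le[of 0] by simp
next
  case False
  then have t0: "0 < t" using t by simp
  define g where "g s = integral {0..s} U" for s
  define h where "h s = exp (- K * s) * (A + K * g s)" for s
  have g: "(g has_real_derivative U s) (at s within {0..1})" if "s \<in> {0..1}" for s
    unfolding g_def using integral_has_real_derivative[OF U that] .
  have h: "(h has_real_derivative exp (- K * s) * (K * U s - K * (A + K * g s))) (at s within {0..1})"
    if "s \<in> {0..1}" for s
    unfolding h_def by (auto intro!: derivative_eq_intros g[OF that] simp: algebra_simps)
  have cont: "continuous_on {0..1} h"
    by (auto simp: continuous_on_eq_continuous_within intro: DERIV_continuous[OF h])
  have "h t \<le> h 0"
  proof (rule DERIV_nonpos_imp_decreasing_open[OF t0[THEN less_imp_le]])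
    fix s assume s: "0 < s" "s < t"
    have "at s within {0..1} = at s"
      using s t by (intro at_within_interior) auto
    moreover have "exp (- K * s) * (K * U s - K * (A + K * g s)) \<le> 0"
      using mult_left_mono[OF le[of s] K] s t by (auto simp: g_def mult_le_0_iff)
    ultimately show "\<exists>y. (h has_real_derivative y) (at s) \<and> y \<le> 0"
      using h[of s] s t by auto
  qed (use cont t in \<open>auto elim: continuous_on_subset\<close>)
  then have "exp (- K * t) * (A + K * g t) \<le> A" by (simp add: h_def g_def)
  then have "A + K * g t \<le> A * exp (K * t)"
    by (simp add: exp_minus field_simps)
  then show ?thesis using le[OF t] by (simp add: g_def)
qed

text \<open>Squaring the inequality and applying the Cauchy-Schwarz inequality reduces the case of a
  square-integrable coefficient \<open>k\<close> to that of a constant coefficient, with a bound depending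
  only on the norm of \<open>k\<close>.\<close>

lemma Gronwall_L2:
  fixes u k :: "real \<Rightarrow> real"
  assumes u: "continuous_on {0..1} u"
    and k: "k \<in> borel_measurable unit_time" "integrable unit_time (\<lambda>t. (k t)\<^sup>2)"
    and B: "(LINT t|unit_time. (k t)\<^sup>2) \<le> B\<^sup>2"
    and a: "0 \<le> a" and nn: "\<And>t. t \<in> {0..1} \<Longrightarrow> 0 \<le> u t"
    and le: "\<And>t. t \<in> {0..1} \<Longrightarrow> u t \<le> a + (LINT s|unit_time. indicator {0..t} s * (k s * u s))"
    and t: "t \<in> {0..1}"
  shows "u t \<le> sqrt 2 * exp (B\<^sup>2) * a"
proof -
  have um: "u \<in> borel_measurable unit_time"
    using u by (intro continuous_imp_measurable_on_sets_lebesgue) auto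
  have sq: "(u r)\<^sup>2 \<le> 2 * a\<^sup>2 + (2 * B\<^sup>2) * integral {0..r} (\<lambda>s. (u s)\<^sup>2)" if r: "r \<in> {0..1}" for r
  proof -
    let ?I = "LINT s|unit_time. indicator {0..r} s * (k s * u s)"
    let ?f = "\<lambda>s. indicator {0..r} s * u s"
    have sets: "{0..r} \<in> sets unit_time" using r by simp
    note um[measurable] k(1)[measurable] sets[measurable]
    have u2: "set_integrable lebesgue {0..r} (\<lambda>s. (u s)\<^sup>2)"
    proof -
      have "integrable (lebesgue_on {0..r}) (\<lambda>s. (u s)\<^sup>2)"
        using continuous_imp_integrable[of 0 r "\<lambda>s. (u s)\<^sup>2"] r
        by (simp add: continuous_on_power continuous_on_subset[OF u])
      then show ?thesis by (simp add: integrable_restrict_space set_integrable_def)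
    qed
    have f2: "(?f s)\<^sup>2 = indicator {0..r} s *\<^sub>R (u s)\<^sup>2" for s by (simp add: indicator_def)
    have if2: "integrable unit_time (\<lambda>s. (?f s)\<^sup>2)"
      unfolding f2 using u2 set_integral_unit_time(1)[of "{0..r}" "\<lambda>s. (u s)\<^sup>2"] r by simp
    have "(LINT s|unit_time. (?f s)\<^sup>2) = (LINT s:{0..r}|lebesgue. (u s)\<^sup>2)"
      unfolding f2 using set_integral_unit_time(2)[of "{0..r}" "\<lambda>s. (u s)\<^sup>2"] r by simp
    also have "\<dots> = integral {0..r} (\<lambda>s. (u s)\<^sup>2)"
      using u2 by (rule set_lebesgue_integral_eq_integral(2))
    finally have I2: "(LINT s|unit_time. (?f s)\<^sup>2) = integral {0..r} (\<lambda>s. (u s)\<^sup>2)" .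
    have "?I = (LINT s|unit_time. ?f s * k s)" by (simp add: mult_ac)
    also have "\<dots> \<le> (LINT s|unit_time. \<bar>?f s * k s\<bar>)"
      by (rule order_trans[OF abs_ge_self integral_abs_bound])
    finally have "?I \<le> (LINT s|unit_time. \<bar>?f s * k s\<bar>)" .
    moreover have "0 \<le> u r" using nn[OF r] .
    ultimately have "(u r)\<^sup>2 \<le> (a + (LINT s|unit_time. \<bar>?f s * k s\<bar>))\<^sup>2"
      using le[OF r] by (intro power_mono) auto
    also have "\<dots> \<le> 2 * a\<^sup>2 + 2 * (LINT s|unit_time. \<bar>?f s * k s\<bar>)\<^sup>2"
      using sum_squares_bound[of a "LINT s|unit_time. \<bar>?f s * k s\<bar>"] by (simp add: power2_sum)
    also have "(LINT s|unit_time. \<bar>?f s * k s\<bar>)\<^sup>2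
        \<le> (LINT s|unit_time. (?f s)\<^sup>2) * (LINT s|unit_time. (k s)\<^sup>2)"
      by (rule Cauchy_Schwarz_integral(2)[OF _ k(1) if2 k(2)]) measurable
    also have "\<dots> \<le> (LINT s|unit_time. (?f s)\<^sup>2) * B\<^sup>2"
      by (intro mult_left_mono B) simp
    finally show ?thesis unfolding I2 by (simp add: mult_ac)
  qed
  have "(u t)\<^sup>2 \<le> 2 * a\<^sup>2 * exp (2 * B\<^sup>2 * t)"
    by (rule Gronwall_constant[OF _ _ sq t]) (use u in \<open>auto intro: continuous_on_power\<close>)
  also have "\<dots> \<le> 2 * a\<^sup>2 * exp (2 * B\<^sup>2 * 1)"
    using t by (intro mult_left_mono iffD2[OF exp_le_cancel_iff]) auto
  also have "\<dots> = (sqrt 2 * exp (B\<^sup>2) * a)\<^sup>2"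
    by (simp add: power_mult_distrib exp_double)
  finally show ?thesis by (rule power2_le_imp_le) (use a in simp)
qed

definition integral_curve ::
  "(real \<Rightarrow> real \<Rightarrow> real^'n \<Rightarrow> real^'n) \<Rightarrow> real \<Rightarrow> real^'n \<Rightarrow> (real \<Rightarrow> real^'n) \<Rightarrow> bool" where
  "integral_curve v l x y \<longleftrightarrow>
     (\<forall>t\<in>{0..1}. integrable unit_time (\<lambda>s. indicator {0..t} s *\<^sub>R v s l (y s)) \<and>
        y t = x + (LINT s|unit_time. indicator {0..t} s *\<^sub>R v s l (y s)))"

lemma flow_equation_integral_curves:
  "flow_equation s1 s2 v \<phi> \<longleftrightarrow> (\<forall>l\<in>{s1..s2}. \<forall>x. integral_curve v l x (\<lambda>t. \<phi> t l x))"
proof -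
  have "{0..t} \<subseteq> {0..1}" if "t \<in> {0..1}" for t :: real using that by auto
  then show ?thesis
    unfolding flow_equation_def integral_curve_def
    by (auto simp: set_integral_unit_time)
qed

sublocale scale_fields \<subseteq> control: semi_hilbert_L2 S N ip unit_time
  using lebesgue_on_Icc by (unfold_locales) (auto simp: complete_measure_def
      finite_measure_def finite_measure_axioms_def sigma_finite_measure_def)

context scale_fields
begin

sublocale L2: semi_hilbert control.L2 "L2_norm N unit_time" control.L2_ip
  by (rule control.L2_semi_hilbert)

lemma field_continuous:
  assumes "v \<in> S" "l \<in> {s1..s2}"
  shows "continuous_on A (v l)"
proof -
  have "(c * N v)-lipschitz_on A (v l)"
    using increment_le[OF assms assms(2)] c_nonneg N_nonneg[OF assms(1)]
    by (intro lipschitz_onI) (auto simp: dist_norm)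
  then show ?thesis by (rule lipschitz_on_continuous_on)
qed

text \<open>For a control with finitely many values the integrand is a measurable choice among finitely
  many continuous functions; evaluation bounds carry this over to limits of such controls.\<close>

lemma curve_measurable:
  assumes v: "control.strongly_meas v" and l: "l \<in> {s1..s2}" and y: "continuous_on {0..1} y"
  shows "(\<lambda>t. v t l (y t)) \<in> borel_measurable unit_time"
proof -
  obtain s where s: "\<And>i. simple_function unit_time (s i)" "\<And>i t. t \<in> space unit_time \<Longrightarrow> s i t \<in> S"
    and lim: "AE t in unit_time. (\<lambda>i. N (s i t - v t)) \<longlonglongrightarrow> 0" using control.strongly_measE[OF v] by blast
  show ?thesis
  proof (rule control.borel_measurable_AE_LIMSEQ)
    fix i
    let ?I = "s i ` space unit_time"
    show "(\<lambda>t. s i t l (y t)) \<in> borel_measurable unit_time"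
    proof (rule measurable_compose_countable'[where I = ?I and f = "\<lambda>a t. a l (y t)"])
      show "countable ?I" using simple_functionD(1)[OF s(1)] by (rule countable_finite)
      show "s i \<in> unit_time \<rightarrow>\<^sub>M count_space ?I"
      proof (rule measurableI)
        show "s i -` A \<inter> space unit_time \<in> sets unit_time" for A
          by (rule simple_functionD(2)[OF s(1)])
      qed simp
      fix a assume "a \<in> ?I"
      then have "a \<in> S" using s(2) by blast
      then have "continuous_on {0..1} (\<lambda>t. a l (y t))"
        using continuous_on_compose2[OF field_continuous[OF _ l, of a UNIV] y] by auto
      then show "(\<lambda>t. a l (y t)) \<in> borel_measurable unit_time"
        by (intro continuous_imp_measurable_on_sets_lebesgue) auto
    qed
  next
    show "AE t in unit_time. (\<lambda>i. s i t l (y t)) \<longlonglongrightarrow> v t l (y t)"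
      using lim AE_space
    proof eventually_elim
      case (elim t)
      have "norm (s i t l (y t) - v t l (y t)) \<le> c * N (s i t - v t)" for i
        using value_le[OF _ l, of "s i t - v t" "y t"] s(2)[OF elim(2)] control.strongly_meas_in[OF v elim(2)]
        by simp
      from tendsto_zero_le[OF tendsto_mult_right_zero[OF elim(1)] norm_ge_zero this]
      have "(\<lambda>i. norm (s i t l (y t) - v t l (y t))) \<longlonglongrightarrow> 0" .
      then show ?case by (simp add: tendsto_norm_zero_iff LIM_zero_iff)
    qed
  qed
qed

lemma coefficient:
  assumes v: "v \<in> control.L2" and B: "L2_norm N unit_time v \<le> B"
  shows "(\<lambda>t. c * N (v t)) \<in> borel_measurable unit_time"
    and "integrable unit_time (\<lambda>t. (c * N (v t))\<^sup>2)"
    and "(LINT t|unit_time. (c * N (v t))\<^sup>2) \<le> (c * B)\<^sup>2"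
    and "integrable unit_time (\<lambda>t. c * N (v t))"
proof -
  show "(\<lambda>t. c * N (v t)) \<in> borel_measurable unit_time"
    using control.L2_norm_measurable[OF v] by measurable
  show i2: "integrable unit_time (\<lambda>t. (c * N (v t))\<^sup>2)"
    using v by (simp add: control.L2_iff power_mult_distrib)
  have "(LINT t|unit_time. (c * N (v t))\<^sup>2) = c\<^sup>2 * (L2_norm N unit_time v)\<^sup>2"
    by (simp add: power_mult_distrib control.L2_norm_power2[OF v])
  also have "\<dots> \<le> c\<^sup>2 * B\<^sup>2"
    using B L2.N_nonneg[OF v] by (intro mult_left_mono power_mono) auto
  finally show "(LINT t|unit_time. (c * N (v t))\<^sup>2) \<le> (c * B)\<^sup>2" by (simp add: power_mult_distrib)
  show "integrable unit_time (\<lambda>t. c * N (v t))"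
    using control.L2_norm_integrable[OF v] by simp
qed

lemma coefficient_integral:
  assumes v: "v \<in> control.L2" and B: "L2_norm N unit_time v \<le> B" and A: "A \<in> sets unit_time"
  shows "(LINT t|unit_time. indicator A t * (c * N (v t))) \<le> c * B * sqrt (measure unit_time A)"
proof -
  note k = coefficient[OF v B]
  have B0: "0 \<le> B" using L2.N_nonneg[OF v] B by linarith
  have ind2: "(indicator A t :: real)\<^sup>2 = indicator A t" for t by (simp add: indicator_def)
  have iA: "integrable unit_time (indicator A :: real \<Rightarrow> real)"
    using A by (rule integrable_real_indicator) (simp flip: less_top)
  have "A \<subseteq> {0..1}" using sets.sets_into_space[OF A] by simp
  then have mA: "(LINT t|unit_time. indicator A t) = measure unit_time A"
    using A by (simp add: Int_absorb2)
  have "(LINT t|unit_time. \<bar>indicator A t * (c * N (v t))\<bar>)\<^sup>2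
      \<le> (LINT t|unit_time. (indicator A t)\<^sup>2) * (LINT t|unit_time. (c * N (v t))\<^sup>2)"
    by (rule Cauchy_Schwarz_integral(2)) (use A k iA in \<open>auto simp: ind2\<close>)
  also have "\<dots> \<le> measure unit_time A * (c * B)\<^sup>2"
    unfolding ind2 mA by (intro mult_left_mono k) simp
  also have "\<dots> = (c * B * sqrt (measure unit_time A))\<^sup>2"
    by (simp add: power_mult_distrib)
  finally have "(LINT t|unit_time. \<bar>indicator A t * (c * N (v t))\<bar>) \<le> c * B * sqrt (measure unit_time A)"
    by (rule power2_le_imp_le) (use c_nonneg B0 in simp)
  then show ?thesis
    using integral_abs_bound[of unit_time "\<lambda>t. indicator A t * (c * N (v t))"] by linarith
qed

lemma curve_integrable:
  assumes v: "v \<in> control.L2" and l: "l \<in> {s1..s2}" and y: "continuous_on {0..1} y"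
  shows "integrable unit_time (\<lambda>t. v t l (y t))"
proof (rule Bochner_Integration.integrable_bound[OF coefficient(4)[OF v order_refl]])
  show "(\<lambda>t. v t l (y t)) \<in> borel_measurable unit_time"
    using v by (intro curve_measurable[OF _ l y]) (simp add: control.L2_iff)
  show "AE t in unit_time. norm (v t l (y t)) \<le> norm (c * N (v t))"
    using value_le[OF control.L2_in[OF v] l] by (intro AE_I2) (auto intro: order_trans[OF _ abs_ge_self])
qed

text \<open>Weak convergence of controls is used only through these functionals.\<close>

lemma curve_functional:
  assumes l: "l \<in> {s1..s2}" and y: "continuous_on {0..1} y" and t: "t \<in> {0..1}"
  shows "bounded_functional_on control.L2 (L2_norm N unit_time)
    (\<lambda>v. (LINT s|unit_time. indicator {0..t} s *\<^sub>R v s l (y s)) $ i)"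
proof -
  have A: "{0..t} \<in> sets unit_time" using t by simp
  have int: "integrable unit_time (\<lambda>s. indicator {0..t} s *\<^sub>R v s l (y s))" if "v \<in> control.L2" for v
    using curve_integrable[OF that l y] A by (rule integrable_mult_indicator[rotated])
  show ?thesis
    unfolding bounded_functional_on_def
  proof (intro conjI ballI allI exI[of _ c])
    fix u v assume "u \<in> control.L2" "v \<in> control.L2"
    then show "(LINT s|unit_time. indicator {0..t} s *\<^sub>R (u + v) s l (y s)) $ i =
        (LINT s|unit_time. indicator {0..t} s *\<^sub>R u s l (y s)) $ i +
        (LINT s|unit_time. indicator {0..t} s *\<^sub>R v s l (y s)) $ i"
      using int by (simp add: scaleR_add_right)
  next
    fix a v assume "v \<in> control.L2"
    have "(LINT s|unit_time. indicator {0..t} s *\<^sub>R (a *\<^sub>R v) s l (y s))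
        = (LINT s|unit_time. a *\<^sub>R (indicator {0..t} s *\<^sub>R v s l (y s)))"
      by (simp add: scaleR_fun_def mult.commute)
    also have "\<dots> = a *\<^sub>R (LINT s|unit_time. indicator {0..t} s *\<^sub>R v s l (y s))"
      by (rule integral_scaleR_right)
    finally show "(LINT s|unit_time. indicator {0..t} s *\<^sub>R (a *\<^sub>R v) s l (y s)) $ i =
        a * (LINT s|unit_time. indicator {0..t} s *\<^sub>R v s l (y s)) $ i"
      by simp
  next
    fix v assume v: "v \<in> control.L2"
    let ?I = "LINT s|unit_time. indicator {0..t} s *\<^sub>R v s l (y s)"
    have "\<bar>?I $ i\<bar> \<le> norm ?I" by (rule component_le_norm_cart)
    also have "\<dots> \<le> (LINT s|unit_time. indicator {0..1} s * (c * N (v s)))"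
    proof (rule Bochner_Integration.integral_norm_bound_integral[OF int[OF v]])
      show "integrable unit_time (\<lambda>s. indicator {0..1} s * (c * N (v s)))"
        using integrable_mult_indicator[OF _ coefficient(4)[OF v order_refl], of "{0..1}"] by simp
      fix s assume s: "s \<in> space unit_time"
      have "norm (v s l (y s)) \<le> c * N (v s)" by (rule value_le[OF control.L2_in[OF v s] l])
      then show "norm (indicator {0..t} s *\<^sub>R v s l (y s)) \<le> indicator {0..1} s * (c * N (v s))"
        using s c_nonneg N_nonneg[OF control.L2_in[OF v s]] by (auto simp: indicator_def)
    qed
    also have "\<dots> \<le> c * L2_norm N unit_time v * sqrt (measure unit_time {0..1})"
      by (rule coefficient_integral[OF v order_refl]) simp
    also have "measure unit_time {0..1} = 1"
      by (subst measure_restrict_space) auto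
    finally show "\<bar>?I $ i\<bar> \<le> c * L2_norm N unit_time v" by simp
  qed
qed

lemma integral_curve_increment:
  assumes v: "v \<in> control.L2" and B: "L2_norm N unit_time v \<le> B" and l: "l \<in> {s1..s2}"
    and y: "integral_curve v l x y" and st: "0 \<le> s" "s \<le> t" "t \<le> 1"
  shows "norm (y t - y s) \<le> c * B * sqrt (t - s)"
proof -
  have A: "{s<..t} \<in> sets unit_time" using st by simp
  have i: "integrable unit_time (\<lambda>r. indicator {0..t} r *\<^sub>R v r l (y r))"
    "integrable unit_time (\<lambda>r. indicator {0..s} r *\<^sub>R v r l (y r))"
    using y st unfolding integral_curve_def by auto
  have "y t - y s = (LINT r|unit_time. indicator {0..t} r *\<^sub>R v r l (y r))
      - (LINT r|unit_time. indicator {0..s} r *\<^sub>R v r l (y r))"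
    using y st unfolding integral_curve_def by auto
  also have "\<dots> = (LINT r|unit_time. indicator {0..t} r *\<^sub>R v r l (y r) - indicator {0..s} r *\<^sub>R v r l (y r))"
    using i by simp
  finally have eq: "y t - y s =
      (LINT r|unit_time. indicator {0..t} r *\<^sub>R v r l (y r) - indicator {0..s} r *\<^sub>R v r l (y r))" .
  have "norm (y t - y s) \<le> (LINT r|unit_time. indicator {s<..t} r * (c * N (v r)))"
    unfolding eq
  proof (rule Bochner_Integration.integral_norm_bound_integral)
    show "integrable unit_time (\<lambda>r. indicator {s<..t} r * (c * N (v r)))"
      using integrable_mult_indicator[OF A coefficient(4)[OF v B]] by simp
    fix r assume r: "r \<in> space unit_time"
    have "norm (v r l (y r)) \<le> c * N (v r)" by (rule value_le[OF control.L2_in[OF v r] l])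
    then show "norm (indicator {0..t} r *\<^sub>R v r l (y r) - indicator {0..s} r *\<^sub>R v r l (y r))
        \<le> indicator {s<..t} r * (c * N (v r))"
      using r st by (auto simp: indicator_def)
  qed (use i in simp)
  also have "\<dots> \<le> c * B * sqrt (measure unit_time {s<..t})"
    by (rule coefficient_integral[OF v B A])
  finally show ?thesis using st by (simp add: measure_unit_time)
qed

lemma integral_curve_continuous:
  assumes v: "v \<in> control.L2" and l: "l \<in> {s1..s2}" and y: "integral_curve v l x y"
  shows "continuous_on {0..1} y"
  unfolding continuous_on_def
proof
  fix s :: real assume s: "s \<in> {0..1}"
  let ?K = "c * L2_norm N unit_time v"
  have le: "norm (y t - y s) \<le> ?K * sqrt \<bar>t - s\<bar>" if "t \<in> {0..1}" for t
    using integral_curve_increment[OF v order_refl l y, of s t]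
      integral_curve_increment[OF v order_refl l y, of t s] s that
    by (cases "s \<le> t") (auto simp: norm_minus_commute)
  have "((\<lambda>t. ?K * sqrt \<bar>t - s\<bar>) \<longlongrightarrow> ?K * sqrt \<bar>s - s\<bar>) (at s within {0..1})"
    by (intro tendsto_intros)
  then have lim0: "((\<lambda>t. ?K * sqrt \<bar>t - s\<bar>) \<longlongrightarrow> 0) (at s within {0..1})" by simp
  have "((\<lambda>t. y t - y s) \<longlongrightarrow> 0) (at s within {0..1})"
    by (rule Lim_null_comparison[OF _ lim0]) (use le in \<open>auto simp: eventually_at_filter\<close>)
  then show "(y \<longlongrightarrow> y s) (at s within {0..1})" by (simp add: LIM_zero_iff)
qed

definition stability :: "real \<Rightarrow> real" where
  "stability B = sqrt 2 * exp ((c * B)\<^sup>2) * (1 + c * B)"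

text \<open>Between two scales the integrand changes by at most \<open>c N (v s) sqrt \<bar>l - m\<bar>\<close>, which acts like
  a perturbation of the starting point in Gronwall's inequality. The constant depends on the
  control only through a bound of its norm, which makes families of flows equicontinuous.\<close>

lemma integral_curve_stability:
  assumes v: "v \<in> control.L2" and B: "L2_norm N unit_time v \<le> B"
    and l: "l \<in> {s1..s2}" and y: "integral_curve v l x y"
    and m: "m \<in> {s1..s2}" and z: "integral_curve v m x' z" and t: "t \<in> {0..1}"
  shows "norm (y t - z t) \<le> stability B * (norm (x - x') + sqrt \<bar>l - m\<bar>)"
proof -
  have B0: "0 \<le> B" using L2.N_nonneg[OF v] B by linarith
  note k = coefficient[OF v B]
  note yc = integral_curve_continuous[OF v l y] and zc = integral_curve_continuous[OF v m z]
  let ?q = "sqrt \<bar>l - m\<bar>"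
  define a where "a = norm (x - x') + c * B * ?q"
  have a0: "0 \<le> a" using c_nonneg B0 by (simp add: a_def)
  have ku: "integrable unit_time (\<lambda>s. (c * N (v s)) * norm (y s - z s))"
  proof (rule Cauchy_Schwarz_integral(1)[OF k(1) _ k(2)])
    show "(\<lambda>s. norm (y s - z s)) \<in> borel_measurable unit_time"
      using yc zc by (intro continuous_imp_measurable_on_sets_lebesgue continuous_intros) auto
    show "integrable unit_time (\<lambda>s. (norm (y s - z s))\<^sup>2)"
      using continuous_imp_integrable[of 0 1 "\<lambda>s. (norm (y s - z s))\<^sup>2"] yc zc
      by (simp add: continuous_intros)
  qed
  have le: "norm (y r - z r)
      \<le> a + (LINT s|unit_time. indicator {0..r} s * ((c * N (v s)) * norm (y s - z s)))"
    if r: "r \<in> {0..1}" for r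
  proof -
    let ?A = "{0..r} :: real set"
    have A: "?A \<in> sets unit_time" using r by simp
    have i: "integrable unit_time (\<lambda>s. indicator ?A s *\<^sub>R v s l (y s))"
      "integrable unit_time (\<lambda>s. indicator ?A s *\<^sub>R v s m (z s))"
      using y z r unfolding integral_curve_def by auto
    have ik: "integrable unit_time (\<lambda>s. indicator ?A s * (c * N (v s)))"
      "integrable unit_time (\<lambda>s. indicator ?A s * ((c * N (v s)) * norm (y s - z s)))"
      using integrable_mult_indicator[OF A k(4)] integrable_mult_indicator[OF A ku] by simp_all
    have "y r - z r = (x - x') + (LINT s|unit_time. indicator ?A s *\<^sub>R v s l (y s) - indicator ?A s *\<^sub>R v s m (z s))"
      using y z r i unfolding integral_curve_def by auto
    then have split: "norm (y r - z r) \<le> norm (x - x') +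
        norm (LINT s|unit_time. indicator ?A s *\<^sub>R v s l (y s) - indicator ?A s *\<^sub>R v s m (z s))"
      by (simp add: norm_triangle_ineq)
    have "norm (LINT s|unit_time. indicator ?A s *\<^sub>R v s l (y s) - indicator ?A s *\<^sub>R v s m (z s))
        \<le> (LINT s|unit_time. indicator ?A s * ((c * N (v s)) * norm (y s - z s)) +
            ?q * (indicator ?A s * (c * N (v s))))"
    proof (rule Bochner_Integration.integral_norm_bound_integral)
      fix s assume s: "s \<in> space unit_time"
      have "norm (v s l (y s) - v s m (z s)) \<le> c * N (v s) * (norm (y s - z s) + ?q)"
        by (rule increment_le[OF control.L2_in[OF v s] l m])
      then show "norm (indicator ?A s *\<^sub>R v s l (y s) - indicator ?A s *\<^sub>R v s m (z s))
          \<le> indicator ?A s * ((c * N (v s)) * norm (y s - z s)) + ?q * (indicator ?A s * (c * N (v s)))"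
        by (auto simp: indicator_def algebra_simps)
    qed (use i ik in auto)
    also have "\<dots> = (LINT s|unit_time. indicator ?A s * ((c * N (v s)) * norm (y s - z s))) +
        ?q * (LINT s|unit_time. indicator ?A s * (c * N (v s)))"
      using ik by simp
    finally have diff: "norm (LINT s|unit_time. indicator ?A s *\<^sub>R v s l (y s) - indicator ?A s *\<^sub>R v s m (z s))
        \<le> (LINT s|unit_time. indicator ?A s * ((c * N (v s)) * norm (y s - z s))) +
          ?q * (LINT s|unit_time. indicator ?A s * (c * N (v s)))" .
    have "(LINT s|unit_time. indicator ?A s * (c * N (v s))) \<le> c * B"
    proof -
      have "measure unit_time ?A \<le> 1"
        using r by (subst measure_restrict_space) auto
      then have "c * B * sqrt (measure unit_time ?A) \<le> c * B * 1"
        using c_nonneg B0 by (intro mult_left_mono) auto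
      then show ?thesis using coefficient_integral[OF v B A] by simp
    qed
    then have "?q * (LINT s|unit_time. indicator ?A s * (c * N (v s))) \<le> ?q * (c * B)"
      by (intro mult_left_mono) auto
    then show ?thesis using split diff by (simp add: a_def mult.commute)
  qed
  have "norm (y t - z t) \<le> sqrt 2 * exp ((c * B)\<^sup>2) * a"
    by (rule Gronwall_L2[where k = "\<lambda>s. c * N (v s)", OF _ k(1-3) a0 _ le t])
       (use yc zc in \<open>auto intro!: continuous_intros\<close>)
  also have "a \<le> (1 + c * B) * (norm (x - x') + ?q)"
    using c_nonneg B0 by (simp add: a_def algebra_simps)
  finally show ?thesis by (simp add: stability_def mult_left_mono mult.assoc)
qed

lemma integral_curve_unique:
  assumes "v \<in> control.L2" "l \<in> {s1..s2}" "integral_curve v l x y" "integral_curve v l x z" "t \<in> {0..1}"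
  shows "y t = z t"
  using integral_curve_stability[OF assms(1) order_refl assms(2,3,2,4,5)] by simp

lemma flow_scale_continuous:
  assumes v: "v \<in> control.L2" and \<phi>: "flow_equation s1 s2 v \<phi>" and t: "t \<in> {0..1}"
  shows "scale_continuous s1 s2 (\<phi> t)"
  unfolding scale_continuous_def continuous_on_def
proof (clarify)
  fix l and x :: "real^'n" assume l: "l \<in> {s1..s2}"
  let ?K = "stability (L2_norm N unit_time v)" and ?F = "at (l, x) within {s1..s2} \<times> UNIV"
  let ?b = "\<lambda>p. ?K * (norm (snd p - x) + sqrt \<bar>fst p - l\<bar>)"
  have "(?b \<longlongrightarrow> ?K * (norm (snd (l, x) - x) + sqrt \<bar>fst (l, x) - l\<bar>)) ?F"
    by (intro tendsto_intros)
  then have lim0: "(?b \<longlongrightarrow> 0) ?F" by simp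
  have "((\<lambda>p. (case p of (l, x) \<Rightarrow> \<phi> t l x) - \<phi> t l x) \<longlongrightarrow> 0) ?F"
  proof (rule Lim_null_comparison[OF _ lim0])
    have "norm (\<phi> t m x' - \<phi> t l x) \<le> ?b (m, x')" if "m \<in> {s1..s2}" for m x'
      using integral_curve_stability[OF v order_refl, of m x' "\<lambda>t. \<phi> t m x'" l x "\<lambda>t. \<phi> t l x"]
        \<phi> l that t unfolding flow_equation_integral_curves by simp
    then show "\<forall>\<^sub>F p in ?F. norm ((case p of (l, x) \<Rightarrow> \<phi> t l x) - \<phi> t l x) \<le> ?b p"
      unfolding eventually_at_filter by (intro always_eventually) auto
  qed
  then show "((\<lambda>(l, x). \<phi> t l x) \<longlongrightarrow> \<phi> t l x) ?F" by (simp add: LIM_zero_iff)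
qed

text \<open>Ascoli's theorem in time at a fixed scale and starting point. In the limit equation the
  error of replacing the curves by their uniform limit is controlled by the Lipschitz bounds,
  and then the curve is fixed and the integral is a bounded functional of the control.\<close>

lemma integral_curve_weak_limit:
  assumes weak: "weakly_converges_on control.L2 (L2_norm N unit_time) v w"
    and B: "\<And>n. L2_norm N unit_time (v n) \<le> B" and l: "l \<in> {s1..s2}"
    and y: "\<And>n. integral_curve (v n) l x (y n)"
  shows "\<exists>z k. strict_mono k \<and> integral_curve w l x z \<and> (\<lambda>n. y (k n) 1) \<longlonglongrightarrow> z 1"
proof -
  have v: "\<And>n. v n \<in> control.L2" and w: "w \<in> control.L2"
    using weak by (auto simp: weakly_converges_on_def)
  have B0: "0 \<le> B" using L2.N_nonneg[OF v] B order_trans by blast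
  have cB: "0 \<le> c * B" using c_nonneg B0 by simp
  have y0: "y n 0 = x" for n
  proof -
    have "AE s in unit_time. indicator {0..0} s *\<^sub>R v n s l (y n s) = 0"
    proof -
      have "{0::real} \<in> null_sets unit_time"
        by (simp add: null_sets_restrict_space)
      then have "AE s in unit_time. s \<notin> {0}" by (rule AE_not_in)
      then show ?thesis by eventually_elim (simp add: indicator_def)
    qed
    then have "(LINT s|unit_time. indicator {0..0} s *\<^sub>R v n s l (y n s)) = 0"
      by (rule integral_eq_zero_AE)
    then show ?thesis using y[of n] unfolding integral_curve_def by force
  qed
  have hoelder: "norm (y n t - y n s) \<le> c * B * sqrt \<bar>t - s\<bar>" if "s \<in> {0..1}" "t \<in> {0..1}" for n s t
    using integral_curve_increment[OF v B l y, of s t] integral_curve_increment[OF v B l y, of t s] that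
    by (cases "s \<le> t") (auto simp: norm_minus_commute)
  have "\<exists>z (k :: nat \<Rightarrow> nat). continuous_on {0..1} z \<and> strict_mono k \<and>
    (\<forall>e>0. \<exists>n0. \<forall>n t. n \<ge> n0 \<and> t \<in> {0..1} \<longrightarrow> norm (y (k n) t - z t) < e)"
  proof (rule Arzela_Ascoli[of "{0..1::real}" y "norm x + c * B"])
    show "compact {0..1::real}" by simp
  next
    fix n and t :: real assume t: "t \<in> {0..1}"
    have "c * B * sqrt \<bar>t - 0\<bar> \<le> c * B * 1" using cB t by (intro mult_left_mono) auto
    then show "norm (y n t) \<le> norm x + c * B"
      using hoelder[of 0 t n] t norm_triangle_sub[of "y n t" x] by (simp add: y0)
  next
    fix t e :: real assume t: "t \<in> {0..1}" and e: "0 < e"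
    define d where "d = (e / (c * B + 1))\<^sup>2"
    have d: "0 < d" using e cB by (simp add: d_def)
    have "norm (y n t - y n s) < e" if s: "s \<in> {0..1}" "norm (t - s) < d" for n s
    proof -
      have "sqrt \<bar>t - s\<bar> < sqrt d" using s by simp
      also have "sqrt d = e / (c * B + 1)" using e cB by (simp add: d_def)
      finally have "(c * B + 1) * sqrt \<bar>t - s\<bar> < e" using cB by (simp add: field_simps)
      then show ?thesis using hoelder[OF s(1) t, of n] by (simp add: distrib_right)
         (meson le_less_trans add_increasing2 real_sqrt_ge_zero abs_ge_zero order_trans order_refl)
    qed
    then show "\<exists>d>0. \<forall>n s. s \<in> {0..1} \<and> norm (t - s) < d \<longrightarrow> norm (y n t - y n s) < e"
      using d by blast
  next
    fix z and k :: "nat \<Rightarrow> nat" assume "continuous_on {0..1} z" "strict_mono k"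
      "\<And>e. 0 < e \<Longrightarrow> \<exists>n0. \<forall>n t. n \<ge> n0 \<and> t \<in> {0..1} \<longrightarrow> norm (y (k n) t - z t) < e"
    then show ?thesis by blast
  qed
  then obtain z and k :: "nat \<Rightarrow> nat" where z: "continuous_on {0..1} z" and k: "strict_mono k"
    and unif: "\<And>e. 0 < e \<Longrightarrow> \<exists>n0. \<forall>n t. n \<ge> n0 \<and> t \<in> {0..1} \<longrightarrow> norm (y (k n) t - z t) < e"
    by blast
  have point: "(\<lambda>n. y (k n) t) \<longlonglongrightarrow> z t" if "t \<in> {0..1}" for t
    unfolding LIMSEQ_iff using unif that by blast
  have "integral_curve w l x z"
    unfolding integral_curve_def
  proof (intro ballI conjI)
    fix t :: real assume t: "t \<in> {0..1}"
    let ?A = "{0..t} :: real set"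
    have A: "?A \<in> sets unit_time" using t by simp
    show "integrable unit_time (\<lambda>s. indicator ?A s *\<^sub>R w s l (z s))"
      using curve_integrable[OF w l z] A by (rule integrable_mult_indicator[rotated])
    let ?J = "\<lambda>u. LINT s|unit_time. indicator ?A s *\<^sub>R u s l (z s)"
    have "(\<lambda>n. ?J (v n) $ i) \<longlonglongrightarrow> ?J w $ i" for i
      using weak curve_functional[OF l z t] unfolding weakly_converges_on_def by blast
    then have "(\<lambda>n. ?J (v n)) \<longlonglongrightarrow> ?J w" by (rule vec_tendstoI)
    then have J: "(\<lambda>n. ?J (v (k n))) \<longlonglongrightarrow> ?J w"
      using k by (rule LIMSEQ_subseq_LIMSEQ[unfolded o_def])
    have "(\<lambda>n. (y (k n) t - x) - ?J (v (k n))) \<longlonglongrightarrow> 0"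
    proof (rule LIMSEQ_I)
      fix e :: real assume e: "0 < e"
      define d where "d = e / (c * B + 1)"
      have d: "0 < d" using e cB by (simp add: d_def)
      obtain n0 where n0: "\<And>n s. n0 \<le> n \<Longrightarrow> s \<in> {0..1} \<Longrightarrow> norm (y (k n) s - z s) < d"
        using unif[OF d] by blast
      have "norm ((y (k n) t - x) - ?J (v (k n))) < e" if n: "n0 \<le> n" for n
      proof -
        let ?u = "v (k n)" and ?y = "y (k n)"
        have i1: "integrable unit_time (\<lambda>s. indicator ?A s *\<^sub>R ?u s l (?y s))"
          and yt: "?y t - x = (LINT s|unit_time. indicator ?A s *\<^sub>R ?u s l (?y s))"
          using y[of "k n"] t unfolding integral_curve_def by auto
        have i2: "integrable unit_time (\<lambda>s. indicator ?A s *\<^sub>R ?u s l (z s))"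
          using curve_integrable[OF v l z] A by (rule integrable_mult_indicator[rotated])
        have eq: "(?y t - x) - ?J ?u =
            (LINT s|unit_time. indicator ?A s *\<^sub>R ?u s l (?y s) - indicator ?A s *\<^sub>R ?u s l (z s))"
          using i1 i2 by (simp add: yt)
        have "norm ((?y t - x) - ?J ?u) \<le> (LINT s|unit_time. d * (indicator {0..1} s * (c * N (?u s))))"
          unfolding eq
        proof (rule Bochner_Integration.integral_norm_bound_integral)
          show "integrable unit_time (\<lambda>s. d * (indicator {0..1} s * (c * N (?u s))))"
            using integrable_mult_indicator[OF _ coefficient(4)[OF v order_refl], of "{0..1}" "k n"] by simp
          fix s assume s: "s \<in> space unit_time"
          have "norm (?u s l (?y s) - ?u s l (z s)) \<le> c * N (?u s) * norm (?y s - z s)"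
            using increment_le[OF control.L2_in[OF v s] l l, of "k n" "?y s" "z s"] by simp
          also have "\<dots> \<le> c * N (?u s) * d"
            using n0[OF n, of s] s c_nonneg N_nonneg[OF control.L2_in[OF v s]]
            by (intro mult_left_mono) auto
          finally have "norm (?u s l (?y s) - ?u s l (z s)) \<le> d * (c * N (?u s))"
            by (simp add: mult.commute)
          moreover have "0 \<le> d * (c * N (?u s))"
            using d c_nonneg N_nonneg[OF control.L2_in[OF v s]] by simp
          ultimately show "norm (indicator ?A s *\<^sub>R ?u s l (?y s) - indicator ?A s *\<^sub>R ?u s l (z s))
              \<le> d * (indicator {0..1} s * (c * N (?u s)))"
            using s t by (auto simp: indicator_def)
        qed (use i1 i2 in simp)
        then have "norm ((?y t - x) - ?J ?u) \<le> d * (LINT s|unit_time. indicator {0..1} s * (c * N (?u s)))"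
          by simp
        moreover have "d * (LINT s|unit_time. indicator {0..1} s * (c * N (?u s))) \<le> d * (c * B)"
        proof -
          have "measure unit_time {0..1} = 1" by (subst measure_restrict_space) auto
          then show ?thesis
            using d coefficient_integral[OF v B, of "{0..1}" "k n"] by (intro mult_left_mono) auto
        qed
        moreover have "d * (c * B) < e" using e cB d by (simp add: d_def field_simps)
        ultimately show ?thesis by linarith
      qed
      then show "\<exists>n0. \<forall>n\<ge>n0. norm ((y (k n) t - x) - ?J (v (k n)) - 0) < e" by auto
    qed
    from tendsto_add[OF this J] have "(\<lambda>n. y (k n) t - x) \<longlonglongrightarrow> ?J w" by simp
    moreover have "(\<lambda>n. y (k n) t - x) \<longlonglongrightarrow> z t - x"
      by (intro tendsto_diff point[OF t] tendsto_const)
    ultimately have "z t - x = ?J w" using LIMSEQ_unique by blast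
    then show "z t = x + ?J w" by (simp add: algebra_simps)
  qed
  then show ?thesis using k point[of 1] by auto
qed

end


section \<open>Stability of flows under weak convergence of controls\<close>

lemma weakly_converges_on_subseq:
  "weakly_converges_on S N u w \<Longrightarrow> strict_mono r \<Longrightarrow> weakly_converges_on S N (u \<circ> r) w"
  unfolding weakly_converges_on_def
  using LIMSEQ_subseq_LIMSEQ by (fastforce simp: o_def)

context scale_fields
begin

lemma flow_exists_weak_limit:
  assumes weak: "weakly_converges_on control.L2 (L2_norm N unit_time) v w"
    and B: "\<And>n. L2_norm N unit_time (v n) \<le> B"
    and \<phi>: "\<And>n. flow_equation s1 s2 (v n) (\<phi> n)"
  shows "\<exists>\<psi>. flow_equation s1 s2 w \<psi>"
proof -
  have ex: "\<exists>z. integral_curve w l x z" if "l \<in> {s1..s2}" for l x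
    using integral_curve_weak_limit[OF weak B that, of x "\<lambda>n t. \<phi> n t l x"] \<phi> that
    unfolding flow_equation_integral_curves by blast
  have some: "integral_curve w l x (SOME z. integral_curve w l x z)" if "l \<in> {s1..s2}" for l x
    using ex[OF that] by (rule someI_ex)
  have "flow_equation s1 s2 w (\<lambda>t l x. (SOME z. integral_curve w l x z) t)"
    unfolding flow_equation_integral_curves by (intro ballI allI some)
  then show ?thesis by blast
qed

text \<open>Any subsequence has a further one converging to an integral curve of \<open>w\<close>, and there is only
  one such curve.\<close>

lemma flow_pointwise_convergence:
  assumes weak: "weakly_converges_on control.L2 (L2_norm N unit_time) v w"
    and B: "\<And>n. L2_norm N unit_time (v n) \<le> B"
    and \<phi>: "\<And>n. flow_equation s1 s2 (v n) (\<phi> n)" and \<psi>: "flow_equation s1 s2 w \<psi>"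
    and l: "l \<in> {s1..s2}"
  shows "(\<lambda>n. \<phi> n 1 l x) \<longlonglongrightarrow> \<psi> 1 l x"
proof (rule ccontr)
  assume "\<not> ?thesis"
  then obtain e where e: "0 < e" and
    "\<not> (\<forall>\<^sub>F n in sequentially. dist (\<phi> n 1 l x) (\<psi> 1 l x) < e)"
    unfolding tendsto_iff by blast
  then obtain r :: "nat \<Rightarrow> nat" where r: "strict_mono r"
    and far: "\<And>n. \<not> dist (\<phi> (r n) 1 l x) (\<psi> 1 l x) < e"
    using not_eventually_sequentiallyD by blast
  have w: "w \<in> control.L2" using weak by (simp add: weakly_converges_on_def)
  obtain z k where z: "integral_curve w l x z" and lim: "(\<lambda>n. \<phi> (r (k n)) 1 l x) \<longlonglongrightarrow> z 1"
    using integral_curve_weak_limit[OF weakly_converges_on_subseq[OF weak r] _ l,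
        of B x "\<lambda>n t. \<phi> (r n) t l x"] B \<phi> l
    unfolding flow_equation_integral_curves by (auto simp: o_def)
  have "z 1 = \<psi> 1 l x"
    using integral_curve_unique[OF w l z, of "\<lambda>t. \<psi> t l x" 1] \<psi> l
    unfolding flow_equation_integral_curves by auto
  then have "\<forall>\<^sub>F n in sequentially. dist (\<phi> (r (k n)) 1 l x) (\<psi> 1 l x) < e"
    using lim e unfolding tendsto_iff by auto
  then show False using far eventually_happens'[OF sequentially_bot] by blast
qed

text \<open>The flows share one modulus of continuity in scale and starting point, so that pointwise
  convergence is uniform on compact sets.\<close>

lemma flow_uniform_convergence:
  assumes weak: "weakly_converges_on control.L2 (L2_norm N unit_time) v w"
    and B: "\<And>n. L2_norm N unit_time (v n) \<le> B"
    and \<phi>: "\<And>n. flow_equation s1 s2 (v n) (\<phi> n)" and \<psi>: "flow_equation s1 s2 w \<psi>"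
    and K: "compact K" "K \<subseteq> {s1..s2} \<times> UNIV" and \<delta>: "0 < \<delta>"
  shows "\<forall>\<^sub>F n in sequentially. \<forall>(l, x)\<in>K. dist (\<phi> n 1 l x) (\<psi> 1 l x) < \<delta>"
proof (rule ccontr)
  assume "\<not> ?thesis"
  then obtain r :: "nat \<Rightarrow> nat" where r: "strict_mono r"
    and "\<And>n. \<not> (\<forall>(l, x)\<in>K. dist (\<phi> (r n) 1 l x) (\<psi> 1 l x) < \<delta>)"
    using not_eventually_sequentiallyD by blast
  then have "\<exists>p. p \<in> K \<and> \<delta> \<le> dist (\<phi> (r n) 1 (fst p) (snd p)) (\<psi> 1 (fst p) (snd p))" for n
    by (force simp: not_less)
  then obtain p where p: "\<And>n. p n \<in> K"
    and far: "\<And>n. \<delta> \<le> dist (\<phi> (r n) 1 (fst (p n)) (snd (p n))) (\<psi> 1 (fst (p n)) (snd (p n)))"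
    by metis
  obtain a k where a: "a \<in> K" and k: "strict_mono k" and lim: "(p \<circ> k) \<longlonglongrightarrow> a"
    using K(1) p unfolding compact_def by blast
  have v: "\<And>n. v n \<in> control.L2" and w: "w \<in> control.L2"
    using weak by (auto simp: weakly_converges_on_def)
  let ?l = "fst a" and ?x = "snd a" and ?L = "\<lambda>n. fst (p (k n))" and ?X = "\<lambda>n. snd (p (k n))"
  have "fst q \<in> {s1..s2}" if "q \<in> K" for q using that K(2) by auto
  then have l: "?l \<in> {s1..s2}" "\<And>n. ?L n \<in> {s1..s2}" using a p by blast+
  let ?C = "L2_norm N unit_time w"
  let ?d = "\<lambda>n. norm (?X n - ?x) + sqrt \<bar>?L n - ?l\<bar>"
  have lim': "?L \<longlonglongrightarrow> ?l" "?X \<longlonglongrightarrow> ?x"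
    using tendsto_fst[OF lim] tendsto_snd[OF lim] by (simp_all add: o_def)
  then have "?d \<longlonglongrightarrow> norm (?x - ?x) + sqrt \<bar>?l - ?l\<bar>"
    by (intro tendsto_add tendsto_norm tendsto_diff tendsto_real_sqrt tendsto_rabs tendsto_const)
  then have d0: "?d \<longlonglongrightarrow> 0" by simp
  have "(\<lambda>n. \<phi> (r (k n)) 1 ?l ?x) \<longlonglongrightarrow> \<psi> 1 ?l ?x"
    using LIMSEQ_subseq_LIMSEQ[OF flow_pointwise_convergence[OF weak B \<phi> \<psi> l(1)] strict_mono_o[OF r k]]
    by (simp add: o_def)
  then have p0: "(\<lambda>n. dist (\<phi> (r (k n)) 1 ?l ?x) (\<psi> 1 ?l ?x)) \<longlonglongrightarrow> 0"
    by (rule tendsto_dist_iff[THEN iffD1])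
  have "(\<lambda>n. stability B * ?d n + dist (\<phi> (r (k n)) 1 ?l ?x) (\<psi> 1 ?l ?x) + stability ?C * ?d n)
      \<longlonglongrightarrow> stability B * 0 + 0 + stability ?C * 0"
    by (intro tendsto_intros d0 p0)
  then have "\<forall>\<^sub>F n in sequentially.
      stability B * ?d n + dist (\<phi> (r (k n)) 1 ?l ?x) (\<psi> 1 ?l ?x) + stability ?C * ?d n < \<delta>"
    by (rule order_tendstoD(2)) (use \<delta> in simp)
  then obtain n where n:
    "stability B * ?d n + dist (\<phi> (r (k n)) 1 ?l ?x) (\<psi> 1 ?l ?x) + stability ?C * ?d n < \<delta>"
    using eventually_happens'[OF sequentially_bot] by blast
  have curve: "integral_curve (v n) m y (\<lambda>t. \<phi> n t m y)" "integral_curve w m y (\<lambda>t. \<psi> t m y)"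
    if "m \<in> {s1..s2}" for n m y
    using \<phi> \<psi> that unfolding flow_equation_integral_curves by blast+
  have "dist (\<phi> (r (k n)) 1 (?L n) (?X n)) (\<phi> (r (k n)) 1 ?l ?x) \<le> stability B * ?d n"
    using integral_curve_stability[OF v B l(2) curve(1)[OF l(2)] l(1) curve(1)[OF l(1)], of 1]
    by (simp add: dist_norm)
  moreover have "dist (\<psi> 1 (?L n) (?X n)) (\<psi> 1 ?l ?x) \<le> stability ?C * ?d n"
    using integral_curve_stability[OF w order_refl l(2) curve(2)[OF l(2)] l(1) curve(2)[OF l(1)], of 1]
    by (simp add: dist_norm)
  moreover have "dist (\<phi> (r (k n)) 1 (?L n) (?X n)) (\<psi> 1 (?L n) (?X n))
      \<le> dist (\<phi> (r (k n)) 1 (?L n) (?X n)) (\<phi> (r (k n)) 1 ?l ?x)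
        + dist (\<phi> (r (k n)) 1 ?l ?x) (\<psi> 1 ?l ?x) + dist (\<psi> 1 (?L n) (?X n)) (\<psi> 1 ?l ?x)"
    using dist_triangle[of "\<phi> (r (k n)) 1 (?L n) (?X n)" "\<psi> 1 (?L n) (?X n)" "\<phi> (r (k n)) 1 ?l ?x"]
      dist_triangle[of "\<phi> (r (k n)) 1 ?l ?x" "\<psi> 1 (?L n) (?X n)" "\<psi> 1 ?l ?x"]
      dist_commute[of "\<psi> 1 ?l ?x" "\<psi> 1 (?L n) (?X n)"] by linarith
  ultimately show False using n far[of "k n"] by linarith
qed


section \<open>The direct method\<close>

text \<open>The control problem over an arbitrary space of scale-dependent fields.\<close>

definition pairs :: "((real \<Rightarrow> real \<Rightarrow> real^'n \<Rightarrow> real^'n) \<times> (real \<Rightarrow> real \<Rightarrow> real^'n \<Rightarrow> real^'n)) set" where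
  "pairs = {(v, \<phi>). v \<in> control.L2 \<and> flow_equation s1 s2 v \<phi>}"

definition cost :: "((real \<Rightarrow> real^'n \<Rightarrow> real^'n) \<Rightarrow> real) \<Rightarrow>
    (real \<Rightarrow> real \<Rightarrow> real^'n \<Rightarrow> real^'n) \<times> (real \<Rightarrow> real \<Rightarrow> real^'n \<Rightarrow> real^'n) \<Rightarrow> real" where
  "cost G = (\<lambda>(v, \<phi>). 1/2 * (LINT t|unit_time. (N (v t))\<^sup>2) + G (\<phi> 1))"

lemma cost_eq: "v \<in> control.L2 \<Longrightarrow> cost G (v, \<phi>) = (L2_norm N unit_time v)\<^sup>2 / 2 + G (\<phi> 1)"
  by (simp add: cost_def control.L2_norm_power2)

lemma identity_pair: "(0, \<lambda>t l x. x) \<in> pairs"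
  using control.L2_zero
  by (simp add: pairs_def flow_equation_integral_curves integral_curve_def)

lemma end_map_continuous: "(v, \<phi>) \<in> pairs \<Longrightarrow> scale_continuous s1 s2 (\<phi> 1)"
  by (auto simp: pairs_def intro: flow_scale_continuous)

context
  fixes G :: "(real \<Rightarrow> real^'n \<Rightarrow> real^'n) \<Rightarrow> real" and b :: real
  assumes G_lower: "\<And>f. scale_continuous s1 s2 f \<Longrightarrow> b \<le> G f"
begin

lemma cost_lower: "(v, \<phi>) \<in> pairs \<Longrightarrow> (L2_norm N unit_time v)\<^sup>2 / 2 + b \<le> cost G (v, \<phi>)"
  using G_lower[OF end_map_continuous] by (auto simp: cost_eq pairs_def)

lemma infimum_finite: "\<exists>m. (INF a\<in>pairs. ereal (cost G a)) = ereal m"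
proof -
  have "ereal b \<le> (INF a\<in>pairs. ereal (cost G a))"
  proof (rule INF_greatest)
    fix a assume "a \<in> pairs"
    then have "(L2_norm N unit_time (fst a))\<^sup>2 / 2 + b \<le> cost G a"
      using cost_lower[of "fst a" "snd a"] by simp
    moreover have "0 \<le> (L2_norm N unit_time (fst a))\<^sup>2 / 2" by simp
    ultimately have "b \<le> cost G a" by linarith
    then show "ereal b \<le> ereal (cost G a)" by simp
  qed
  moreover have "(INF a\<in>pairs. ereal (cost G a)) \<le> ereal (cost G (0, \<lambda>t l x. x))"
    by (rule INF_lower[OF identity_pair])
  ultimately show ?thesis
    by (cases "INF a\<in>pairs. ereal (cost G a)") auto
qed

lemma minimizing_sequence_bounded:
  assumes "minimizing_sequence pairs (cost G) (\<lambda>n. (v n, \<phi> n))"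
  shows "\<exists>B. \<forall>n. L2_norm N unit_time (v n) \<le> B"
proof -
  obtain m where m: "(INF a\<in>pairs. ereal (cost G a)) = ereal m" using infimum_finite by blast
  have pair: "\<And>n. (v n, \<phi> n) \<in> pairs" and "(\<lambda>n. cost G (v n, \<phi> n)) \<longlonglongrightarrow> m"
    using assms unfolding minimizing_sequence_def by (auto simp: m)
  then have "Bseq (\<lambda>n. cost G (v n, \<phi> n))" by (intro convergent_imp_Bseq convergentI)
  then obtain C where C: "\<And>n. \<bar>cost G (v n, \<phi> n)\<bar> \<le> C" by (auto simp: Bseq_def)
  have "L2_norm N unit_time (v n) \<le> sqrt (2 * (C - b))" for n
  proof (rule real_le_rsqrt)
    have "(L2_norm N unit_time (v n))\<^sup>2 / 2 + b \<le> C"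
      using cost_lower[OF pair, of n] abs_le_D1[OF C, of n] by (rule order_trans)
    then show "(L2_norm N unit_time (v n))\<^sup>2 \<le> 2 * (C - b)" by (simp add: field_simps)
  qed
  then show ?thesis by blast
qed

lemma minimizing_sequence_weakly_convergent:
  assumes seq: "minimizing_sequence pairs (cost G) (\<lambda>n. (v n, \<phi> n))"
  shows "\<exists>r w. strict_mono r \<and> weakly_converges_on control.L2 (L2_norm N unit_time) (v \<circ> r) w"
proof -
  have "\<And>n. v n \<in> control.L2"
    using seq unfolding minimizing_sequence_def pairs_def by auto
  then show ?thesis
    using minimizing_sequence_bounded[OF seq] L2.bounded_imp_weakly_convergent_subseq by blast
qed

lemma minimizing_sequence_exists: "\<exists>v \<phi>. minimizing_sequence pairs (cost G) (\<lambda>n. (v n, \<phi> n))"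
proof -
  obtain m where m: "(INF a\<in>pairs. ereal (cost G a)) = ereal m" using infimum_finite by blast
  have lower: "m \<le> cost G a" if "a \<in> pairs" for a
    using INF_lower[OF that, of "\<lambda>a. ereal (cost G a)"] by (simp add: m)
  have "\<exists>a\<in>pairs. cost G a < m + 1 / real (Suc n)" for n
  proof -
    have "(INF a\<in>pairs. ereal (cost G a)) < ereal (m + 1 / real (Suc n))" by (simp add: m)
    then show ?thesis by (simp add: INF_less_iff)
  qed
  then obtain a where a: "\<And>n. a n \<in> pairs" "\<And>n. cost G (a n) < m + 1 / real (Suc n)" by metis
  have "(\<lambda>n. cost G (a n)) \<longlonglongrightarrow> m"
  proof (rule tendsto_sandwich[of "\<lambda>_. m" _ _ "\<lambda>n. m + 1 / real (Suc n)"])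
    show "(\<lambda>n. m + 1 / real (Suc n)) \<longlonglongrightarrow> m"
      using tendsto_add[OF tendsto_const LIMSEQ_Suc[OF lim_1_over_n], of m] by simp
    show "\<forall>\<^sub>F n in sequentially. cost G (a n) \<le> m + 1 / real (Suc n)"
      using a(2) by (intro always_eventually allI less_imp_le)
  qed (use lower a(1) in auto)
  then have "minimizing_sequence pairs (cost G) (\<lambda>n. (fst (a n), snd (a n)))"
    using a(1) by (simp add: minimizing_sequence_def m)
  then show ?thesis by (intro exI[of _ "\<lambda>n. fst (a n)"] exI[of _ "\<lambda>n. snd (a n)"])
qed

text \<open>Near the weak limit the end-cost can drop by at most \<open>e / 2\<close>, so the norms of the controls
  are eventually bounded by what the infimum leaves for them; this bound passes to the weak
  limit.\<close>

theorem minimizer_exists: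
  assumes lsc: "lsc_compact_uniform s1 s2 G"
  shows "\<exists>p\<in>pairs. \<forall>a\<in>pairs. cost G p \<le> cost G a"
proof -
  obtain m where m: "(INF a\<in>pairs. ereal (cost G a)) = ereal m" using infimum_finite by blast
  have lower: "m \<le> cost G a" if "a \<in> pairs" for a
    using INF_lower[OF that, of "\<lambda>a. ereal (cost G a)"] by (simp add: m)
  obtain v0 \<phi>0 where seq: "minimizing_sequence pairs (cost G) (\<lambda>n. (v0 n, \<phi>0 n))"
    using minimizing_sequence_exists by blast
  obtain B where B0: "\<And>n. L2_norm N unit_time (v0 n) \<le> B"
    using minimizing_sequence_bounded[OF seq] by blast
  obtain r w where r: "strict_mono r"
    and weak: "weakly_converges_on control.L2 (L2_norm N unit_time) (v0 \<circ> r) w"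
    using minimizing_sequence_weakly_convergent[OF seq] by blast
  define v \<phi> where "v n = v0 (r n)" and "\<phi> n = \<phi>0 (r n)" for n
  have weak: "weakly_converges_on control.L2 (L2_norm N unit_time) v w"
    using weak by (simp add: v_def[abs_def] o_def)
  have pair: "\<And>n. (v n, \<phi> n) \<in> pairs"
    using seq by (simp add: minimizing_sequence_def v_def \<phi>_def)
  have "(\<lambda>n. cost G (v0 n, \<phi>0 n)) \<longlonglongrightarrow> m"
    using seq by (simp add: minimizing_sequence_def m)
  then have lim: "(\<lambda>n. cost G (v n, \<phi> n)) \<longlonglongrightarrow> m"
    using LIMSEQ_subseq_LIMSEQ[OF _ r] by (force simp: v_def \<phi>_def o_def)
  have B: "\<And>n. L2_norm N unit_time (v n) \<le> B" using B0 by (simp add: v_def)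
  have v: "\<And>n. v n \<in> control.L2" and flow: "\<And>n. flow_equation s1 s2 (v n) (\<phi> n)"
    using pair by (auto simp: pairs_def)
  have w: "w \<in> control.L2" using weak by (simp add: weakly_converges_on_def)
  obtain \<psi> where \<psi>: "flow_equation s1 s2 w \<psi>"
    using flow_exists_weak_limit[OF weak B flow] by blast
  have pw: "(w, \<psi>) \<in> pairs" using w \<psi> by (simp add: pairs_def)
  have "cost G (w, \<psi>) \<le> m + e" if e: "0 < e" for e
  proof -
    obtain K \<delta> where K: "compact K" "K \<subseteq> {s1..s2} \<times> UNIV" and \<delta>: "0 < \<delta>"
      and near: "\<And>g. scale_continuous s1 s2 g \<Longrightarrow> (\<forall>(l, x)\<in>K. dist (g l x) (\<psi> 1 l x) < \<delta>) \<Longrightarrow>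
        G (\<psi> 1) - e / 2 < G g"
    proof -
      have "\<exists>K \<delta>. compact K \<and> K \<subseteq> {s1..s2} \<times> UNIV \<and> 0 < \<delta> \<and>
          (\<forall>g. scale_continuous s1 s2 g \<longrightarrow> (\<forall>(l, x)\<in>K. dist (g l x) (\<psi> 1 l x) < \<delta>) \<longrightarrow>
            G (\<psi> 1) - e / 2 < G g)"
        using lsc end_map_continuous[OF pw] half_gt_zero[OF e] unfolding lsc_compact_uniform_def by simp
      then show thesis 
        by (elim exE conjE) (rule that, assumption+, drule spec, drule (1) mp, drule (1) mp)
    qed
    have "\<forall>\<^sub>F n in sequentially. cost G (v n, \<phi> n) < m + e / 2"
      by (rule order_tendstoD(2)[OF lim]) (use e in simp)
    then have "\<forall>\<^sub>F n in sequentially. L2_norm N unit_time (v n) \<le> sqrt (2 * (m + e - G (\<psi> 1)))"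
      using flow_uniform_convergence[OF weak B flow \<psi> K \<delta>]
    proof eventually_elim
      case (elim n)
      have "G (\<psi> 1) - e / 2 < G (\<phi> n 1)" by (rule near[OF end_map_continuous[OF pair] elim(2)])
      then have "(L2_norm N unit_time (v n))\<^sup>2 \<le> 2 * (m + e - G (\<psi> 1))"
        using elim(1) cost_eq[OF v, of G n "\<phi> n"] by (simp add: field_simps)
      then show ?case by (rule real_le_rsqrt)
    qed
    then have le: "L2_norm N unit_time w \<le> sqrt (2 * (m + e - G (\<psi> 1)))"
      by (rule L2.norm_weak_limit_le[OF weak])
    then have "0 \<le> 2 * (m + e - G (\<psi> 1))"
      using L2.N_nonneg[OF w] by (meson order_trans real_sqrt_ge_0_iff)
    then have "(L2_norm N unit_time w)\<^sup>2 \<le> 2 * (m + e - G (\<psi> 1))"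
      using power_mono[OF le L2.N_nonneg[OF w], of 2] by simp
    then show ?thesis using cost_eq[OF w, of G \<psi>] by (simp add: field_simps)
  qed
  then have "cost G (w, \<psi>) \<le> m" by (rule field_le_epsilon)
  then show ?thesis using pw lower order_trans by blast
qed

end

end

theorem mainTheorem3:
  fixes s1 s2 :: real and p :: nat
    and W :: "real \<Rightarrow> 'n::finite vfield set" and nrm :: "real \<Rightarrow> 'n vfield \<Rightarrow> real"
    and \<rho> :: "real measure" and G :: "'n scale_map \<Rightarrow> real"
  assumes scales: "0 < s1" "s1 < s2"
    and p: "1 \<le> p"
    and W_rkhs: "\<And>l. l \<in> {0} \<union> {s1..s2} \<Longrightarrow> rkhs (W l) (nrm l)"
    and V_embedded: "continuously_embedded (W 0) (nrm 0) (C0_space p) (C0_norm p)"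
    and W_nested: "\<And>l m. l \<in> {0} \<union> {s1..s2} \<Longrightarrow> m \<in> {0} \<union> {s1..s2} \<Longrightarrow> m < l \<Longrightarrow>
           continuously_embedded (W l) (nrm l) (W m) (nrm m)"
    and W_uniform: "bdd_above {embedding_norm (W l) (nrm l) (nrm m) | l m.
           l \<in> {0} \<union> {s1..s2} \<and> m \<in> {0} \<union> {s1..s2} \<and> m < l}"
    and rho: "sets \<rho> = sets (restrict_space borel {s1..s2})"
    and WW_hilbert: "hilbert_space_on (WW s1 s2 W nrm \<rho>) (WW_norm s1 s2 W nrm \<rho>)"
    and WW_evaluation: "\<And>l x. l \<in> {s1..s2} \<Longrightarrow>
           \<exists>K. \<forall>v\<in>WW s1 s2 W nrm \<rho>. norm (v l x) \<le> K * WW_norm s1 s2 W nrm \<rho> v"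
    and G_lsc: "lsc_compact_uniform s1 s2 G"
    and G_bounded_below: "\<exists>b. \<forall>f. scale_continuous s1 s2 f \<longrightarrow> b \<le> G f"
  shows "(\<forall>v \<phi>. minimizing_sequence (admissible s1 s2 W nrm \<rho>) (objective s1 s2 W nrm \<rho> G)
                  (\<lambda>n. (v n, \<phi> n)) \<longrightarrow>
            (\<exists>B. \<forall>n. control_norm s1 s2 W nrm \<rho> (v n) \<le> B) \<and>
            (\<exists>r w. strict_mono r \<and>
               weakly_converges_on (controls s1 s2 W nrm \<rho>) (control_norm s1 s2 W nrm \<rho>)
                 (v \<circ> r) w)) \<and>
         (\<exists>c\<in>admissible s1 s2 W nrm \<rho>. \<forall>a\<in>admissible s1 s2 W nrm \<rho>.
            objective s1 s2 W nrm \<rho> G c \<le> objective s1 s2 W nrm \<rho> G a)"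
proof -
  let ?S = "WW s1 s2 W nrm \<rho>" and ?N = "WW_norm s1 s2 W nrm \<rho>"
  obtain ip where S: "semi_hilbert ?S ?N ip"
    using hilbert_space_on_semi_hilbert[OF WW_hilbert] by blast
  have V0: "rkhs (W 0) (nrm 0)" using W_rkhs by simp
  then obtain ipV where V: "semi_hilbert (W 0) (nrm 0) ipV"
    using hilbert_space_on_semi_hilbert unfolding rkhs_def by blast
  have "\<exists>c. scale_fields ?S ?N ip s1 s2 c"
  proof (rule H1_subspace_scale_fields[OF S _ WW_evaluation V _ _ p])
    show "?S \<subseteq> H1_space (W 0) (nrm 0) s1 s2" by (auto simp: WW_def)
    show "\<exists>K. \<forall>f\<in>W 0. norm (f x) \<le> K * nrm 0 f" for x using V0 by (simp add: rkhs_def)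
    show "W 0 \<subseteq> C0_space p" using V_embedded by (simp add: continuously_embedded_def)
  qed
  then obtain c where "scale_fields ?S ?N ip s1 s2 c" by blast
  then interpret scale_fields ?S ?N ip s1 s2 c .
  obtain b where b: "\<And>f. scale_continuous s1 s2 f \<Longrightarrow> b \<le> G f" using G_bounded_below by blast
  have eqs: "admissible s1 s2 W nrm \<rho> = pairs" "objective s1 s2 W nrm \<rho> G = cost G"
    "controls s1 s2 W nrm \<rho> = control.L2" "control_norm s1 s2 W nrm \<rho> = L2_norm ?N unit_time"
    by (simp_all add: admissible_def pairs_def objective_def cost_def controls_def control_norm_def)
  show ?thesis
    unfolding eqs
    using minimizing_sequence_bounded[where G = G and b = b, OF b]
      minimizing_sequence_weakly_convergent[where G = G and b = b, OF b]
      minimizer_exists[where G = G and b = b, OF b G_lsc]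
    by blast
qed

end
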